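(* Let $\kappa$ be a positive definite kernel on $X$, $\mathbf A=(A_i)_{i\in I}$ an $(I^+,I^-)$-condenser, and $\mathbf f$, $\mathbf a$, $\mathbf g$ as in the context. Then $$\bigl\langle W_\lambda^i,\lambda^i\bigr\rangle=\bigl\langle W_{\hat\lambda}^i,\hat\lambda^i\bigr\rangle$$ for any $\lambda,\hat\lambda\in\mathcal G_{\mathbf f}(\mathbf A,\mathbf a,\mathbf g)$ and all $i\in I$.
   Context: Let $X$ be a locally compact Hausdorff space and $\mathfrak M$ the space of real-valued (signed) Radon measures on $X$. For a locally compact space $Y$, $\Phi(Y)$ is the set of lower semicontinuous $\psi:Y\to(-\infty,\infty]$, with $\psi\ge0$ required unless $Y$ is compact. Write $\langle u,\nu\rangle:=\int u\,d\nu$. A kernel is an element $\kappa\in\Phi(X\times X)$; $\kappa(\nu,\nu_1):=\int\kappa\,d(\nu\otimes\nu_1)$ and $\kappa(x,\nu):=\int\kappa(x,y)\,d\nu(y)$ whenever well defined. $\kappa$ is positive definite if it is symmetric and $\kappa(\nu,\nu)\ge0$ for every $\nu\in\mathfrak M$ for which it is defined. Then $\mathcal E:=\{\nu\in\mathfrak M:-\infty<\kappa(\nu,\nu)<\infty\}$ is a pre-Hilbert space with scalar product $\kappa(\nu,\nu_1)$ and seminorm $\|\nu\|:=\sqrt{\kappa(\nu,\nu)}$. $\mathfrak M^+(E)$ is the set of nonnegative measures supported by the closed set $E$; $\mathcal E^+:=\mathfrak M^+(X)\cap\mathcal E$. The interior capacity of $E\subset X$ is $C(E):=[\inf\|\nu\|^2]^{-1}$,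 the infimum over $\nu\in\mathcal E^+$ with $\nu(X)=1$ and compact support contained in $E$ ($\inf\varnothing=\infty$, $1/\infty=0$, $1/0=\infty$). A property holds nearly everywhere (n.e.) in $E$ if the set of $x\in E$ where it fails has interior capacity zero. $I^+$, $I^-$ are disjoint countable (finite or infinite) sets of indices in $\mathbb N$, $I^-$ possibly empty, $I=I^+\cup I^-$; $\alpha_i=+1$ for $i\in I^+$ and $\alpha_i=-1$ for $i\in I^-$. An $(I^+,I^-)$-condenser is a family $\mathbf A=(A_i)_{i\in I}$ of nonempty closed sets in $X$ such that every compact set meets at most finitely many $A_i$ and $A_i\cap A_j=\varnothing$ for $i\in I^+$, $j\in I^-$. $\mathfrak M(\mathbf A):=\prod_{i\in I}\mathfrak M^+(A_i)$ consists of vector measures $\mu=(\mu^i)_{i\in I}$. Put $\kappa(\mu,\mu_1):=\sum_{i,j\in I}\alpha_i\alpha_j\kappa(\mu^i,\mu_1^j)$ and $\kappa_\mu=(\kappa^i_\mu)_{i\in I}$ with $\kappa_\mu^i(x):=\sum_{j\in I}\alpha_i\alpha_j\kappa(x,\mu^j)$. $\mathcal E(\mathbf A)$ is the set of $\mu\in\mathfrak M(\mathbf A)$ with $\kappa(\mu,\mu)$ finite (absolute convergence). External field: $\mathbf f=(f_i)_{i\in I}$, where for each $i$ there are $f_{i1},f_{i2}\in\Phi(X)$ with $f_{i2}\ne\infty$ n.e. in $X$ and $f_i=f_{i1}-f_{i2}$ (defined exactly where the right side is). $\mathbf g=(g_i)_{i\in I}$ with $g_i:A_i\to(0,\infty)$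 continuous; $\mathbf a=(a_i)_{i\in I}$ with $a_i>0$. $\langle\mathbf f,\mu\rangle:=\sum_{i\in I}\langle f_i,\mu^i\rangle$ (finite iff the series converges absolutely). $\mathbf W_\mu=(W^i_\mu)_{i\in I}:=\kappa_\mu+\mathbf f$ (for $\mu\in\mathcal E(\mathbf A)$ it is defined and $\ne-\infty$ n.e. in $X$) and $G_{\mathbf f}(\mu):=\kappa(\mu,\mu)+2\langle\mathbf f,\mu\rangle$. $\mathcal E_{\mathbf f}(\mathbf A,\mathbf a,\mathbf g)$ is the set of $\mu\in\mathcal E(\mathbf A)$ with $\langle g_i,\mu^i\rangle=a_i$ for all $i\in I$ and $\langle\mathbf f,\mu\rangle$ finite. $G_{\mathbf f}(\mathbf A,\mathbf a,\mathbf g):=\inf_{\mu\in\mathcal E_{\mathbf f}(\mathbf A,\mathbf a,\mathbf g)}G_{\mathbf f}(\mu)$ ($\inf\varnothing=+\infty$). $\mathcal G_{\mathbf f}(\mathbf A,\mathbf a,\mathbf g)$ is the set of $\lambda\in\mathcal E_{\mathbf f}(\mathbf A,\mathbf a,\mathbf g)$ with $G_{\mathbf f}(\lambda)=G_{\mathbf f}(\mathbf A,\mathbf a,\mathbf g)$ (equilibrium measures). *)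

theory Defs
  imports "HOL-Analysis.Analysis"
begin

section \<open>Partially defined extended real quantities\<close>

text \<open>
  Functions such as \<open>f1 - f2\<close>, and integrals and series of extended real functions, are not
  defined everywhere. They are modelled by \<^typ>\<open>ereal option\<close>, with \<^term>\<open>None\<close> for
  ``undefined''. The sum is undefined if a summand is, or for \<open>\<infinity> + (-\<infinity>)\<close>.
\<close>

definition padd :: "ereal option \<Rightarrow> ereal option \<Rightarrow> ereal option" where
  "padd a b = (case (a, b) of
      (Some x, Some y) \<Rightarrow>
        if x = \<infinity> \<and> y = -\<infinity> \<or> x = -\<infinity> \<and> y = \<infinity> then None else Some (x + y)
    | _ \<Rightarrow> None)"

definition pdiff :: "ereal option \<Rightarrow> ereal option \<Rightarrow> ereal option" where
  "pdiff a b = padd a (map_option uminus b)"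

definition pscale :: "ereal \<Rightarrow> ereal option \<Rightarrow> ereal option" where
  "pscale c a = map_option (\<lambda>x. c * x) a"

definition pfinite :: "ereal option \<Rightarrow> bool" where
  "pfinite a \<longleftrightarrow> (\<exists>r::real. a = Some (ereal r))"

text \<open>
  \<open>pairing u \<nu>\<close> is \<open>\<langle>u,\<nu>\<rangle> = \<integral>u\<^sup>+ d\<nu> - \<integral>u\<^sup>- d\<nu>\<close>. It is defined if \<open>u\<close> is defined and
  measurable up to a null set and the two integrals are not both infinite. Note that
  \<^const>\<open>e2ennreal\<close> maps negative numbers to \<open>0\<close>, so it computes the positive part.
\<close>

definition pairing :: "('b \<rightharpoonup> ereal) \<Rightarrow> 'b measure \<Rightarrow> ereal option" where
  "pairing u \<nu> =
    (if \<exists>v\<in>borel_measurable \<nu>. AE x in \<nu>. u x = Some (v x)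
     then pdiff (Some (enn2ereal (\<integral>\<^sup>+x. e2ennreal (the (u x)) \<partial>\<nu>)))
                (Some (enn2ereal (\<integral>\<^sup>+x. e2ennreal (- the (u x)) \<partial>\<nu>)))
     else None)"

text \<open>
  A series is the integral with respect to counting measure: the sum of its positive terms
  minus the sum of the absolute values of its negative terms. Hence it is finite iff it
  converges absolutely, and it is undefined if some term is.
\<close>

definition series :: "('i \<rightharpoonup> ereal) \<Rightarrow> 'i set \<Rightarrow> ereal option" where
  "series u J = pairing u (count_space J)"


section \<open>Radon measures and kernels\<close>

text \<open>
  A nonnegative Radon measure (positive functional on \<open>C\<^sub>c\<close>) is represented by the unique
  Borel measure, finite on compact sets, that is inner regular on open sets and outer regular
  on Borel sets.
\<close>

definition radon :: "'b::topological_space measure \<Rightarrow> bool" where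
  "radon \<nu> \<longleftrightarrow> sets \<nu> = sets borel \<and>
    (\<forall>K. compact K \<longrightarrow> emeasure \<nu> K < \<infinity>) \<and>
    (\<forall>U. open U \<longrightarrow> emeasure \<nu> U = (SUP K\<in>{K. compact K \<and> K \<subseteq> U}. emeasure \<nu> K)) \<and>
    (\<forall>B\<in>sets borel. emeasure \<nu> B = (INF U\<in>{U. open U \<and> B \<subseteq> U}. emeasure \<nu> U))"

text \<open>
  A signed Radon measure is a difference of two possibly infinite measures, so it need not be
  a set function on the Borel sets. It is represented by its Jordan decomposition
  \<open>(\<nu>\<^sup>+, \<nu>\<^sup>-)\<close>. Mutual singularity is required on compact sets only: this is what
  \<open>inf \<nu>\<^sup>+ \<nu>\<^sup>- = 0\<close> means for Radon measures, and a single Borel set separating the two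
  measures globally need not exist on a space that is not \<open>\<sigma>\<close>-compact.
\<close>

definition signed_radon :: "('b::topological_space measure \<times> 'b measure) set" where
  "signed_radon = {(P, N). radon P \<and> radon N \<and>
    (\<forall>K. compact K \<longrightarrow>
      (\<exists>S\<in>sets borel. emeasure P (K \<inter> S) = 0 \<and> emeasure N (K - S) = 0))}"

text \<open>
  The Radon measure on the product space. It lives on the Borel sets of the product topology,
  which in general form a larger \<open>\<sigma>\<close>-algebra than that of \<^const>\<open>pair_measure\<close>.
\<close>

definition radon_prod ::
    "'b::topological_space measure \<Rightarrow> 'c::topological_space measure \<Rightarrow> ('b \<times> 'c) measure" where
  "radon_prod \<nu> \<nu>1 = (THE \<rho>. radon \<rho> \<and>
    (\<forall>K L. compact K \<and> compact L \<longrightarrow>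
      emeasure \<rho> (K \<times> L) = emeasure \<nu> K * emeasure \<nu>1 L))"

definition msupport :: "'b::topological_space measure \<Rightarrow> 'b set" where
  "msupport \<nu> = {x. \<forall>U. open U \<and> x \<in> U \<longrightarrow> emeasure \<nu> U \<noteq> 0}"

definition Mplus :: "'b::topological_space set \<Rightarrow> 'b measure set" where
  "Mplus E = {\<nu>. radon \<nu> \<and> msupport \<nu> \<subseteq> E}"

definition lsc :: "('b::topological_space \<Rightarrow> ereal) \<Rightarrow> bool" where
  "lsc \<psi> \<longleftrightarrow> (\<forall>t. open {y. t < \<psi> y})"

definition Phi :: "('b::topological_space \<Rightarrow> ereal) set" where
  "Phi = {\<psi>. lsc \<psi> \<and> (\<forall>y. \<psi> y \<noteq> -\<infinity>) \<and>
    (\<not> compact (UNIV :: 'b set) \<longrightarrow> (\<forall>y. 0 \<le> \<psi> y))}"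

type_synonym 'a kernel = "'a \<times> 'a \<Rightarrow> ereal"

definition potential :: "'a::topological_space kernel \<Rightarrow> 'a measure \<Rightarrow> 'a \<rightharpoonup> ereal" where
  "potential \<kappa> \<nu> x = pairing (\<lambda>y. Some (\<kappa> (x, y))) \<nu>"

definition energy :: "'a::topological_space kernel \<Rightarrow> 'a measure \<Rightarrow> 'a measure \<Rightarrow> ereal option" where
  "energy \<kappa> \<nu> \<nu>1 = pairing (\<lambda>z. Some (\<kappa> z)) (radon_prod \<nu> \<nu>1)"

text \<open>
  The integral against \<open>\<nu> \<otimes> \<nu>1\<close> for signed measures, whose positive and negative parts
  are \<open>\<nu>\<^sup>+ \<otimes> \<nu>1\<^sup>+ + \<nu>\<^sup>- \<otimes> \<nu>1\<^sup>-\<close> and \<open>\<nu>\<^sup>+ \<otimes> \<nu>1\<^sup>- + \<nu>\<^sup>- \<otimes> \<nu>1\<^sup>+\<close>.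
\<close>

definition signed_energy ::
    "'a::topological_space kernel \<Rightarrow> 'a measure \<times> 'a measure \<Rightarrow> 'a measure \<times> 'a measure
      \<Rightarrow> ereal option" where
  "signed_energy \<kappa> \<nu> \<nu>1 = pdiff
    (padd (energy \<kappa> (fst \<nu>) (fst \<nu>1)) (energy \<kappa> (snd \<nu>) (snd \<nu>1)))
    (padd (energy \<kappa> (fst \<nu>) (snd \<nu>1)) (energy \<kappa> (snd \<nu>) (fst \<nu>1)))"

definition positive_definite :: "'a::topological_space kernel \<Rightarrow> bool" where
  "positive_definite \<kappa> \<longleftrightarrow> (\<forall>x y. \<kappa> (x, y) = \<kappa> (y, x)) \<and>
    (\<forall>\<nu>\<in>signed_radon. \<forall>e. signed_energy \<kappa> \<nu> \<nu> = Some e \<longrightarrow> 0 \<le> e)"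

definition Eplus :: "'a::topological_space kernel \<Rightarrow> 'a measure set" where
  "Eplus \<kappa> = {\<nu>\<in>Mplus UNIV. pfinite (energy \<kappa> \<nu> \<nu>)}"

text \<open>
  In \<^typ>\<open>ereal\<close> the infimum of the empty set is \<open>\<infinity>\<close>, \<open>inverse \<infinity> = 0\<close> and
  \<open>inverse 0 = \<infinity>\<close>.
\<close>

definition capacity :: "'a::topological_space kernel \<Rightarrow> 'a set \<Rightarrow> ereal" where
  "capacity \<kappa> E = inverse
    (INF \<nu>\<in>{\<nu>\<in>Eplus \<kappa>. emeasure \<nu> UNIV = 1 \<and> compact (msupport \<nu>) \<and> msupport \<nu> \<subseteq> E}.
      the (energy \<kappa> \<nu> \<nu>))"

definition nearly_everywhere ::
    "'a::topological_space kernel \<Rightarrow> 'a set \<Rightarrow> ('a \<Rightarrow> bool) \<Rightarrow> bool" where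
  "nearly_everywhere \<kappa> E P \<longleftrightarrow> capacity \<kappa> {x\<in>E. \<not> P x} = 0"


section \<open>Condensers and vector measures\<close>

definition alpha :: "nat set \<Rightarrow> nat \<Rightarrow> ereal" where
  "alpha Ipos i = (if i \<in> Ipos then 1 else -1)"

definition condenser :: "nat set \<Rightarrow> nat set \<Rightarrow> (nat \<Rightarrow> 'a::topological_space set) \<Rightarrow> bool" where
  "condenser Ipos Ineg A \<longleftrightarrow> Ipos \<inter> Ineg = {} \<and>
    (\<forall>i\<in>Ipos \<union> Ineg. A i \<noteq> {} \<and> closed (A i)) \<and>
    (\<forall>K. compact K \<longrightarrow> finite {i\<in>Ipos \<union> Ineg. A i \<inter> K \<noteq> {}}) \<and>
    (\<forall>i\<in>Ipos. \<forall>j\<in>Ineg. A i \<inter> A j = {})"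

text \<open>
  Families indexed by \<open>I\<close> are functions on \<^typ>\<open>nat\<close>; their values outside \<open>I\<close> play no role.
\<close>

definition vmeasures ::
    "nat set \<Rightarrow> nat set \<Rightarrow> (nat \<Rightarrow> 'a::topological_space set) \<Rightarrow> (nat \<Rightarrow> 'a measure) set" where
  "vmeasures Ipos Ineg A = (\<Pi> i\<in>Ipos \<union> Ineg. Mplus (A i))"

definition venergy ::
    "'a::topological_space kernel \<Rightarrow> nat set \<Rightarrow> nat set \<Rightarrow> (nat \<Rightarrow> 'a measure) \<Rightarrow>
      (nat \<Rightarrow> 'a measure) \<Rightarrow> ereal option" where
  "venergy \<kappa> Ipos Ineg \<mu> \<mu>1 =
    series (\<lambda>(i, j). pscale (alpha Ipos i * alpha Ipos j) (energy \<kappa> (\<mu> i) (\<mu>1 j)))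
      ((Ipos \<union> Ineg) \<times> (Ipos \<union> Ineg))"

definition vpotential ::
    "'a::topological_space kernel \<Rightarrow> nat set \<Rightarrow> nat set \<Rightarrow> (nat \<Rightarrow> 'a measure) \<Rightarrow> nat \<Rightarrow>
      'a \<rightharpoonup> ereal" where
  "vpotential \<kappa> Ipos Ineg \<mu> i x =
    series (\<lambda>j. pscale (alpha Ipos i * alpha Ipos j) (potential \<kappa> (\<mu> j) x)) (Ipos \<union> Ineg)"

definition E_cond ::
    "'a::topological_space kernel \<Rightarrow> nat set \<Rightarrow> nat set \<Rightarrow> (nat \<Rightarrow> 'a set) \<Rightarrow>
      (nat \<Rightarrow> 'a measure) set" where
  "E_cond \<kappa> Ipos Ineg A = {\<mu>\<in>vmeasures Ipos Ineg A. pfinite (venergy \<kappa> Ipos Ineg \<mu> \<mu>)}"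


section \<open>External fields and equilibrium measures\<close>

definition external_field ::
    "'a::topological_space kernel \<Rightarrow> nat set \<Rightarrow> nat set \<Rightarrow> (nat \<Rightarrow> 'a \<rightharpoonup> ereal) \<Rightarrow> bool" where
  "external_field \<kappa> Ipos Ineg f \<longleftrightarrow> (\<forall>i\<in>Ipos \<union> Ineg. \<exists>f1\<in>Phi. \<exists>f2\<in>Phi.
    nearly_everywhere \<kappa> UNIV (\<lambda>x. f2 x \<noteq> \<infinity>) \<and>
    (\<forall>x. f i x = pdiff (Some (f1 x)) (Some (f2 x))))"

definition field_pairing ::
    "nat set \<Rightarrow> nat set \<Rightarrow> (nat \<Rightarrow> 'a \<rightharpoonup> ereal) \<Rightarrow> (nat \<Rightarrow> 'a measure) \<Rightarrow> ereal option" where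
  "field_pairing Ipos Ineg f \<mu> = series (\<lambda>i. pairing (f i) (\<mu> i)) (Ipos \<union> Ineg)"

definition weighted_potential ::
    "'a::topological_space kernel \<Rightarrow> nat set \<Rightarrow> nat set \<Rightarrow> (nat \<Rightarrow> 'a \<rightharpoonup> ereal) \<Rightarrow>
      (nat \<Rightarrow> 'a measure) \<Rightarrow> nat \<Rightarrow> 'a \<rightharpoonup> ereal" where
  "weighted_potential \<kappa> Ipos Ineg f \<mu> i x = padd (vpotential \<kappa> Ipos Ineg \<mu> i x) (f i x)"

definition weighted_energy ::
    "'a::topological_space kernel \<Rightarrow> nat set \<Rightarrow> nat set \<Rightarrow> (nat \<Rightarrow> 'a \<rightharpoonup> ereal) \<Rightarrow>
      (nat \<Rightarrow> 'a measure) \<Rightarrow> ereal option" where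
  "weighted_energy \<kappa> Ipos Ineg f \<mu> =
    padd (venergy \<kappa> Ipos Ineg \<mu> \<mu>) (pscale 2 (field_pairing Ipos Ineg f \<mu>))"

text \<open>The function \<open>g i\<close> is only given on \<open>A i\<close>, whence the restriction in the pairing.\<close>

definition admissible ::
    "'a::topological_space kernel \<Rightarrow> nat set \<Rightarrow> nat set \<Rightarrow> (nat \<Rightarrow> 'a set) \<Rightarrow>
      (nat \<Rightarrow> 'a \<rightharpoonup> ereal) \<Rightarrow> (nat \<Rightarrow> real) \<Rightarrow> (nat \<Rightarrow> 'a \<Rightarrow> real) \<Rightarrow> (nat \<Rightarrow> 'a measure) set" where
  "admissible \<kappa> Ipos Ineg A f a g = {\<mu>\<in>E_cond \<kappa> Ipos Ineg A.
    (\<forall>i\<in>Ipos \<union> Ineg. pairing ((\<lambda>x. Some (ereal (g i x))) |` A i) (\<mu> i) = Some (ereal (a i))) \<and>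
    pfinite (field_pairing Ipos Ineg f \<mu>)}"

definition min_weighted_energy ::
    "'a::topological_space kernel \<Rightarrow> nat set \<Rightarrow> nat set \<Rightarrow> (nat \<Rightarrow> 'a set) \<Rightarrow>
      (nat \<Rightarrow> 'a \<rightharpoonup> ereal) \<Rightarrow> (nat \<Rightarrow> real) \<Rightarrow> (nat \<Rightarrow> 'a \<Rightarrow> real) \<Rightarrow> ereal" where
  "min_weighted_energy \<kappa> Ipos Ineg A f a g =
    (INF \<mu>\<in>admissible \<kappa> Ipos Ineg A f a g. the (weighted_energy \<kappa> Ipos Ineg f \<mu>))"

definition equilibrium_measures ::
    "'a::topological_space kernel \<Rightarrow> nat set \<Rightarrow> nat set \<Rightarrow> (nat \<Rightarrow> 'a set) \<Rightarrow>
      (nat \<Rightarrow> 'a \<rightharpoonup> ereal) \<Rightarrow> (nat \<Rightarrow> real) \<Rightarrow> (nat \<Rightarrow> 'a \<Rightarrow> real) \<Rightarrow> (nat \<Rightarrow> 'a measure) set" where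
  "equilibrium_measures \<kappa> Ipos Ineg A f a g = {\<mu>\<in>admissible \<kappa> Ipos Ineg A f a g.
    weighted_energy \<kappa> Ipos Ineg f \<mu> = Some (min_weighted_energy \<kappa> Ipos Ineg A f a g)}"

end

theory Submission
  imports Defs
begin

text \<open>
  Two minimizers \<open>l\<close>, \<open>l'\<close> are compared along families \<open>(1 - t\<^sub>j) l\<^sub>j + t\<^sub>j l'\<^sub>j\<close> with
  \<open>0 \<le> t\<^sub>j \<le> 1\<close>, which are admissible, and whose weighted energy is a quadratic polynomial
  in \<open>t\<close>. Taking all \<open>t\<^sub>j = 1/2\<close>, minimality and the parallelogram identity give
  \<open>\<parallel>l - l'\<parallel>\<^sup>2 \<le> 0\<close>. For a positive semidefinite form this forces, by the Cauchy-Schwarz argument,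
  that \<open>l\<close> and \<open>l'\<close> have the same mutual energy with every family of finite energy. Moving only
  component \<open>i\<close>, the first order condition at \<open>t = 0\<close> reads
  \<open>\<langle>W\<^sub>l\<^sup>i, l'\<^sub>i\<rangle> \<ge> \<langle>W\<^sub>l\<^sup>i, l\<^sub>i\<rangle>\<close>, and symmetrically with \<open>l\<close> and \<open>l'\<close> exchanged. As
  \<open>W\<^sub>l\<^sup>i\<close> and \<open>W\<^sub>l\<^sub>'\<^sup>i\<close> pair equally with both measures, the two inequalities are opposite and
  equality follows. This is \<open>variational_equality\<close>, a statement about semidefinite forms; it is
  applied in \<open>equilibrium_interaction\<close>.

  The rest of the theory gives the terms of this argument their meaning.

  \<^item> Energies are integrals against \<^const>\<open>radon_prod\<close>, whose existence and uniqueness have to be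
  shown. On an open set \<open>W\<close> the product must be \<open>\<integral>\<nu>(W\<^sub>x) d\<mu>(x)\<close>, and Caratheodory's method
  extends this content to the Borel sets (\<open>radon_prod_exists\<close>). As Radon measures may
  fail to be \<open>\<sigma>\<close>-finite, measurability and the theorem of Fubini rest on lower semicontinuity
  and on the continuity of Radon measures along directed families
  (\<open>radon_directed_SUP\<close>, \<open>nn_integral_radon_prod\<close>).

  \<^item> Positive definiteness speaks of mutually singular pairs. It is transferred to arbitrary pairs
  of finite energy by restricting to a compact set, cancelling the common part of the two
  measures, and exhausting the space (\<open>energy_cross\<close>). In particular mutual energies of measures
  of finite energy are finite.

  \<^item> For infinitely many plates the energy is an absolutely convergent double series. Positive
  definiteness on finite sets of indices bounds the series of mutual energies between \<open>l\<close> and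
  \<open>l'\<close> (\<open>M_summable\<close>), and integration of the potential term by term
  (\<open>weighted_potential_pairing\<close>) identifies \<open>\<langle>W\<^sub>l\<^sup>i, l\<^sub>i\<rangle>\<close> with a row of the energy series plus
  \<open>\<langle>f\<^sub>i, l\<^sub>i\<rangle>\<close>.

  \<^item> A kernel that takes negative values lives on a compact space, where it is bounded below. All
  integrals are therefore taken of \<open>\<kappa> + c \<ge> 0\<close> for a constant \<open>c\<close> that vanishes unless the
  space is compact; in the compact case masses are finite and there are finitely many plates.
\<close>

section \<open>Locally compact Hausdorff spaces\<close>

lemma locally_compact_nbhd_point:
  fixes x :: "'b::t2_space"
  assumes "locally_compact_space (euclidean :: 'b topology)" "open U" "x \<in> U"
  obtains V where "open V" "x \<in> V" "compact (closure V)" "closure V \<subseteq> U"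
proof -
  have haus: "Hausdorff_space (euclidean :: 'b topology)"
    unfolding Hausdorff_space_def by (auto simp: disjnt_def) (metis hausdorff)
  have "neighbourhood_base_of (\<lambda>C::'b set. compact C \<and> closed C) euclidean"
    using assms(1) locally_compact_space_neighbourhood_base_closedin[OF disjI1, OF haus] by simp
  then obtain V C where "open V" "compact C" "closed C" "x \<in> V" "V \<subseteq> C" "C \<subseteq> U"
    using assms(2,3) unfolding neighbourhood_base_of by (metis open_openin)
  moreover from this have "closure V \<subseteq> C" by (intro closure_minimal)
  moreover from this have "compact (closure V)"
    using \<open>compact C\<close> compact_Int_closed[of C "closure V"] by (simp add: Int_absorb1)
  ultimately show thesis by (intro that[of V]) auto
qed

lemma locally_compact_nbhd:
  fixes K :: "'b::t2_space set"
  assumes lc: "locally_compact_space (euclidean :: 'b topology)" and "compact K" "open U" "K \<subseteq> U"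
  obtains V where "open V" "K \<subseteq> V" "compact (closure V)" "closure V \<subseteq> U"
proof -
  have "\<exists>V. open V \<and> x \<in> V \<and> compact (closure V) \<and> closure V \<subseteq> U" if "x \<in> K" for x
    using locally_compact_nbhd_point[OF lc \<open>open U\<close>] that \<open>K \<subseteq> U\<close> by (metis subsetD)
  then obtain V where V: "\<And>x. x \<in> K \<Longrightarrow> open (V x) \<and> x \<in> V x \<and> compact (closure (V x)) \<and> closure (V x) \<subseteq> U"
    by metis
  obtain F where F: "F \<subseteq> K" "finite F" "K \<subseteq> (\<Union>x\<in>F. V x)"
    using compactE_image[OF \<open>compact K\<close>, of K V] V by (metis UN_iff subsetI)
  have cl: "closure (\<Union>x\<in>F. V x) = (\<Union>x\<in>F. closure (V x))"
    using F(2) by (induction F) auto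
  show thesis
  proof (rule that)
    show "open (\<Union>x\<in>F. V x)" using F V by blast
    show "K \<subseteq> (\<Union>x\<in>F. V x)" by fact
    show "compact (closure (\<Union>x\<in>F. V x))" unfolding cl using F V by (intro compact_UN) auto
    show "closure (\<Union>x\<in>F. V x) \<subseteq> U" unfolding cl using F V by blast
  qed
qed

lemma locally_compact_Times:
  assumes "locally_compact_space (euclidean :: 'b::topological_space topology)"
    and "locally_compact_space (euclidean :: 'c::topological_space topology)"
  shows "locally_compact_space (euclidean :: ('b \<times> 'c) topology)"
  unfolding locally_compact_space_def
proof (intro ballI)
  fix z :: "'b \<times> 'c"
  obtain U K where 1: "open U" "compact K" "fst z \<in> U" "U \<subseteq> K"
    using assms(1) unfolding locally_compact_space_def topspace_euclidean
    by (metis UNIV_I compactin_euclidean_iff open_openin)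
  obtain V L where 2: "open V" "compact L" "snd z \<in> V" "V \<subseteq> L"
    using assms(2) unfolding locally_compact_space_def topspace_euclidean
    by (metis UNIV_I compactin_euclidean_iff open_openin)
  show "\<exists>U K. openin euclidean U \<and> compactin euclidean K \<and> z \<in> U \<and> U \<subseteq> K"
    using 1 2 by (intro exI[of _ "U \<times> V"] exI[of _ "K \<times> L"])
      (auto intro: open_Times compact_Times simp: mem_Times_iff)
qed

section \<open>Radon measures from contents on open sets\<close>

text \<open>
  The outer measure is \<open>B \<mapsto> inf r(U)\<close> over open \<open>U \<supseteq> B\<close>. Open sets \<open>U\<close> are Caratheodory
  measurable because of inner approximation: if \<open>Q\<close> has its closure in \<open>V \<inter> U\<close>, then \<open>Q\<close> and
  \<open>V - closure Q\<close> are disjoint open subsets of \<open>V\<close>, and the second one contains \<open>V - U\<close>.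
\<close>

lemma radon_from_content:
  fixes r :: "'b::t2_space set \<Rightarrow> ennreal"
  assumes empty: "r {} = 0"
    and mono: "\<And>U V. open U \<Longrightarrow> open V \<Longrightarrow> U \<subseteq> V \<Longrightarrow> r U \<le> r V"
    and sub: "\<And>U. (\<And>n. open (U n)) \<Longrightarrow> r (\<Union>n::nat. U n) \<le> (\<Sum>n. r (U n))"
    and disj: "\<And>U V. open U \<Longrightarrow> open V \<Longrightarrow> U \<inter> V = {} \<Longrightarrow> r U + r V \<le> r (U \<union> V)"
    and inner: "\<And>U. open U \<Longrightarrow> r U \<le> (SUP Q\<in>{Q. open Q \<and> compact (closure Q) \<and> closure Q \<subseteq> U}. r Q)"
    and fin: "\<And>K. compact K \<Longrightarrow> \<exists>U. open U \<and> K \<subseteq> U \<and> r U < \<infinity>"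
  obtains \<rho> where "radon \<rho>" "\<And>U. open U \<Longrightarrow> emeasure \<rho> U = r U"
proof -
  define m where "m B = (INF U\<in>{U. open U \<and> B \<subseteq> U}. r U)" for B
  have m_le: "m B \<le> r U" if "open U" "B \<subseteq> U" for B U
    unfolding m_def using that by (intro INF_lower) auto
  have m_open: "m U = r U" if "open U" for U
    by (rule antisym[OF m_le]) (use that in \<open>auto simp: m_def intro!: INF_greatest mono\<close>)
  have m_mono: "m B \<le> m C" if "B \<subseteq> C" for B C
    unfolding m_def using that by (intro INF_superset_mono) auto
  have oms: "outer_measure_space (Pow UNIV) m"
    unfolding outer_measure_space_def
  proof (intro conjI)
    show "positive (Pow UNIV) m" using m_open[of "{}"] empty by (simp add: positive_def)
    show "increasing (Pow UNIV) m" using m_mono by (auto simp: increasing_def)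
    show "countably_subadditive (Pow UNIV) m"
      unfolding countably_subadditive_def
    proof (intro allI impI)
      fix B :: "nat \<Rightarrow> 'b set"
      show "m (\<Union>i. B i) \<le> (\<Sum>i. m (B i))"
      proof (rule ennreal_le_epsilon)
        fix e :: real assume e: "0 < e" and fin: "(\<Sum>i. m (B i)) < top"
        have pos: "0 < ennreal (e * (1/2)^Suc i)" for i using e by simp
        have "\<exists>U. open U \<and> B i \<subseteq> U \<and> r U < m (B i) + ennreal (e * (1/2)^Suc i)" for i
        proof -
          have "m (B i) < top"
            using ennreal_suminf_lessD[OF fin] by auto
          then have "m (B i) < m (B i) + ennreal (e * (1/2)^Suc i)"
            using pos[of i] by (metis add.right_neutral ennreal_add_left_cancel_less infinity_ennreal_def)
          then show ?thesis by (subst (asm) m_def) (auto simp: INF_less_iff)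
        qed
        then obtain U where U: "\<And>i. open (U i)" "\<And>i. B i \<subseteq> U i"
            "\<And>i. r (U i) < m (B i) + ennreal (e * (1/2)^Suc i)" by metis
        have "m (\<Union>i. B i) \<le> r (\<Union>i. U i)" using U by (intro m_le) (auto intro: open_UN)
        also have "\<dots> \<le> (\<Sum>i. r (U i))" by (rule sub) (rule U)
        also have "\<dots> \<le> (\<Sum>i. m (B i) + ennreal (e * (1/2)^Suc i))"
          using U(3) by (intro suminf_le) (auto intro: less_imp_le)
        also have "\<dots> = (\<Sum>i. m (B i)) + (\<Sum>i. ennreal (e * (1/2)^Suc i))"
          by (rule suminf_add[symmetric]) auto
        also have "(\<Sum>i. ennreal (e * (1/2)^Suc i)) = ennreal e"
          using sums_mult[OF power_half_series, of e] e by (intro suminf_ennreal_eq) auto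
        finally show "m (\<Union>i. B i) \<le> (\<Sum>i. m (B i)) + ennreal e" .
      qed
    qed
  qed
  define L where "L = lambda_system UNIV (Pow UNIV) m"
  interpret P: sigma_algebra UNIV "Pow UNIV :: 'b set set" by (rule sigma_algebra_Pow)
  have ms: "measure_space UNIV L m" unfolding L_def by (rule P.caratheodory_lemma[OF oms])
  have "subadditive (Pow UNIV) m"
    using oms P.countably_subadditive_subadditive[of m] by (auto simp: outer_measure_space_def)
  then have subadd: "m (B \<union> C) \<le> m B + m C" if "B \<inter> C = {}" for B C
    using that by (auto simp: subadditive_def)
  have open_L: "U \<in> L" if U: "open U" for U
    unfolding L_def P.lambda_system_eq
  proof (intro CollectI conjI ballI antisym)
    fix B
    have "m B = m ((B \<inter> U) \<union> (B - U))" by (simp add: Int_Diff_Un)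
    then show "m B \<le> m (B \<inter> U) + m (B - U)" using subadd[of "B \<inter> U" "B - U"] by auto
    show "m (B \<inter> U) + m (B - U) \<le> m B"
      unfolding m_def[of B]
    proof (rule INF_greatest, clarify)
      fix V assume V: "open V" "B \<subseteq> V"
      have "m (B \<inter> U) + m (B - U) \<le> r (V \<inter> U) + m (V - U)"
        using V U by (intro add_mono m_le m_mono) auto
      also have "\<dots> \<le> (SUP Q\<in>{Q. open Q \<and> compact (closure Q) \<and> closure Q \<subseteq> V \<inter> U}. r Q) + m (V - U)"
        using U V by (intro add_mono inner) auto
      also have "\<dots> = (SUP Q\<in>{Q. open Q \<and> compact (closure Q) \<and> closure Q \<subseteq> V \<inter> U}. r Q + m (V - U))"
        by (rule ennreal_SUP_add_left[symmetric]) (auto intro!: exI[of _ "{}"])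
      also have "\<dots> \<le> r V"
      proof (rule SUP_least, clarify)
        fix Q assume Q: "open Q" "compact (closure Q)" "closure Q \<subseteq> V \<inter> U"
        have "r Q + m (V - U) \<le> r Q + r (V - closure Q)"
          using Q V by (intro add_left_mono m_le) auto
        also have "\<dots> \<le> r (Q \<union> (V - closure Q))"
          using Q V closure_subset[of Q] by (intro disj) auto
        also have "\<dots> \<le> r V" using Q V closure_subset[of Q] by (intro mono) auto
        finally show "r Q + m (V - U) \<le> r V" .
      qed
      finally show "m (B \<inter> U) + m (B - U) \<le> r V" .
    qed
  qed auto
  interpret L: sigma_algebra UNIV L using ms by (simp add: measure_space_def)
  have sL: "sets borel \<subseteq> L"
    unfolding borel_def using open_L by (subst sets_measure_of) (auto intro!: L.sigma_sets_subset)
  have ms2: "measure_space UNIV (sets borel) m"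
    using measure_down[OF ms _ sL] sets.sigma_algebra_axioms[of "borel::'b measure"] by simp
  define \<rho> where "\<rho> = measure_of UNIV (sets borel) m"
  have sets: "sets \<rho> = sets borel"
    unfolding \<rho>_def by (metis sets.sigma_sets_eq sets_measure_of space_borel subset_UNIV Pow_UNIV)
  have em: "emeasure \<rho> B = m B" if "B \<in> sets borel" for B
    unfolding \<rho>_def using ms2 that
    by (intro emeasure_measure_of_sigma) (auto simp: measure_space_def)
  have "radon \<rho>"
    unfolding radon_def
  proof (intro conjI allI impI ballI)
    fix K :: "'b set" assume "compact K"
    then show "emeasure \<rho> K < \<infinity>"
      using fin[of K] m_le by (subst em) (auto intro: borel_compact le_less_trans)
  next
    fix U :: "'b set" assume U: "open U"
    show "emeasure \<rho> U = (SUP K\<in>{K. compact K \<and> K \<subseteq> U}. emeasure \<rho> K)"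
    proof (rule antisym)
      have "emeasure \<rho> U \<le> (SUP Q\<in>{Q. open Q \<and> compact (closure Q) \<and> closure Q \<subseteq> U}. r Q)"
        using inner[OF U] em[of U] m_open U by simp
      also have "\<dots> \<le> (SUP K\<in>{K. compact K \<and> K \<subseteq> U}. emeasure \<rho> K)"
      proof (rule SUP_least, clarify)
        fix Q assume Q: "open Q" "compact (closure Q)" "closure Q \<subseteq> U"
        have "r Q \<le> emeasure \<rho> (closure Q)"
          using Q m_open m_mono[OF closure_subset[of Q]] by (subst em) auto
        then show "r Q \<le> (SUP K\<in>{K. compact K \<and> K \<subseteq> U}. emeasure \<rho> K)"
          using Q by (intro SUP_upper2[of "closure Q"]) auto
      qed
      finally show "emeasure \<rho> U \<le> (SUP K\<in>{K. compact K \<and> K \<subseteq> U}. emeasure \<rho> K)" .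
      show "(SUP K\<in>{K. compact K \<and> K \<subseteq> U}. emeasure \<rho> K) \<le> emeasure \<rho> U"
        using U by (intro SUP_least emeasure_mono) (auto simp: sets)
    qed
  next
    fix B :: "'b set" assume B: "B \<in> sets borel"
    show "emeasure \<rho> B = (INF U\<in>{U. open U \<and> B \<subseteq> U}. emeasure \<rho> U)"
      unfolding em[OF B] m_def by (intro INF_cong refl) (simp add: em m_open)
  qed (rule sets)
  then show thesis using em m_open by (intro that[of \<rho>]) auto
qed

section \<open>Lower semicontinuous functions and Radon measures\<close>

definition lsc_nn :: "('b::topological_space \<Rightarrow> ennreal) \<Rightarrow> bool" where
  "lsc_nn h \<longleftrightarrow> (\<forall>t. open {x. t < h x})"

lemma lsc_nn_open: "lsc_nn h \<Longrightarrow> open {x. t < h x}"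
  by (simp add: lsc_nn_def)

lemma lsc_nn_measurable: "lsc_nn h \<Longrightarrow> h \<in> borel_measurable borel"
  by (rule borel_measurableI_greater) (auto simp: lsc_nn_def)

lemma lsc_nn_SUP: "(\<And>h. h \<in> D \<Longrightarrow> lsc_nn h) \<Longrightarrow> lsc_nn (\<lambda>x. SUP h\<in>D. h x)"
  by (auto simp: lsc_nn_def less_SUP_iff Collect_bex_eq)

lemma lsc_nn_indicator_mult:
  assumes "lsc_nn h" "open U"
  shows "lsc_nn (\<lambda>x. h x * indicator U x)"
  unfolding lsc_nn_def
proof
  fix t
  have "{x. t < h x * indicator U x} = {x. t < h x} \<inter> U" by (auto simp: indicator_def)
  then show "open {x. t < h x * indicator U x}" using assms by (auto simp: lsc_nn_def)
qed

text \<open>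
  The staircase of mesh \<open>1/n\<close> below \<open>v\<close>, cut off at height \<open>n\<close>. Applied to a lower
  semicontinuous function it is a finite sum of multiples of indicators of open sets.
\<close>

definition step :: "nat \<Rightarrow> ennreal \<Rightarrow> ennreal" where
  "step n v = (\<Sum>m=1..n*n. if ennreal (real m / real n) < v then ennreal (1 / real n) else 0)"

lemma step_le: "step n v \<le> v"
proof (cases v)
  case (real r)
  let ?M = "{m\<in>{1..n*n}. ennreal (real m / real n) < v}"
  show ?thesis
  proof (cases "n = 0")
    case False
    have "?M \<subseteq> {1..nat \<lfloor>r * real n\<rfloor>}"
    proof
      fix m assume "m \<in> ?M"
      then have "real m / real n < r" "1 \<le> m" using real by (auto simp: ennreal_less_iff)
      then have "real m < r * real n" using False by (simp add: field_simps)
      then show "m \<in> {1..nat \<lfloor>r * real n\<rfloor>}" using \<open>1 \<le> m\<close> by (simp add: le_nat_floor)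
    qed
    then have "card ?M \<le> nat \<lfloor>r * real n\<rfloor>" using card_mono[of "{1..nat \<lfloor>r * real n\<rfloor>}" ?M] by simp
    moreover have "real (nat \<lfloor>r * real n\<rfloor>) \<le> r * real n" using real by (intro of_nat_floor) simp
    ultimately have c: "real (card ?M) \<le> r * real n" by linarith
    have "step n v = (\<Sum>m\<in>?M. ennreal (1 / real n))"
      unfolding step_def by (rule sum.inter_filter[symmetric]) simp
    also have "\<dots> = ennreal (real (card ?M) * (1 / real n))"
      by (simp add: ennreal_of_nat_eq_real_of_nat ennreal_mult[symmetric])
    also have "\<dots> \<le> ennreal r" using c False by (intro ennreal_leI) (simp add: field_simps)
    finally show ?thesis using real by simp
  qed (simp add: step_def)
qed simp

text \<open>
  Together with \<open>step_le\<close> this is convergence of the staircases, in the form required by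
  Fatou's lemma.
\<close>

lemma step_liminf: "v \<le> liminf (\<lambda>n. step n v)"
  unfolding le_Liminf_iff
proof (intro allI impI)
  fix y assume y: "y < v"
  then obtain z' where z': "y < z'" "z' < v" using dense by blast
  then obtain w' where w': "z' < w'" "w' < v" using dense by blast
  obtain z where z: "z' = ennreal z" "0 \<le> z" using w' by (cases z') auto
  obtain w where w: "w' = ennreal w" "0 \<le> w" using w' by (cases w') auto
  have zw: "z < w" using w' z w by (simp add: ennreal_less_iff)
  have "\<forall>\<^sub>F n::nat in sequentially. real n > max z (1 / (w - z))"
    using filterlim_real_sequentially unfolding filterlim_at_top_dense by blast
  then show "\<forall>\<^sub>F n in sequentially. y < step n v"
  proof eventually_elim
    case (elim n)
    then have n: "z < real n" "1 / (w - z) < real n" "0 < real n" using z by auto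
    let ?N = "nat \<lceil>z * real n\<rceil>"
    have N1: "z * real n \<le> real ?N" by linarith
    have N2: "real ?N < z * real n + 1" using z by (simp add: ceiling_less_iff of_nat_less_iff) linarith
    have "1 < real n * (w - z)" using n zw by (simp add: field_simps)
    then have N3: "real ?N < w * real n" using N2 by (simp add: algebra_simps)
    have "z * real n \<le> real n * real n" using n by (intro mult_right_mono) auto
    then have N4: "?N \<le> n * n" by (metis ceiling_le of_int_of_nat_eq of_nat_mult nat_le_iff of_nat_le_iff)
    have le: "ennreal (real m / real n) < v" if "m \<le> ?N" for m
    proof -
      have "real m / real n < w" using that N3 n by (simp add: field_simps) 
      then show ?thesis using w w' by (metis ennreal_less_iff less_trans divide_nonneg_nonneg of_nat_0_le_iff)
    qed
    have "z \<le> real ?N * (1 / real n)" using N1 n by (simp add: field_simps)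
    then have "ennreal z \<le> ennreal (real ?N * (1 / real n))" by (rule ennreal_leI)
    also have "\<dots> = (\<Sum>m=1..?N. ennreal (1 / real n))"
      by (simp add: ennreal_of_nat_eq_real_of_nat ennreal_mult[symmetric])
    also have "\<dots> = (\<Sum>m=1..?N. if ennreal (real m / real n) < v then ennreal (1 / real n) else 0)"
      using le by (intro sum.cong) auto
    also have "\<dots> \<le> step n v" unfolding step_def using N4 by (intro sum_mono2) auto
    finally show "y < step n v" using z' z by simp
  qed
qed

lemma step_measurable [measurable]: "step n \<in> borel_measurable borel"
  unfolding step_def[abs_def] by measurable

lemma nn_integral_step:
  assumes "sets \<mu> = sets borel" "lsc_nn h"
  shows "(\<integral>\<^sup>+x. step n (h x) \<partial>\<mu>) = (\<Sum>m=1..n*n. ennreal (1 / real n) * emeasure \<mu> {x. ennreal (real m / real n) < h x})"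
proof -
  have [measurable]: "{x. t < h x} \<in> sets \<mu>" for t using assms by (simp add: lsc_nn_open)
  have "(\<integral>\<^sup>+x. step n (h x) \<partial>\<mu>) =
      (\<integral>\<^sup>+x. (\<Sum>m=1..n*n. ennreal (1 / real n) * indicator {x. ennreal (real m / real n) < h x} x) \<partial>\<mu>)"
    unfolding step_def by (intro nn_integral_cong sum.cong) (auto simp: indicator_def)
  also have "\<dots> = (\<Sum>m=1..n*n. \<integral>\<^sup>+x. ennreal (1 / real n) * indicator {x. ennreal (real m / real n) < h x} x \<partial>\<mu>)"
    by (rule nn_integral_sum) measurable
  finally show ?thesis by (simp add: nn_integral_cmult_indicator)
qed

lemma nn_integral_le_liminf_step:
  assumes [measurable]: "h \<in> borel_measurable \<mu>"
  shows "(\<integral>\<^sup>+x. h x \<partial>\<mu>) \<le> liminf (\<lambda>n. \<integral>\<^sup>+x. step n (h x) \<partial>\<mu>)"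
proof -
  have "(\<integral>\<^sup>+x. h x \<partial>\<mu>) \<le> (\<integral>\<^sup>+x. liminf (\<lambda>n. step n (h x)) \<partial>\<mu>)"
    by (intro nn_integral_mono step_liminf)
  also have "\<dots> \<le> liminf (\<lambda>n. \<integral>\<^sup>+x. step n (h x) \<partial>\<mu>)" by (intro nn_integral_liminf) measurable
  finally show ?thesis .
qed

lemma radonD:
  assumes "radon \<mu>"
  shows radon_sets: "sets \<mu> = sets borel" and radon_space: "space \<mu> = UNIV"
    and radon_compact: "compact K \<Longrightarrow> emeasure \<mu> K < \<infinity>"
    and radon_inner: "open U \<Longrightarrow> emeasure \<mu> U = (SUP K\<in>{K. compact K \<and> K \<subseteq> U}. emeasure \<mu> K)"
    and radon_outer: "B \<in> sets borel \<Longrightarrow> emeasure \<mu> B = (INF U\<in>{U. open U \<and> B \<subseteq> U}. emeasure \<mu> U)"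
  using assms sets_eq_imp_space_eq[of \<mu> borel] unfolding radon_def by (auto simp: space_borel)

text \<open>
  Chooses near-optimal elements in finitely many suprema at once. It is used for inner regularity
  at finitely many open sets, and its dual below for outer regularity.
\<close>

lemma sum_less_SUP:
  fixes w :: "'i \<Rightarrow> 'k \<Rightarrow> ennreal"
  assumes "finite F" "\<And>i. i \<in> F \<Longrightarrow> S i \<noteq> {}" "t < (\<Sum>i\<in>F. ennreal (c i) * (SUP k\<in>S i. w i k))"
  obtains k where "\<And>i. i \<in> F \<Longrightarrow> k i \<in> S i" "t < (\<Sum>i\<in>F. ennreal (c i) * w i (k i))"
proof -
  have "\<exists>u::nat\<Rightarrow>ennreal. incseq u \<and> range u \<subseteq> w i ` S i \<and> (SUP k\<in>S i. w i k) = (SUP j. u j)" if "i \<in> F" for i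
    using ennreal_Sup_countable_SUP[of "w i ` S i"] assms(2)[OF that] by auto
  then obtain u :: "'i \<Rightarrow> nat \<Rightarrow> ennreal" where u: "\<And>i. i \<in> F \<Longrightarrow> incseq (u i)" "\<And>i. i \<in> F \<Longrightarrow> range (u i) \<subseteq> w i ` S i"
     "\<And>i. i \<in> F \<Longrightarrow> (SUP k\<in>S i. w i k) = (SUP j. u i j)" by metis
  have "(\<lambda>j. \<Sum>i\<in>F. ennreal (c i) * u i j) \<longlonglongrightarrow> (\<Sum>i\<in>F. ennreal (c i) * (SUP k\<in>S i. w i k))"
    using u by (intro tendsto_sum ennreal_tendsto_cmult) (auto simp: LIMSEQ_SUP)
  then have "\<forall>\<^sub>F j in sequentially. t < (\<Sum>i\<in>F. ennreal (c i) * u i j)" using assms(3) by (rule order_tendstoD)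
  then obtain j where j: "t < (\<Sum>i\<in>F. ennreal (c i) * u i j)" by (auto simp: eventually_sequentially)
  have "\<exists>k\<in>S i. u i j = w i k" if "i \<in> F" for i using u(2)[OF that] by auto
  then obtain k where "\<And>i. i \<in> F \<Longrightarrow> k i \<in> S i \<and> u i j = w i (k i)" by metis
  then show thesis using j by (intro that[of k]) auto
qed

lemma sum_INF_less:
  fixes w :: "'i \<Rightarrow> 'k \<Rightarrow> ennreal"
  assumes "finite F" "\<And>i. i \<in> F \<Longrightarrow> S i \<noteq> {}" "(\<Sum>i\<in>F. ennreal (c i) * (INF k\<in>S i. w i k)) < t"
  obtains k where "\<And>i. i \<in> F \<Longrightarrow> k i \<in> S i" "(\<Sum>i\<in>F. ennreal (c i) * w i (k i)) < t"
proof -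
  have "\<exists>u::nat\<Rightarrow>ennreal. decseq u \<and> range u \<subseteq> w i ` S i \<and> (INF k\<in>S i. w i k) = (INF j. u j)" if "i \<in> F" for i
    using ennreal_Inf_countable_INF[of "w i ` S i"] assms(2)[OF that] by auto
  then obtain u :: "'i \<Rightarrow> nat \<Rightarrow> ennreal" where u: "\<And>i. i \<in> F \<Longrightarrow> decseq (u i)" "\<And>i. i \<in> F \<Longrightarrow> range (u i) \<subseteq> w i ` S i"
     "\<And>i. i \<in> F \<Longrightarrow> (INF k\<in>S i. w i k) = (INF j. u i j)" by metis
  have "(\<lambda>j. \<Sum>i\<in>F. ennreal (c i) * u i j) \<longlonglongrightarrow> (\<Sum>i\<in>F. ennreal (c i) * (INF k\<in>S i. w i k))"
    using u by (intro tendsto_sum ennreal_tendsto_cmult) (auto simp: LIMSEQ_INF)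
  then have "\<forall>\<^sub>F j in sequentially. (\<Sum>i\<in>F. ennreal (c i) * u i j) < t" using assms(3) by (rule order_tendstoD)
  then obtain j where j: "(\<Sum>i\<in>F. ennreal (c i) * u i j) < t" by (auto simp: eventually_sequentially)
  have "\<exists>k\<in>S i. u i j = w i k" if "i \<in> F" for i using u(2)[OF that] by auto
  then obtain k where "\<And>i. i \<in> F \<Longrightarrow> k i \<in> S i \<and> u i j = w i (k i)" by metis
  then show thesis using j by (intro that[of k]) auto
qed

text \<open>
  Inner regularity for integrals: a level below the integral is exceeded by a staircase
  resting on compact subsets of the open sets \<open>{h > m/n}\<close>. The converse estimate
  \<open>radon_sum_le_integral\<close> applies to every function that exceeds the same levels on the same
  compact sets.
\<close>

lemma radon_less_integral:
  fixes h :: "'b::topological_space \<Rightarrow> ennreal"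
  assumes rad: "radon \<mu>" and h: "lsc_nn h" and t: "t < (\<integral>\<^sup>+x. h x \<partial>\<mu>)"
  obtains n K where "\<And>m. m \<in> {1..n*n} \<Longrightarrow> compact (K m) \<and> K m \<subseteq> {x. ennreal (real m / real n) < h x}"
    "t < (\<Sum>m=1..n*n. ennreal (1 / real n) * emeasure \<mu> (K m))"
proof -
  note sets = radon_sets[OF rad]
  have "h \<in> borel_measurable \<mu>" using lsc_nn_measurable[OF h] sets measurable_cong_sets by blast
  then have "t < liminf (\<lambda>n. \<integral>\<^sup>+x. step n (h x) \<partial>\<mu>)"
    using t nn_integral_le_liminf_step[of h \<mu>] by auto
  then have "\<forall>\<^sub>F n in sequentially. t < (\<integral>\<^sup>+x. step n (h x) \<partial>\<mu>)"
    using order_refl[of "liminf (\<lambda>n. \<integral>\<^sup>+x. step n (h x) \<partial>\<mu>)"] unfolding le_Liminf_iff by blast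
  then obtain n where n: "t < (\<integral>\<^sup>+x. step n (h x) \<partial>\<mu>)"
    by (auto simp: eventually_sequentially)
  let ?U = "\<lambda>m. {x. ennreal (real m / real n) < h x}"
  have "t < (\<Sum>m=1..n*n. ennreal (1 / real n) * (SUP K\<in>{K. compact K \<and> K \<subseteq> ?U m}. emeasure \<mu> K))"
    using n unfolding nn_integral_step[OF sets h] by (simp add: radon_inner[OF rad lsc_nn_open[OF h], symmetric])
  then obtain K where K: "\<And>m. m \<in> {1..n*n} \<Longrightarrow> K m \<in> {K. compact K \<and> K \<subseteq> ?U m}"
      and tK: "t < (\<Sum>m=1..n*n. ennreal (1 / real n) * emeasure \<mu> (K m))"
    by (rule sum_less_SUP[where c = "\<lambda>_. 1 / real n", rotated 2]) auto
  show thesis by (rule that[OF _ tK]) (use K in auto)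
qed

lemma radon_sum_le_integral:
  fixes h :: "'b::topological_space \<Rightarrow> ennreal"
  assumes rad: "radon \<mu>" and h: "lsc_nn h"
    and K: "\<And>m. m \<in> {1..n*n} \<Longrightarrow> K m \<subseteq> {x. ennreal (real m / real n) < h x}"
  shows "(\<Sum>m=1..n*n. ennreal (1 / real n) * emeasure \<mu> (K m)) \<le> (\<integral>\<^sup>+x. h x \<partial>\<mu>)"
proof -
  note sets = radon_sets[OF rad]
  have "(\<Sum>m=1..n*n. ennreal (1 / real n) * emeasure \<mu> (K m)) \<le> (\<integral>\<^sup>+x. step n (h x) \<partial>\<mu>)"
    unfolding nn_integral_step[OF sets h] using lsc_nn_open[OF h] K
    by (intro sum_mono mult_left_mono emeasure_mono) (auto simp: sets)
  also have "\<dots> \<le> (\<integral>\<^sup>+x. h x \<partial>\<mu>)" by (intro nn_integral_mono step_le)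
  finally show ?thesis .
qed

lemma directed_finite:
  assumes "finite F" "D \<noteq> {}" "\<And>g h. g \<in> D \<Longrightarrow> h \<in> D \<Longrightarrow> \<exists>f\<in>D. g \<le> f \<and> h \<le> (f :: 'b \<Rightarrow> ennreal)"
    and "\<And>i. i \<in> F \<Longrightarrow> q i \<in> D"
  shows "\<exists>f\<in>D. \<forall>i\<in>F. q i \<le> f"
  using assms(1,4)
proof (induction F)
  case empty
  then show ?case using assms(2) by auto
next
  case (insert i F)
  then obtain f where "f \<in> D" "\<forall>i\<in>F. q i \<le> f" by auto
  moreover obtain f' where "f' \<in> D" "q i \<le> f'" "f \<le> f'" using assms(3)[of "q i" f] insert.prems \<open>f \<in> D\<close> by auto
  ultimately show ?case by (intro bexI[of _ f']) (auto intro: order_trans)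
qed

text \<open>
  Radon measures are continuous along directed families, of any cardinality, of lower
  semicontinuous functions. Finitely many compact sets carry a staircase below the supremum, each
  of them is covered by finitely many of the sets \<open>{h > m/n}\<close> with \<open>h \<in> D\<close>, and a single element
  of \<open>D\<close> dominates the finitely many functions involved.
\<close>

lemma radon_directed_SUP:
  fixes D :: "('b::t2_space \<Rightarrow> ennreal) set"
  assumes rad: "radon \<mu>" and lsc: "\<And>h. h \<in> D \<Longrightarrow> lsc_nn h"
    and dir: "\<And>g h. g \<in> D \<Longrightarrow> h \<in> D \<Longrightarrow> \<exists>f\<in>D. g \<le> f \<and> h \<le> f"
    and t: "t < (\<integral>\<^sup>+x. (SUP h\<in>D. h x) \<partial>\<mu>)"
  shows "\<exists>h\<in>D. t < (\<integral>\<^sup>+x. h x \<partial>\<mu>)"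
proof -
  have D: "D \<noteq> {}" using t by (auto simp: bot_ennreal)
  define H where "H x = (SUP h\<in>D. h x)" for x
  have H: "lsc_nn H" unfolding H_def using lsc by (rule lsc_nn_SUP)
  obtain n K where K: "\<And>m. m \<in> {1..n*n} \<Longrightarrow> compact (K m) \<and> K m \<subseteq> {x. ennreal (real m / real n) < H x}"
      and tK: "t < (\<Sum>m=1..n*n. ennreal (1 / real n) * emeasure \<mu> (K m))"
    using radon_less_integral[OF rad H t[folded H_def]] by metis
  have "\<exists>h\<in>D. K m \<subseteq> {x. ennreal (real m / real n) < h x}" if m: "m \<in> {1..n*n}" for m
  proof -
    define V where "V h = {x. ennreal (real m / real n) < h x}" for h :: "'b \<Rightarrow> ennreal"
    have "compact (K m)" "K m \<subseteq> (\<Union>h\<in>D. V h)"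
      using K[OF m] by (auto simp: H_def V_def less_SUP_iff subset_iff)
    moreover have "open (V h)" if "h \<in> D" for h
      unfolding V_def by (intro lsc_nn_open lsc that)
    ultimately obtain F where F: "F \<subseteq> D" "finite F" "K m \<subseteq> (\<Union>h\<in>F. V h)"
      using compactE_image[of "K m" D V] by metis
    obtain f where f: "f \<in> D" "\<forall>h\<in>F. h \<le> f"
      using directed_finite[OF F(2) D dir, of "\<lambda>h. h"] F(1) by blast
    have "V h \<subseteq> V f" if "h \<in> F" for h
      using f(2) that by (auto simp: V_def le_fun_def intro: less_le_trans)
    then have "K m \<subseteq> V f" using F(3) by blast
    then show ?thesis using f(1) unfolding V_def by blast
  qed
  then obtain q where q: "\<And>m. m \<in> {1..n*n} \<Longrightarrow> q m \<in> D"
      "\<And>m. m \<in> {1..n*n} \<Longrightarrow> K m \<subseteq> {x. ennreal (real m / real n) < q m x}" by metis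
  obtain f where f: "f \<in> D" "\<forall>m\<in>{1..n*n}. q m \<le> f" using directed_finite[OF _ D dir, of "{1..n*n}" q] q by blast
  have "K m \<subseteq> {x. ennreal (real m / real n) < f x}" if m: "m \<in> {1..n*n}" for m
  proof
    fix x assume "x \<in> K m"
    then have "ennreal (real m / real n) < q m x" using q(2)[OF m] by auto
    also have "q m x \<le> f x" using f(2) m by (auto simp: le_fun_def)
    finally show "x \<in> {x. ennreal (real m / real n) < f x}" by simp
  qed
  then have "t < (\<integral>\<^sup>+x. f x \<partial>\<mu>)"
    using tK radon_sum_le_integral[OF rad lsc[OF f(1)], of n K] by (meson less_le_trans)
  then show ?thesis using f by auto
qed

section \<open>Products of Radon measures\<close>

lemma lsc_nn_section:
  fixes k :: "'b::topological_space \<times> 'c::topological_space \<Rightarrow> ennreal"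
  assumes "lsc_nn k" shows "lsc_nn (\<lambda>y. k (x, y))"
  unfolding lsc_nn_def
proof
  fix t
  have "open ((\<lambda>y. (x, y)) -` {z. t < k z})"
    by (intro open_vimage lsc_nn_open assms) (auto intro: continuous_intros)
  then show "open {y. t < k (x, y)}" by (simp add: vimage_def)
qed

lemma lsc_nn_indicator: "open W \<Longrightarrow> lsc_nn (indicator W)"
  unfolding lsc_nn_def
proof
  fix t :: ennreal assume "open W"
  have "{x. t < indicator W x} = (if t < 1 then W else {})" by (auto simp: indicator_def)
  then show "open {x. t < indicator W x}" using \<open>open W\<close> by simp
qed

text \<open>
  A staircase on compact sets that witnesses \<open>t < \<integral> k (x, y) d\<nu>(y)\<close> remains below \<open>k (x', \<cdot>)\<close>
  for all \<open>x'\<close> near \<open>x\<close>, by the tube lemma.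
\<close>

lemma lsc_nn_integral_section:
  fixes k :: "'b::topological_space \<times> 'c::topological_space \<Rightarrow> ennreal"
  assumes rad: "radon \<nu>" and k: "lsc_nn k"
  shows "lsc_nn (\<lambda>x. \<integral>\<^sup>+y. k (x, y) \<partial>\<nu>)"
  unfolding lsc_nn_def
proof
  fix t
  note kx = lsc_nn_section[OF k]
  show "open {x. t < (\<integral>\<^sup>+y. k (x, y) \<partial>\<nu>)}"
  proof (subst open_subopen, clarify)
    fix x assume t: "t < (\<integral>\<^sup>+y. k (x, y) \<partial>\<nu>)"
    let ?V = "\<lambda>x m n. {y. ennreal (real m / real n) < k (x, y)}"
    obtain n K where K: "\<And>m. m \<in> {1..n*n} \<Longrightarrow> compact (K m) \<and> K m \<subseteq> ?V x m n"
        and tK: "t < (\<Sum>m=1..n*n. ennreal (1 / real n) * emeasure \<nu> (K m))"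
      using radon_less_integral[OF rad kx t] by metis
    have "\<exists>U. open U \<and> x \<in> U \<and> U \<times> K m \<subseteq> {z. ennreal (real m / real n) < k z}" if m: "m \<in> {1..n*n}" for m
    proof -
      have "compact (K m)" "{x} \<times> K m \<subseteq> {z. ennreal (real m / real n) < k z}" using K[OF m] by auto
      then show ?thesis using Elementary_Topology.tube_lemma[OF _ lsc_nn_open[OF k]] by metis
    qed
    then obtain U where U: "\<And>m. m \<in> {1..n*n} \<Longrightarrow> open (U m) \<and> x \<in> U m \<and> U m \<times> K m \<subseteq> {z. ennreal (real m / real n) < k z}"
      by metis
    define T where "T = (\<Inter>m\<in>{1..n*n}. U m)"
    have T: "open T" "x \<in> T" using U by (auto simp: T_def)
    have "t < (\<integral>\<^sup>+y. k (x', y) \<partial>\<nu>)" if x': "x' \<in> T" for x'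
    proof -
      have sub: "K m \<subseteq> ?V x' m n" if "m \<in> {1..n*n}" for m
        using U[OF that] x' that unfolding T_def by blast
      show ?thesis by (rule less_le_trans[OF tK radon_sum_le_integral[OF rad kx sub]])
    qed
    then show "\<exists>T. open T \<and> x \<in> T \<and> T \<subseteq> {x. t < (\<integral>\<^sup>+y. k (x, y) \<partial>\<nu>)}" using T by blast
  qed
qed

lemma open_section: "open (W :: ('b::topological_space \<times> 'c::topological_space) set) \<Longrightarrow> open (Pair x -` W)"
  by (intro open_vimage) (auto intro: continuous_intros)

lemma lsc_nn_emeasure_section:
  assumes "radon \<nu>" "open (W :: ('b::topological_space \<times> 'c::topological_space) set)"
  shows "lsc_nn (\<lambda>x. emeasure \<nu> (Pair x -` W))"
proof -
  have "(\<integral>\<^sup>+y. indicator W (x, y) \<partial>\<nu>) = emeasure \<nu> (Pair x -` W)" for x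
  proof -
    have "(\<integral>\<^sup>+y. indicator W (x, y) \<partial>\<nu>) = (\<integral>\<^sup>+y. indicator (Pair x -` W) y \<partial>\<nu>)"
      by (intro nn_integral_cong) (simp add: indicator_def)
    then show ?thesis using open_section[OF assms(2), of x] radon_sets[OF assms(1)] by simp
  qed
  then show ?thesis using lsc_nn_integral_section[OF assms(1) lsc_nn_indicator[OF assms(2)]] by simp
qed

text \<open>
  The functions \<open>x \<mapsto> \<nu>(Q\<^sub>x)\<close>, for \<open>Q\<close> relatively compact in \<open>W\<close>, are lower semicontinuous
  and directed, and inner regularity of \<open>\<nu>\<close> makes \<open>x \<mapsto> \<nu>(W\<^sub>x)\<close> their supremum.
\<close>

lemma radon_prod_content_inner:
  fixes \<mu> :: "'b::t2_space measure" and \<nu> :: "'c::t2_space measure"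
  assumes lcb: "locally_compact_space (euclidean :: 'b topology)"
    and lcc: "locally_compact_space (euclidean :: 'c topology)"
    and \<mu>: "radon \<mu>" and \<nu>: "radon \<nu>" and W: "open W"
  shows "(\<integral>\<^sup>+x. emeasure \<nu> (Pair x -` W) \<partial>\<mu>) \<le>
    (SUP Q\<in>{Q. open Q \<and> compact (closure Q) \<and> closure Q \<subseteq> W}. \<integral>\<^sup>+x. emeasure \<nu> (Pair x -` Q) \<partial>\<mu>)"
proof (rule dense_le)
  note lc = locally_compact_Times[OF lcb lcc]
  define \<Q> where "\<Q> = {Q. open Q \<and> compact (closure Q) \<and> closure Q \<subseteq> W}"
  define D where "D = (\<lambda>Q x. emeasure \<nu> (Pair x -` Q)) ` \<Q>"
  fix t assume t: "t < (\<integral>\<^sup>+x. emeasure \<nu> (Pair x -` W) \<partial>\<mu>)"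
  have "emeasure \<nu> (Pair x -` W) \<le> (SUP h\<in>D. h x)" for x
    unfolding radon_inner[OF \<nu> open_section[OF W]]
  proof (rule SUP_least, clarify)
    fix K assume K: "compact K" "K \<subseteq> Pair x -` W"
    have "compact ({x} \<times> K)" "{x} \<times> K \<subseteq> W" using K by (auto intro: compact_Times)
    then obtain Q where Q: "open Q" "{x} \<times> K \<subseteq> Q" "compact (closure Q)" "closure Q \<subseteq> W"
      using locally_compact_nbhd[OF lc _ W] by metis
    then have "emeasure \<nu> K \<le> emeasure \<nu> (Pair x -` Q)"
      using open_section[of Q x] radon_sets[OF \<nu>] by (intro emeasure_mono) auto
    also have "\<dots> \<le> (SUP h\<in>D. h x)" using Q by (intro SUP_upper2[of "\<lambda>x. emeasure \<nu> (Pair x -` Q)"]) (auto simp: D_def \<Q>_def)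
    finally show "emeasure \<nu> K \<le> (SUP h\<in>D. h x)" .
  qed
  then have t': "t < (\<integral>\<^sup>+x. (SUP h\<in>D. h x) \<partial>\<mu>)"
    by (intro less_le_trans[OF t] nn_integral_mono)
  have "\<exists>h\<in>D. t < (\<integral>\<^sup>+x. h x \<partial>\<mu>)"
  proof (rule radon_directed_SUP[OF \<mu> _ _ t'])
    fix h assume "h \<in> D" then show "lsc_nn h" using lsc_nn_emeasure_section[OF \<nu>] by (auto simp: D_def \<Q>_def)
  next
    fix g h assume "g \<in> D" "h \<in> D"
    then obtain P Q where PQ: "P \<in> \<Q>" "Q \<in> \<Q>" "g = (\<lambda>x. emeasure \<nu> (Pair x -` P))" "h = (\<lambda>x. emeasure \<nu> (Pair x -` Q))"
      by (auto simp: D_def)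
    have U: "P \<union> Q \<in> \<Q>" using PQ by (auto simp: \<Q>_def)
    then have "Pair x -` (P \<union> Q) \<in> sets \<nu>" for x using open_section[of "P \<union> Q" x] radon_sets[OF \<nu>] by (auto simp: \<Q>_def)
    then show "\<exists>f\<in>D. g \<le> f \<and> h \<le> f"
      using U PQ unfolding D_def
      by (intro bexI[OF _ imageI[OF U]]) (auto simp: le_fun_def intro!: emeasure_mono)
  qed
  then obtain Q where Q: "Q \<in> \<Q>" and le: "t < (\<integral>\<^sup>+x. emeasure \<nu> (Pair x -` Q) \<partial>\<mu>)" by (auto simp: D_def)
  show "t \<le> (SUP Q\<in>{Q. open Q \<and> compact (closure Q) \<and> closure Q \<subseteq> W}. \<integral>\<^sup>+x. emeasure \<nu> (Pair x -` Q) \<partial>\<mu>)"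
    using Q le unfolding \<Q>_def[symmetric] by (intro SUP_upper2[of Q]) auto
qed

lemma nn_integral_section_rect:
  assumes "U \<in> sets \<mu>"
  shows "(\<integral>\<^sup>+x. emeasure \<nu> (Pair x -` (U \<times> V)) \<partial>\<mu>) = emeasure \<nu> V * emeasure \<mu> U"
proof -
  have "emeasure \<nu> (Pair x -` (U \<times> V)) = emeasure \<nu> V * indicator U x" for x
    by (cases "x \<in> U") auto
  then show ?thesis using assms by (simp add: nn_integral_cmult_indicator)
qed

lemma radon_compact_open:
  assumes rad: "radon (\<mu> :: 'b::t2_space measure)" and "compact K" "emeasure \<mu> K < t"
  obtains U where "open U" "K \<subseteq> U" "emeasure \<mu> U < t"
  using assms(3) radon_outer[OF rad borel_compact[OF assms(2)]] by (auto simp: INF_less_iff)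

lemma radon_prod_exists:
  fixes \<mu> :: "'b::t2_space measure" and \<nu> :: "'c::t2_space measure"
  assumes lcb: "locally_compact_space (euclidean :: 'b topology)"
    and lcc: "locally_compact_space (euclidean :: 'c topology)"
    and \<mu>: "radon \<mu>" and \<nu>: "radon \<nu>"
  obtains \<rho> where "radon \<rho>" "\<And>W. open W \<Longrightarrow> emeasure \<rho> W = (\<integral>\<^sup>+x. emeasure \<nu> (Pair x -` W) \<partial>\<mu>)"
proof -
  have meas: "(\<lambda>x. emeasure \<nu> (Pair x -` W)) \<in> borel_measurable \<mu>" if "open W" for W
    using lsc_nn_measurable[OF lsc_nn_emeasure_section[OF \<nu> that]] radon_sets[OF \<mu>] measurable_cong_sets by blast
  have sec: "Pair x -` W \<in> sets \<nu>" if "open W" for x :: 'b and W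
    using open_section[OF that, of x] radon_sets[OF \<nu>] by simp
  show thesis
  proof (rule radon_from_content[where r = "\<lambda>W. \<integral>\<^sup>+x. emeasure \<nu> (Pair x -` W) \<partial>\<mu>"])
    fix U V :: "('b \<times> 'c) set" assume "open U" "open V" "U \<subseteq> V"
    then show "(\<integral>\<^sup>+x. emeasure \<nu> (Pair x -` U) \<partial>\<mu>) \<le> (\<integral>\<^sup>+x. emeasure \<nu> (Pair x -` V) \<partial>\<mu>)"
      by (intro nn_integral_mono emeasure_mono vimage_mono sec)
  next
    fix U :: "nat \<Rightarrow> ('b \<times> 'c) set" assume U: "\<And>n. open (U n)"
    have "emeasure \<nu> (Pair x -` (\<Union>n. U n)) \<le> (\<Sum>n. emeasure \<nu> (Pair x -` U n))" for x
      unfolding vimage_UN using sec[OF U] by (intro emeasure_subadditive_countably) auto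
    then have "(\<integral>\<^sup>+x. emeasure \<nu> (Pair x -` (\<Union>n. U n)) \<partial>\<mu>) \<le> (\<integral>\<^sup>+x. (\<Sum>n. emeasure \<nu> (Pair x -` U n)) \<partial>\<mu>)"
      by (intro nn_integral_mono)
    also have "\<dots> = (\<Sum>n. \<integral>\<^sup>+x. emeasure \<nu> (Pair x -` U n) \<partial>\<mu>)"
      by (intro nn_integral_suminf meas U)
    finally show "(\<integral>\<^sup>+x. emeasure \<nu> (Pair x -` (\<Union>n. U n)) \<partial>\<mu>) \<le> (\<Sum>n. \<integral>\<^sup>+x. emeasure \<nu> (Pair x -` U n) \<partial>\<mu>)" .
  next
    fix U V :: "('b \<times> 'c) set" assume UV: "open U" "open V" "U \<inter> V = {}"
    have "emeasure \<nu> (Pair x -` U) + emeasure \<nu> (Pair x -` V) = emeasure \<nu> (Pair x -` (U \<union> V))" for x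
      unfolding vimage_Un using UV by (intro plus_emeasure sec) auto
    then show "(\<integral>\<^sup>+x. emeasure \<nu> (Pair x -` U) \<partial>\<mu>) + (\<integral>\<^sup>+x. emeasure \<nu> (Pair x -` V) \<partial>\<mu>)
        \<le> (\<integral>\<^sup>+x. emeasure \<nu> (Pair x -` (U \<union> V)) \<partial>\<mu>)"
      using UV by (subst nn_integral_add[symmetric]) (auto simp: meas)
  next
    fix K :: "('b \<times> 'c) set" assume K: "compact K"
    have cK: "compact (fst ` K)" "compact (snd ` K)"
      using K by (auto intro!: compact_continuous_image continuous_intros)
    obtain U where U: "open U" "fst ` K \<subseteq> U" "emeasure \<mu> U < \<infinity>"
      using radon_compact_open[OF \<mu> cK(1) radon_compact[OF \<mu> cK(1)]] .
    obtain V where V: "open V" "snd ` K \<subseteq> V" "emeasure \<nu> V < \<infinity>"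
      using radon_compact_open[OF \<nu> cK(2) radon_compact[OF \<nu> cK(2)]] .
    have "K \<subseteq> U \<times> V" using U V by (auto simp: image_subset_iff) 
    moreover have "(\<integral>\<^sup>+x. emeasure \<nu> (Pair x -` (U \<times> V)) \<partial>\<mu>) < \<infinity>"
      using U V radon_sets[OF \<mu>] by (subst nn_integral_section_rect) (auto simp: ennreal_mult_less_top)
    ultimately show "\<exists>U. open U \<and> K \<subseteq> U \<and> (\<integral>\<^sup>+x. emeasure \<nu> (Pair x -` U) \<partial>\<mu>) < \<infinity>"
      using U V by (intro exI[of _ "U \<times> V"]) (auto intro: open_Times)
  next
    fix W :: "('b \<times> 'c) set" assume "open W"
    then show "(\<integral>\<^sup>+x. emeasure \<nu> (Pair x -` W) \<partial>\<mu>) \<le>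
      (SUP Q\<in>{Q. open Q \<and> compact (closure Q) \<and> closure Q \<subseteq> W}. \<integral>\<^sup>+x. emeasure \<nu> (Pair x -` Q) \<partial>\<mu>)"
      by (rule radon_prod_content_inner[OF lcb lcc \<mu> \<nu>])
  qed (use that in auto)
qed

text \<open>
  A neighbourhood of \<open>K \<times> L\<close> contains \<open>K \<times> L\<close> itself, which gives one inequality. For the
  other, take \<open>U \<times> V\<close> with \<open>U\<close>, \<open>V\<close> open of measure close to that of \<open>K\<close>, \<open>L\<close>.
\<close>

lemma radon_prod_rect:
  fixes \<mu> :: "'b::t2_space measure" and \<nu> :: "'c::t2_space measure"
  assumes \<mu>: "radon \<mu>" and \<nu>: "radon \<nu>" and \<rho>: "radon \<rho>"
    and W: "\<And>W. open W \<Longrightarrow> emeasure \<rho> W = (\<integral>\<^sup>+x. emeasure \<nu> (Pair x -` W) \<partial>\<mu>)"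
    and K: "compact K" and L: "compact L"
  shows "emeasure \<rho> (K \<times> L) = emeasure \<mu> K * emeasure \<nu> L"
proof (rule antisym)
  note B = borel_compact[OF compact_Times[OF K L]]
  show "emeasure \<mu> K * emeasure \<nu> L \<le> emeasure \<rho> (K \<times> L)"
    unfolding radon_outer[OF \<rho> B]
  proof (rule INF_greatest, clarify)
    fix W assume oW: "open W" "K \<times> L \<subseteq> W"
    have "emeasure \<nu> L * indicator K x \<le> emeasure \<nu> (Pair x -` W)" for x
      using oW open_section[OF oW(1), of x] radon_sets[OF \<nu>]
      by (cases "x \<in> K") (auto intro!: emeasure_mono)
    then have "(\<integral>\<^sup>+x. emeasure \<nu> L * indicator K x \<partial>\<mu>) \<le> emeasure \<rho> W"
      unfolding W[OF oW(1)] by (intro nn_integral_mono)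
    then show "emeasure \<mu> K * emeasure \<nu> L \<le> emeasure \<rho> W"
      using K radon_sets[OF \<mu>] by (subst (asm) nn_integral_cmult_indicator) (auto simp: borel_compact mult.commute)
  qed
  show "emeasure \<rho> (K \<times> L) \<le> emeasure \<mu> K * emeasure \<nu> L"
  proof (rule dense_ge)
    fix t assume t: "emeasure \<mu> K * emeasure \<nu> L < t"
    obtain p q where pq: "emeasure \<mu> K = ennreal p" "0 \<le> p" "emeasure \<nu> L = ennreal q" "0 \<le> q"
      using radon_compact[OF \<mu> K] radon_compact[OF \<nu> L] by (metis ennreal_cases infinity_ennreal_def less_irrefl)
    have "((\<lambda>e. ennreal ((p + e) * (q + e))) \<longlongrightarrow> ennreal ((p + 0) * (q + 0))) (at_right 0)"
      by (intro tendsto_intros)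
    then have "\<forall>\<^sub>F e in at_right 0. ennreal ((p + e) * (q + e)) < t"
      using t pq by (intro order_tendstoD) (auto simp: ennreal_mult)
    moreover have "\<forall>\<^sub>F e in at_right (0::real). 0 < e" by (simp add: eventually_at_right_less)
    ultimately obtain e where e: "ennreal ((p + e) * (q + e)) < t" "0 < e"
      by (metis (mono_tags, lifting) eventually_conj eventually_happens trivial_limit_at_right_real)
    have "emeasure \<mu> K < ennreal (p + e)" "emeasure \<nu> L < ennreal (q + e)"
      using pq e by (auto simp: ennreal_less_iff)
    then obtain U V where UV: "open U" "K \<subseteq> U" "emeasure \<mu> U < ennreal (p + e)" "open V" "L \<subseteq> V" "emeasure \<nu> V < ennreal (q + e)"
      using radon_compact_open[OF \<mu> K] radon_compact_open[OF \<nu> L] by metis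
    have "emeasure \<rho> (K \<times> L) \<le> emeasure \<rho> (U \<times> V)"
      using UV radon_sets[OF \<rho>] borel_open[OF open_Times[OF UV(1,4)]] by (intro emeasure_mono) auto
    also have "\<dots> = emeasure \<nu> V * emeasure \<mu> U"
      using UV radon_sets[OF \<mu>] unfolding W[OF open_Times[OF UV(1,4)]] by (intro nn_integral_section_rect) simp
    also have "\<dots> \<le> ennreal (q + e) * ennreal (p + e)" using UV by (intro mult_mono) auto
    also have "\<dots> = ennreal ((p + e) * (q + e))" using e pq by (subst ennreal_mult[symmetric]) (auto simp: mult.commute)
    also have "\<dots> < t" by (rule e)
    finally show "emeasure \<rho> (K \<times> L) \<le> t" by simp
  qed
qed

section \<open>Uniqueness of the product and the theorem of Fubini\<close>

lemma radon_eqI: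
  assumes "radon \<mu>" "radon \<nu>" "\<And>U. open U \<Longrightarrow> emeasure \<mu> U = emeasure \<nu> U"
  shows "\<mu> = \<nu>"
proof (rule measure_eqI)
  show "sets \<mu> = sets \<nu>" using assms(1,2) by (simp add: radon_sets)
  fix B assume "B \<in> sets \<mu>"
  then have B: "B \<in> sets borel" using radon_sets[OF assms(1)] by simp
  show "emeasure \<mu> B = emeasure \<nu> B"
    unfolding radon_outer[OF assms(1) B] radon_outer[OF assms(2) B] using assms(3) by (intro INF_cong) auto
qed

definition compact_rects :: "('b::topological_space \<times> 'c::topological_space) set set" where
  "compact_rects = {K \<times> L | K L. compact K \<and> compact L}"

lemma compact_rects_compact: "R \<in> compact_rects \<Longrightarrow> compact R"
  by (auto simp: compact_rects_def intro: compact_Times)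

lemma compact_rects_Int:
  fixes R S :: "('b::t2_space \<times> 'c::t2_space) set"
  assumes "R \<in> compact_rects" "S \<in> compact_rects" shows "R \<inter> S \<in> compact_rects"
proof -
  obtain K L K' L' where "R = K \<times> L" "S = K' \<times> L'" "compact K" "compact L" "compact K'" "compact L'"
    using assms by (auto simp: compact_rects_def)
  then show ?thesis
    by (auto simp: compact_rects_def Times_Int_Times intro!: exI[of _ "K \<inter> K'"] exI[of _ "L \<inter> L'"] compact_Int)
qed

text \<open>
  Inclusion and exclusion: intersecting with one rectangle turns a union of rectangles into a
  union of as many rectangles.
\<close>

lemma radon_eq_Union_rects:
  fixes \<rho> \<rho>' :: "('b::t2_space \<times> 'c::t2_space) measure"
  assumes \<rho>: "radon \<rho>" and \<rho>': "radon \<rho>'"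
    and rect: "\<And>R. R \<in> compact_rects \<Longrightarrow> emeasure \<rho> R = emeasure \<rho>' R"
  shows "set Rs \<subseteq> compact_rects \<Longrightarrow> emeasure \<rho> (\<Union>(set Rs)) = emeasure \<rho>' (\<Union>(set Rs))"
proof (induction Rs rule: length_induct)
  case (1 Rs)
  show ?case
  proof (cases Rs)
    case (Cons R Ss)
    have R: "R \<in> compact_rects" and Ss: "set Ss \<subseteq> compact_rects" using 1 Cons by auto
    let ?S = "\<Union>(set Ss)"
    have cS: "compact ?S" using Ss by (intro compact_Union) (auto intro: compact_rects_compact)
    have cR: "compact R" using R by (rule compact_rects_compact)
    have S: "emeasure \<rho> ?S = emeasure \<rho>' ?S" using 1 Cons Ss by auto
    have "R \<inter> ?S = \<Union>(set (map ((\<inter>) R) Ss))" by auto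
    moreover have "set (map ((\<inter>) R) Ss) \<subseteq> compact_rects" using R Ss compact_rects_Int by auto
    ultimately have RS: "emeasure \<rho> (R \<inter> ?S) = emeasure \<rho>' (R \<inter> ?S)"
      using 1 Cons by (metis length_Cons length_map lessI)
    have fin: "emeasure \<rho> (R \<inter> ?S) < \<infinity>" using radon_compact[OF \<rho> compact_Int[OF cR cS]] .
    have b: "R \<in> sets borel" "?S \<in> sets borel" using cR cS by (auto intro: borel_compact)
    have e: "emeasure \<rho> R + emeasure \<rho> ?S = emeasure \<rho> (R \<union> ?S) + emeasure \<rho> (R \<inter> ?S)"
        "emeasure \<rho>' R + emeasure \<rho>' ?S = emeasure \<rho>' (R \<union> ?S) + emeasure \<rho>' (R \<inter> ?S)"
      using b by (auto intro!: emeasure_Un_Int simp: radon_sets[OF \<rho>] radon_sets[OF \<rho>'])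
    have "emeasure \<rho> (R \<inter> ?S) + emeasure \<rho> (R \<union> ?S) = emeasure \<rho> (R \<inter> ?S) + emeasure \<rho>' (R \<union> ?S)"
      using e unfolding RS S rect[OF R] by (metis add.commute)
    then have "emeasure \<rho> (R \<union> ?S) = emeasure \<rho>' (R \<union> ?S)"
      using fin unfolding ennreal_add_left_cancel by auto
    then show ?thesis using Cons by simp
  qed simp
qed

lemma compact_open_rects:
  fixes C W :: "('b::t2_space \<times> 'c::t2_space) set"
  assumes lcb: "locally_compact_space (euclidean :: 'b topology)"
    and lcc: "locally_compact_space (euclidean :: 'c topology)"
    and "compact C" "open W" "C \<subseteq> W"
  obtains Rs where "set Rs \<subseteq> compact_rects" "C \<subseteq> \<Union>(set Rs)" "\<Union>(set Rs) \<subseteq> W"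
proof -
  have "\<exists>U R. open U \<and> z \<in> U \<and> U \<subseteq> R \<and> R \<subseteq> W \<and> R \<in> compact_rects" if z: "z \<in> C" for z
  proof -
    obtain A B where AB: "open A" "open B" "z \<in> A \<times> B" "A \<times> B \<subseteq> W"
    proof (rule open_prod_elim[OF \<open>open W\<close>])
      show "z \<in> W" using z \<open>C \<subseteq> W\<close> by blast
    qed
    obtain U where U: "open U" "fst z \<in> U" "compact (closure U)" "closure U \<subseteq> A"
      by (rule locally_compact_nbhd_point[OF lcb AB(1), of "fst z"]) (use AB(3) in auto)
    obtain V where V: "open V" "snd z \<in> V" "compact (closure V)" "closure V \<subseteq> B"
      by (rule locally_compact_nbhd_point[OF lcc AB(2), of "snd z"]) (use AB(3) in auto)
    have "closure U \<times> closure V \<in> compact_rects" using U V by (auto simp: compact_rects_def)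
    moreover have "U \<times> V \<subseteq> closure U \<times> closure V" by (intro Sigma_mono closure_subset)
    moreover have "closure U \<times> closure V \<subseteq> W" using U(4) V(4) AB(4) by blast
    moreover have "z \<in> U \<times> V" using U(2) V(2) by (simp add: mem_Times_iff)
    ultimately show ?thesis using open_Times[OF U(1) V(1)] by blast
  qed
  then obtain U R where UR: "\<And>z. z \<in> C \<Longrightarrow> open (U z) \<and> z \<in> U z \<and> U z \<subseteq> R z \<and> R z \<subseteq> W \<and> R z \<in> compact_rects"
    by metis
  obtain F where F: "F \<subseteq> C" "finite F" "C \<subseteq> (\<Union>z\<in>F. U z)"
    using compactE_image[OF \<open>compact C\<close>, of C U] UR by (metis UN_iff subsetI)
  obtain Rs where Rs: "set Rs = R ` F" using F(2) by (metis finite_imageI finite_list)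
  show thesis
  proof (rule that[of Rs])
    show "set Rs \<subseteq> compact_rects" "\<Union>(set Rs) \<subseteq> W" unfolding Rs using F(1) UR by blast+
    show "C \<subseteq> \<Union>(set Rs)" unfolding Rs using F(1,3) UR by blast
  qed
qed

lemma radon_le_open_rects:
  fixes \<rho> \<rho>' :: "('b::t2_space \<times> 'c::t2_space) measure"
  assumes lcb: "locally_compact_space (euclidean :: 'b topology)"
    and lcc: "locally_compact_space (euclidean :: 'c topology)"
    and \<rho>: "radon \<rho>" and \<rho>': "radon \<rho>'"
    and rect: "\<And>R. R \<in> compact_rects \<Longrightarrow> emeasure \<rho> R = emeasure \<rho>' R" and W: "open W"
  shows "emeasure \<rho> W \<le> emeasure \<rho>' W"
  unfolding radon_inner[OF \<rho> W]
proof (rule SUP_least, clarify)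
  fix C assume C: "compact C" "C \<subseteq> W"
  obtain Rs where Rs: "set Rs \<subseteq> compact_rects" "C \<subseteq> \<Union>(set Rs)" "\<Union>(set Rs) \<subseteq> W"
    using compact_open_rects[OF lcb lcc C(1) W C(2)] .
  have "compact (\<Union>(set Rs))" using Rs by (intro compact_Union) (auto intro: compact_rects_compact)
  then have "\<Union>(set Rs) \<in> sets borel" by (rule borel_compact)
  then have "emeasure \<rho> C \<le> emeasure \<rho> (\<Union>(set Rs))"
    using Rs by (intro emeasure_mono) (auto simp: radon_sets[OF \<rho>])
  also have "\<dots> = emeasure \<rho>' (\<Union>(set Rs))" using radon_eq_Union_rects[OF \<rho> \<rho>' rect Rs(1)] .
  also have "\<dots> \<le> emeasure \<rho>' W" using Rs W by (intro emeasure_mono) (auto simp: radon_sets[OF \<rho>'])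
  finally show "emeasure \<rho> C \<le> emeasure \<rho>' W" .
qed

text \<open>
  Between a compact set and an open neighbourhood lies a finite union of compact rectangles, so
  the rectangles determine a Radon measure on open sets, and hence everywhere.
\<close>

lemma radon_prod_unique:
  fixes \<rho> \<rho>' :: "('b::t2_space \<times> 'c::t2_space) measure"
  assumes lcb: "locally_compact_space (euclidean :: 'b topology)"
    and lcc: "locally_compact_space (euclidean :: 'c topology)"
    and \<rho>: "radon \<rho>" and \<rho>': "radon \<rho>'"
    and rect: "\<And>K L. compact K \<Longrightarrow> compact L \<Longrightarrow> emeasure \<rho> (K \<times> L) = emeasure \<rho>' (K \<times> L)"
  shows "\<rho> = \<rho>'"
proof (rule radon_eqI[OF \<rho> \<rho>'], rule antisym)
  have rect': "emeasure \<rho> R = emeasure \<rho>' R" if R: "R \<in> compact_rects" for R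
  proof -
    obtain K L where "R = K \<times> L" "compact K" "compact L" using R unfolding compact_rects_def by blast
    then show ?thesis using rect[of K L] by simp
  qed
  fix W :: "('b \<times> 'c) set" assume W: "open W"
  show "emeasure \<rho> W \<le> emeasure \<rho>' W" by (rule radon_le_open_rects[OF lcb lcc \<rho> \<rho>' rect' W])
  show "emeasure \<rho>' W \<le> emeasure \<rho> W" by (rule radon_le_open_rects[OF lcb lcc \<rho>' \<rho> rect'[symmetric] W])
qed

lemma radon_prod_eqI:
  fixes \<mu> :: "'b::t2_space measure" and \<nu> :: "'c::t2_space measure"
  assumes lcb: "locally_compact_space (euclidean :: 'b topology)"
    and lcc: "locally_compact_space (euclidean :: 'c topology)"
    and "radon \<rho>" "\<And>K L. compact K \<Longrightarrow> compact L \<Longrightarrow> emeasure \<rho> (K \<times> L) = emeasure \<mu> K * emeasure \<nu> L"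
  shows "radon_prod \<mu> \<nu> = \<rho>"
  unfolding radon_prod_def
proof (rule the_equality)
  fix \<rho>' assume "radon \<rho>' \<and> (\<forall>K L. compact K \<and> compact L \<longrightarrow> emeasure \<rho>' (K \<times> L) = emeasure \<mu> K * emeasure \<nu> L)"
  then show "\<rho>' = \<rho>" using assms(3,4) by (intro radon_prod_unique[OF lcb lcc]) auto
qed (use assms in auto)

lemma
  fixes \<mu> :: "'b::t2_space measure" and \<nu> :: "'c::t2_space measure"
  assumes lcb: "locally_compact_space (euclidean :: 'b topology)"
    and lcc: "locally_compact_space (euclidean :: 'c topology)"
    and \<mu>: "radon \<mu>" and \<nu>: "radon \<nu>"
  shows radon_radon_prod: "radon (radon_prod \<mu> \<nu>)"
    and radon_prod_open: "open W \<Longrightarrow> emeasure (radon_prod \<mu> \<nu>) W = (\<integral>\<^sup>+x. emeasure \<nu> (Pair x -` W) \<partial>\<mu>)"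
    and radon_prod_Times: "compact K \<Longrightarrow> compact L \<Longrightarrow> emeasure (radon_prod \<mu> \<nu>) (K \<times> L) = emeasure \<mu> K * emeasure \<nu> L"
proof -
  obtain \<rho> where \<rho>: "radon \<rho>" "\<And>W. open W \<Longrightarrow> emeasure \<rho> W = (\<integral>\<^sup>+x. emeasure \<nu> (Pair x -` W) \<partial>\<mu>)"
    using radon_prod_exists[OF lcb lcc \<mu> \<nu>] by blast
  note rect = radon_prod_rect[OF \<mu> \<nu> \<rho>]
  have eq: "radon_prod \<mu> \<nu> = \<rho>" by (rule radon_prod_eqI[OF lcb lcc \<rho>(1) rect])
  show "radon (radon_prod \<mu> \<nu>)"
    and "open W \<Longrightarrow> emeasure (radon_prod \<mu> \<nu>) W = (\<integral>\<^sup>+x. emeasure \<nu> (Pair x -` W) \<partial>\<mu>)"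
    and "compact K \<Longrightarrow> compact L \<Longrightarrow> emeasure (radon_prod \<mu> \<nu>) (K \<times> L) = emeasure \<mu> K * emeasure \<nu> L"
    unfolding eq by (auto simp: \<rho> rect)
qed

text \<open>
  For the staircases below \<open>k\<close> this is the value of the product measure on open sets. Fatou's
  lemma, used once on the product and once in the iterated integral, passes to \<open>k\<close>.
\<close>

lemma nn_integral_radon_prod:
  fixes \<mu> :: "'b::t2_space measure" and \<nu> :: "'c::t2_space measure"
  assumes lcb: "locally_compact_space (euclidean :: 'b topology)"
    and lcc: "locally_compact_space (euclidean :: 'c topology)"
    and \<mu>: "radon \<mu>" and \<nu>: "radon \<nu>" and k: "lsc_nn k"
  shows "(\<integral>\<^sup>+z. k z \<partial>radon_prod \<mu> \<nu>) = (\<integral>\<^sup>+x. \<integral>\<^sup>+y. k (x, y) \<partial>\<nu> \<partial>\<mu>)"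
proof -
  note \<rho> = radon_radon_prod[OF lcb lcc \<mu> \<nu>]
  note sets = radon_sets[OF \<mu>] radon_sets[OF \<nu>] radon_sets[OF \<rho>]
  note kx = lsc_nn_section[OF k]
  let ?V = "\<lambda>n m. {z. ennreal (real m / real n) < k z}"
  have V: "{y. ennreal (real m / real n) < k (x, y)} = Pair x -` ?V n m" for x n m by auto
  have meas: "(\<lambda>x. emeasure \<nu> (Pair x -` ?V n m)) \<in> borel_measurable \<mu>" for n m
    using lsc_nn_measurable[OF lsc_nn_emeasure_section[OF \<nu> lsc_nn_open[OF k]]] sets measurable_cong_sets by blast
  have tmeas: "(\<lambda>x. ennreal (1 / real n) * emeasure \<nu> (Pair x -` ?V n m)) \<in> borel_measurable \<mu>" for n m
    using meas by (intro borel_measurable_times_ennreal borel_measurable_const)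
  have kmeas: "(\<lambda>y. k (x, y)) \<in> borel_measurable \<nu>" for x
    using lsc_nn_measurable[OF kx] sets measurable_cong_sets by blast
  have kmeas': "k \<in> borel_measurable (radon_prod \<mu> \<nu>)"
    using lsc_nn_measurable[OF k] sets measurable_cong_sets by blast
  have inner: "(\<integral>\<^sup>+y. step n (k (x, y)) \<partial>\<nu>) = (\<Sum>m=1..n*n. ennreal (1 / real n) * emeasure \<nu> (Pair x -` ?V n m))" for n x
    unfolding nn_integral_step[OF sets(2) kx] V ..
  have imeas: "(\<lambda>x. \<integral>\<^sup>+y. step n (k (x, y)) \<partial>\<nu>) \<in> borel_measurable \<mu>" for n
    unfolding inner by (rule borel_measurable_sum) (rule tmeas)
  have eq: "(\<integral>\<^sup>+z. step n (k z) \<partial>radon_prod \<mu> \<nu>) = (\<integral>\<^sup>+x. \<integral>\<^sup>+y. step n (k (x, y)) \<partial>\<nu> \<partial>\<mu>)" for n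
  proof -
    have "(\<integral>\<^sup>+x. \<integral>\<^sup>+y. step n (k (x, y)) \<partial>\<nu> \<partial>\<mu>)
        = (\<Sum>m=1..n*n. \<integral>\<^sup>+x. ennreal (1 / real n) * emeasure \<nu> (Pair x -` ?V n m) \<partial>\<mu>)"
      unfolding inner by (rule nn_integral_sum) (rule tmeas)
    also have "\<dots> = (\<Sum>m=1..n*n. ennreal (1 / real n) * emeasure (radon_prod \<mu> \<nu>) (?V n m))"
      by (intro sum.cong refl)
        (simp only: nn_integral_cmult[OF meas] radon_prod_open[OF lcb lcc \<mu> \<nu> lsc_nn_open[OF k]])
    finally show ?thesis unfolding nn_integral_step[OF sets(3) k] by simp
  qed
  show ?thesis
  proof (rule antisym)
    have "(\<integral>\<^sup>+z. k z \<partial>radon_prod \<mu> \<nu>) \<le> liminf (\<lambda>n. \<integral>\<^sup>+x. \<integral>\<^sup>+y. step n (k (x, y)) \<partial>\<nu> \<partial>\<mu>)"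
      using nn_integral_le_liminf_step[OF kmeas'] unfolding eq .
    also have "\<dots> \<le> (\<integral>\<^sup>+x. \<integral>\<^sup>+y. k (x, y) \<partial>\<nu> \<partial>\<mu>)"
      by (intro Liminf_le always_eventually allI nn_integral_mono step_le) auto
    finally show "(\<integral>\<^sup>+z. k z \<partial>radon_prod \<mu> \<nu>) \<le> (\<integral>\<^sup>+x. \<integral>\<^sup>+y. k (x, y) \<partial>\<nu> \<partial>\<mu>)" .
    have "(\<integral>\<^sup>+x. \<integral>\<^sup>+y. k (x, y) \<partial>\<nu> \<partial>\<mu>) \<le> (\<integral>\<^sup>+x. liminf (\<lambda>n. \<integral>\<^sup>+y. step n (k (x, y)) \<partial>\<nu>) \<partial>\<mu>)"
      by (intro nn_integral_mono nn_integral_le_liminf_step kmeas)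
    also have "\<dots> \<le> liminf (\<lambda>n. \<integral>\<^sup>+x. \<integral>\<^sup>+y. step n (k (x, y)) \<partial>\<nu> \<partial>\<mu>)"
      by (intro nn_integral_liminf imeas)
    also have "\<dots> \<le> (\<integral>\<^sup>+z. k z \<partial>radon_prod \<mu> \<nu>)"
      unfolding eq[symmetric] by (intro Liminf_le always_eventually allI nn_integral_mono step_le) auto
    finally show "(\<integral>\<^sup>+x. \<integral>\<^sup>+y. k (x, y) \<partial>\<nu> \<partial>\<mu>) \<le> (\<integral>\<^sup>+z. k z \<partial>radon_prod \<mu> \<nu>)" .
  qed
qed

lemma swap_measurable: "prod.swap \<in> borel_measurable (borel :: ('b::topological_space \<times> 'c::topological_space) measure)"
  by (intro borel_measurable_continuous_onI continuous_on_swap)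

lemma vimage_swap: "prod.swap -` A = prod.swap ` A"
  by (auto simp: image_iff) (metis swap_simp)

lemma open_vimage_swap:
  fixes U :: "('b::topological_space \<times> 'c::topological_space) set"
  shows "open U \<Longrightarrow> open (prod.swap -` U)"
  by (intro open_vimage continuous_on_swap)

lemma compact_vimage_swap:
  fixes K :: "('b::topological_space \<times> 'c::topological_space) set"
  shows "compact K \<Longrightarrow> compact (prod.swap -` K)"
  unfolding vimage_swap by (intro compact_continuous_image continuous_on_swap)

lemma vimage_swap_swap: "prod.swap -` (prod.swap -` B) = B"
  by auto

lemma Collect_vimage_swap:
  assumes "\<And>K. P K \<Longrightarrow> Q (prod.swap -` K)" "\<And>K. Q K \<Longrightarrow> P (prod.swap -` K)"
  shows "{K. Q K} = (\<lambda>K. prod.swap -` K) ` {K. P K}"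
proof (intro set_eqI iffI)
  fix K assume "K \<in> {K. Q K}"
  then show "K \<in> (\<lambda>K. prod.swap -` K) ` {K. P K}"
    using assms(2)[of K] by (intro image_eqI[of _ _ "prod.swap -` K"]) (auto simp: vimage_swap_swap)
qed (use assms(1) in auto)

lemma radon_distr_swap:
  fixes \<rho> :: "('b::t2_space \<times> 'c::t2_space) measure"
  assumes "radon \<rho>"
  shows "radon (distr \<rho> borel prod.swap)"
proof -
  note sets = radon_sets[OF assms]
  have sm: "prod.swap \<in> \<rho> \<rightarrow>\<^sub>M borel" using swap_measurable sets measurable_cong_sets by blast
  have em: "emeasure (distr \<rho> borel prod.swap) B = emeasure \<rho> (prod.swap -` B)" if "B \<in> sets borel" for B
    using that sm radon_space[OF assms] by (simp add: emeasure_distr)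
  note oi = open_vimage_swap and ci = compact_vimage_swap
  show ?thesis
    unfolding radon_def
  proof (intro conjI allI impI ballI)
    fix K :: "('c \<times> 'b) set" assume "compact K"
    then show "emeasure (distr \<rho> borel prod.swap) K < \<infinity>"
      using radon_compact[OF assms ci] by (simp add: em borel_compact)
  next
    fix U :: "('c \<times> 'b) set" assume U: "open U"
    have "{K. compact K \<and> K \<subseteq> prod.swap -` U} = (\<lambda>K. prod.swap -` K) ` {K. compact K \<and> K \<subseteq> U}"
      by (rule Collect_vimage_swap) (auto intro: ci)
    then have "emeasure \<rho> (prod.swap -` U) = (SUP K\<in>{K. compact K \<and> K \<subseteq> U}. emeasure \<rho> (prod.swap -` K))"
      unfolding radon_inner[OF assms oi[OF U]] by (simp add: image_image)
    also have "\<dots> = (SUP K\<in>{K. compact K \<and> K \<subseteq> U}. emeasure (distr \<rho> borel prod.swap) K)"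
      by (intro SUP_cong refl) (auto simp: em borel_compact)
    finally show "emeasure (distr \<rho> borel prod.swap) U = (SUP K\<in>{K. compact K \<and> K \<subseteq> U}. emeasure (distr \<rho> borel prod.swap) K)"
      using U by (simp add: em)
  next
    fix B :: "('c \<times> 'b) set" assume B: "B \<in> sets borel"
    have "{U. open U \<and> prod.swap -` B \<subseteq> U} = (\<lambda>K. prod.swap -` K) ` {U. open U \<and> B \<subseteq> U}"
      by (rule Collect_vimage_swap) (auto intro: oi simp: subset_iff)
    moreover have "prod.swap -` B \<in> sets borel"
      using measurable_sets[OF swap_measurable B] by simp
    ultimately have "emeasure \<rho> (prod.swap -` B) = (INF U\<in>{U. open U \<and> B \<subseteq> U}. emeasure \<rho> (prod.swap -` U))"
      using radon_outer[OF assms, of "prod.swap -` B"] by (simp add: image_image)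
    also have "\<dots> = (INF U\<in>{U. open U \<and> B \<subseteq> U}. emeasure (distr \<rho> borel prod.swap) U)"
      by (intro INF_cong refl) (auto simp: em)
    finally show "emeasure (distr \<rho> borel prod.swap) B = (INF U\<in>{U. open U \<and> B \<subseteq> U}. emeasure (distr \<rho> borel prod.swap) U)"
      using B by (simp add: em)
  qed simp
qed

text \<open>
  The image of the product measure under the swap of coordinates has the right values on compact
  rectangles, hence is the product in the other order.
\<close>

lemma nn_integral_commute_lsc:
  fixes \<mu> :: "'b::t2_space measure" and \<nu> :: "'c::t2_space measure"
  assumes lcb: "locally_compact_space (euclidean :: 'b topology)"
    and lcc: "locally_compact_space (euclidean :: 'c topology)"
    and \<mu>: "radon \<mu>" and \<nu>: "radon \<nu>" and k: "lsc_nn k"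
  shows "(\<integral>\<^sup>+x. \<integral>\<^sup>+y. k (x, y) \<partial>\<nu> \<partial>\<mu>) = (\<integral>\<^sup>+y. \<integral>\<^sup>+x. k (x, y) \<partial>\<mu> \<partial>\<nu>)"
proof -
  let ?\<rho> = "radon_prod \<nu> \<mu>"
  note \<rho> = radon_radon_prod[OF lcc lcb \<nu> \<mu>]
  have sm: "prod.swap \<in> ?\<rho> \<rightarrow>\<^sub>M borel" using swap_measurable radon_sets[OF \<rho>] measurable_cong_sets by blast
  have "radon_prod \<mu> \<nu> = distr ?\<rho> borel prod.swap"
  proof (rule radon_prod_eqI[OF lcb lcc radon_distr_swap[OF \<rho>]])
    fix K :: "'b set" and L :: "'c set" assume KL: "compact K" "compact L"
    have "prod.swap -` (K \<times> L) = L \<times> K" by auto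
    then show "emeasure (distr ?\<rho> borel prod.swap) (K \<times> L) = emeasure \<mu> K * emeasure \<nu> L"
      using KL sm radon_space[OF \<rho>] radon_prod_Times[OF lcc lcb \<nu> \<mu> KL(2,1)] compact_Times[OF KL]
      by (simp add: emeasure_distr borel_compact mult.commute)
  qed
  then have "(\<integral>\<^sup>+x. \<integral>\<^sup>+y. k (x, y) \<partial>\<nu> \<partial>\<mu>) = (\<integral>\<^sup>+z. k (prod.swap z) \<partial>?\<rho>)"
    using nn_integral_radon_prod[OF lcb lcc \<mu> \<nu> k] nn_integral_distr[OF sm, of k] lsc_nn_measurable[OF k] by simp
  also have "\<dots> = (\<integral>\<^sup>+y. \<integral>\<^sup>+x. k (x, y) \<partial>\<mu> \<partial>\<nu>)"
  proof -
    have "lsc_nn (\<lambda>z. k (prod.swap z))"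
      unfolding lsc_nn_def
    proof
      fix t
      have "open (prod.swap -` {z. t < k z})"
        by (intro open_vimage_swap lsc_nn_open k)
      then show "open {z. t < k (prod.swap z)}" by (simp add: vimage_def)
    qed
    then show ?thesis using nn_integral_radon_prod[OF lcc lcb \<nu> \<mu>] by simp
  qed
  finally show ?thesis .
qed

section \<open>Linear combinations, restrictions and Jordan decompositions of Radon measures\<close>

text \<open>
  Only nonnegative coefficients are meaningful: \<^const>\<open>ennreal\<close> replaces negative ones by \<open>0\<close>.
\<close>

definition comb :: "'i set \<Rightarrow> ('i \<Rightarrow> real) \<Rightarrow> ('i \<Rightarrow> 'b::topological_space measure) \<Rightarrow> 'b measure" where
  "comb F w \<nu> = measure_of UNIV (sets borel) (\<lambda>B. \<Sum>i\<in>F. ennreal (w i) * emeasure (\<nu> i) B)"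

lemma sets_comb [simp]: "sets (comb F w \<nu>) = sets borel"
  unfolding comb_def by (metis sets.sigma_sets_eq sets_measure_of space_borel subset_UNIV Pow_UNIV)

lemma space_comb [simp]: "space (comb F w \<nu>) = UNIV"
  using sets_eq_imp_space_eq[OF sets_comb] by simp

lemma emeasure_comb:
  assumes "\<And>i. i \<in> F \<Longrightarrow> sets (\<nu> i) = sets borel" "B \<in> sets borel"
  shows "emeasure (comb F w \<nu>) B = (\<Sum>i\<in>F. ennreal (w i) * emeasure (\<nu> i) B)"
  unfolding comb_def
proof (rule emeasure_measure_of_sigma)
  show "sigma_algebra UNIV (sets borel :: 'b set set)" using sets.sigma_algebra_axioms[of "borel :: 'b measure"] by simp
  show "positive (sets borel) (\<lambda>B. \<Sum>i\<in>F. ennreal (w i) * emeasure (\<nu> i) B)" by (simp add: positive_def)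
  show "countably_additive (sets borel) (\<lambda>B. \<Sum>i\<in>F. ennreal (w i) * emeasure (\<nu> i) B)"
  proof (rule countably_additiveI)
    fix A :: "nat \<Rightarrow> 'b set" assume A: "range A \<subseteq> sets borel" "disjoint_family A"
    have "(\<Sum>n. \<Sum>i\<in>F. ennreal (w i) * emeasure (\<nu> i) (A n)) = (\<Sum>i\<in>F. \<Sum>n. ennreal (w i) * emeasure (\<nu> i) (A n))"
      by (rule suminf_sum) simp
    also have "\<dots> = (\<Sum>i\<in>F. ennreal (w i) * emeasure (\<nu> i) (\<Union>n. A n))"
      using A assms(1) by (intro sum.cong refl) (simp add: suminf_emeasure)
    finally show "(\<Sum>n. \<Sum>i\<in>F. ennreal (w i) * emeasure (\<nu> i) (A n)) = (\<Sum>i\<in>F. ennreal (w i) * emeasure (\<nu> i) (\<Union>n. A n))" .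
  qed
qed (rule assms)

lemma nn_integral_comb:
  assumes "finite F" and sets: "\<And>i. i \<in> F \<Longrightarrow> sets (\<nu> i) = sets borel" and h: "h \<in> borel_measurable borel"
  shows "(\<integral>\<^sup>+x. h x \<partial>comb F w \<nu>) = (\<Sum>i\<in>F. ennreal (w i) * (\<integral>\<^sup>+x. h x \<partial>\<nu> i))"
  using h
proof (induction rule: borel_measurable_induct)
  case (cong f g)
  then show ?case by (simp add: cong)
next
  case (set A)
  then show ?case using sets by (simp add: emeasure_comb cong: sum.cong)
next
  case (mult u v)
  have "u \<in> borel_measurable (\<nu> i)" if "i \<in> F" for i
    using mult measurable_cong_sets[OF sets[OF that] refl] by blast
  moreover have "u \<in> borel_measurable (comb F w \<nu>)"
    using mult measurable_cong_sets[OF sets_comb refl] by blast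
  ultimately show ?case using mult
    by (simp add: nn_integral_cmult sum_distrib_left mult.left_commute cong: sum.cong)
next
  case (add u v)
  have "u \<in> borel_measurable (\<nu> i)" "v \<in> borel_measurable (\<nu> i)" if "i \<in> F" for i
    using add measurable_cong_sets[OF sets[OF that] refl] by blast+
  moreover have "u \<in> borel_measurable (comb F w \<nu>)" "v \<in> borel_measurable (comb F w \<nu>)"
    using add measurable_cong_sets[OF sets_comb refl] by blast+
  ultimately show ?case using add
    by (simp add: nn_integral_add sum.distrib distrib_left cong: sum.cong)
next
  case (seq U)
  have m: "U n \<in> borel_measurable (\<nu> i)" if "i \<in> F" for i n
    using seq measurable_cong_sets[OF sets[OF that] refl] by blast
  have m': "U n \<in> borel_measurable (comb F w \<nu>)" for n
    using seq measurable_cong_sets[OF sets_comb refl] by blast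
  have inc: "incseq (\<lambda>n. \<integral>\<^sup>+x. U n x \<partial>\<mu>)" for \<mu>
    using seq by (auto simp: incseq_def le_fun_def intro!: nn_integral_mono)
  have "(\<integral>\<^sup>+x. (SUP n. U n x) \<partial>comb F w \<nu>) = (SUP n. \<integral>\<^sup>+x. U n x \<partial>comb F w \<nu>)"
    by (intro nn_integral_monotone_convergence_SUP m' seq)
  also have "\<dots> = (SUP n. \<Sum>i\<in>F. ennreal (w i) * (\<integral>\<^sup>+x. U n x \<partial>\<nu> i))" by (simp add: seq)
  also have "\<dots> = (\<Sum>i\<in>F. SUP n. ennreal (w i) * (\<integral>\<^sup>+x. U n x \<partial>\<nu> i))"
    using inc by (intro ennreal_SUP_sum) (auto simp: incseq_def intro!: mult_left_mono)
  also have "\<dots> = (\<Sum>i\<in>F. ennreal (w i) * (\<integral>\<^sup>+x. (SUP n. U n x) \<partial>\<nu> i))"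
    using m seq by (intro sum.cong refl) (simp add: SUP_mult_left_ennreal nn_integral_monotone_convergence_SUP)
  finally show ?case by (simp add: SUP_apply image_image)
qed

lemma radon_comb:
  fixes \<nu> :: "'i \<Rightarrow> 'b::t2_space measure"
  assumes F: "finite F" and rad: "\<And>i. i \<in> F \<Longrightarrow> radon (\<nu> i)"
  shows "radon (comb F w \<nu>)"
proof -
  have sets: "sets (\<nu> i) = sets borel" if "i \<in> F" for i using radon_sets[OF rad[OF that]] .
  note em = emeasure_comb[of F \<nu>, OF sets]
  show ?thesis
    unfolding radon_def
  proof (intro conjI allI impI ballI)
    fix K :: "'b set" assume K: "compact K"
    show "emeasure (comb F w \<nu>) K < \<infinity>"
      using F radon_compact[OF rad K] by (simp add: em borel_compact K ennreal_mult_less_top)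
  next
    fix U :: "'b set" assume U: "open U"
    show "emeasure (comb F w \<nu>) U = (SUP K\<in>{K. compact K \<and> K \<subseteq> U}. emeasure (comb F w \<nu>) K)"
    proof (rule antisym)
      show "emeasure (comb F w \<nu>) U \<le> (SUP K\<in>{K. compact K \<and> K \<subseteq> U}. emeasure (comb F w \<nu>) K)"
      proof (rule dense_le)
        fix t assume "t < emeasure (comb F w \<nu>) U"
        then have "t < (\<Sum>i\<in>F. ennreal (w i) * (SUP K\<in>{K. compact K \<and> K \<subseteq> U}. emeasure (\<nu> i) K))"
          using radon_inner[OF rad U] U by (simp add: em cong: sum.cong)
        then obtain K where K: "\<And>i. i \<in> F \<Longrightarrow> K i \<in> {K. compact K \<and> K \<subseteq> U}"
            and t: "t < (\<Sum>i\<in>F. ennreal (w i) * emeasure (\<nu> i) (K i))"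
          by (rule sum_less_SUP[OF F, rotated]) auto
        have cK: "compact (\<Union>i\<in>F. K i)" using K F by (intro compact_UN) auto
        have "t < (\<Sum>i\<in>F. ennreal (w i) * emeasure (\<nu> i) (\<Union>i\<in>F. K i))"
          using sets cK by (intro less_le_trans[OF t] sum_mono mult_left_mono emeasure_mono) (auto simp: borel_compact)
        also have "\<dots> = emeasure (comb F w \<nu>) (\<Union>i\<in>F. K i)" using cK by (simp add: em borel_compact)
        finally show "t \<le> (SUP K\<in>{K. compact K \<and> K \<subseteq> U}. emeasure (comb F w \<nu>) K)"
          using K cK by (intro SUP_upper2[of "\<Union>i\<in>F. K i"]) auto
      qed
      show "(SUP K\<in>{K. compact K \<and> K \<subseteq> U}. emeasure (comb F w \<nu>) K) \<le> emeasure (comb F w \<nu>) U"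
        using U by (intro SUP_least emeasure_mono) auto
    qed
  next
    fix B :: "'b set" assume B: "B \<in> sets borel"
    show "emeasure (comb F w \<nu>) B = (INF U\<in>{U. open U \<and> B \<subseteq> U}. emeasure (comb F w \<nu>) U)"
    proof (rule antisym)
      show "emeasure (comb F w \<nu>) B \<le> (INF U\<in>{U. open U \<and> B \<subseteq> U}. emeasure (comb F w \<nu>) U)"
        by (intro INF_greatest emeasure_mono) auto
      show "(INF U\<in>{U. open U \<and> B \<subseteq> U}. emeasure (comb F w \<nu>) U) \<le> emeasure (comb F w \<nu>) B"
      proof (rule dense_ge)
        fix t assume "emeasure (comb F w \<nu>) B < t"
        then have "(\<Sum>i\<in>F. ennreal (w i) * (INF U\<in>{U. open U \<and> B \<subseteq> U}. emeasure (\<nu> i) U)) < t"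
          using radon_outer[OF rad B] B by (simp add: em cong: sum.cong)
        then obtain U where U: "\<And>i. i \<in> F \<Longrightarrow> U i \<in> {U. open U \<and> B \<subseteq> U}"
            and t: "(\<Sum>i\<in>F. ennreal (w i) * emeasure (\<nu> i) (U i)) < t"
          by (rule sum_INF_less[OF F, rotated]) auto
        have oU: "open (\<Inter>i\<in>F. U i)" using U F by (intro open_INT) auto
        have "emeasure (comb F w \<nu>) (\<Inter>i\<in>F. U i) = (\<Sum>i\<in>F. ennreal (w i) * emeasure (\<nu> i) (\<Inter>i\<in>F. U i))"
          using oU by (simp add: em)
        also have "\<dots> \<le> (\<Sum>i\<in>F. ennreal (w i) * emeasure (\<nu> i) (U i))"
          using sets U by (intro sum_mono mult_left_mono emeasure_mono) auto
        also have "\<dots> < t" by (rule t)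
        finally show "(INF U\<in>{U. open U \<and> B \<subseteq> U}. emeasure (comb F w \<nu>) U) \<le> t"
          using U oU by (intro INF_lower2[of "\<Inter>i\<in>F. U i"]) auto
      qed
    qed
  qed simp
qed

lemma Mplus_comb:
  fixes \<nu> :: "'i \<Rightarrow> 'b::t2_space measure"
  assumes F: "finite F" and rad: "\<And>i. i \<in> F \<Longrightarrow> \<nu> i \<in> Mplus E"
  shows "comb F w \<nu> \<in> Mplus E"
proof -
  have rad': "radon (\<nu> i)" if "i \<in> F" for i using rad[OF that] by (simp add: Mplus_def)
  have "x \<notin> msupport (comb F w \<nu>)" if x: "x \<notin> E" for x
  proof -
    have "\<exists>U. open U \<and> x \<in> U \<and> emeasure (\<nu> i) U = 0" if "i \<in> F" for i
      using rad[OF that] x by (auto simp: Mplus_def msupport_def)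
    then obtain U where U: "\<And>i. i \<in> F \<Longrightarrow> open (U i) \<and> x \<in> U i \<and> emeasure (\<nu> i) (U i) = 0" by metis
    have oU: "open (\<Inter>i\<in>F. U i)" using U F by (intro open_INT) auto
    have "emeasure (\<nu> i) (\<Inter>i\<in>F. U i) = 0" if "i \<in> F" for i
      using emeasure_mono[of "\<Inter>i\<in>F. U i" "U i" "\<nu> i"] U[OF that] that radon_sets[OF rad'[OF that]] by auto
    then have "emeasure (comb F w \<nu>) (\<Inter>i\<in>F. U i) = 0"
      using oU radon_sets[OF rad'] by (subst emeasure_comb) auto
    then show ?thesis using oU U unfolding msupport_def by auto
  qed
  then show ?thesis using radon_comb[of F \<nu> w] F rad' by (auto simp: Mplus_def)
qed

text \<open>
  Approximation from inside and outside is inherited because it is governed by \<open>P\<close>-small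
  differences inside the compact set \<open>K\<close>, where \<open>P\<close> is finite. This covers restrictions to
  compact sets and the parts of a Jordan decomposition.
\<close>

lemma radon_dominated:
  fixes P Q :: "'b::t2_space measure"
  assumes P: "radon P" and K: "compact K" and sQ: "sets Q = sets borel"
    and le: "\<And>B. B \<in> sets borel \<Longrightarrow> emeasure Q B \<le> emeasure P (B \<inter> K)"
  shows "radon Q"
proof -
  note sP = radon_sets[OF P]
  have bK: "K \<in> sets borel" using K by (rule borel_compact)
  have small: "\<exists>U. open U \<and> B \<subseteq> U \<and> emeasure P (U - B) < e" if B: "B \<in> sets borel" "B \<subseteq> K" and e: "0 < e" for B e
  proof -
    have fin: "emeasure P B < \<infinity>"
      using emeasure_mono[of B K P] B bK sP radon_compact[OF P K] by (auto intro: le_less_trans)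
    then have "emeasure P B < emeasure P B + e"
      using e by (metis add.right_neutral ennreal_add_left_cancel_less infinity_ennreal_def)
    then obtain U where U: "open U" "B \<subseteq> U" "emeasure P U < emeasure P B + e"
      using radon_outer[OF P B(1)] by (auto simp: INF_less_iff)
    have "emeasure P U = emeasure P B + emeasure P (U - B)"
      using U B sP by (subst plus_emeasure) (auto simp: Un_absorb1)
    then show ?thesis using U fin by (auto simp: ennreal_add_left_cancel_less)
  qed
  have mono: "emeasure Q B \<le> emeasure P C" if "B \<in> sets borel" "C \<in> sets borel" "B \<inter> K \<subseteq> C" for B C
    using le[OF that(1)] emeasure_mono[of "B \<inter> K" C P] that sP by (auto intro: order_trans)
  have near: "emeasure Q C \<le> emeasure Q B + e"
    if "B \<in> sets borel" "C \<in> sets borel" "D \<in> sets borel" "B \<subseteq> C" "(C - B) \<inter> K \<subseteq> D" "emeasure P D < e" for B C D e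
  proof -
    have "emeasure Q C = emeasure Q B + emeasure Q (C - B)"
      using that sQ by (subst plus_emeasure) (auto simp: Un_absorb1)
    also have "emeasure Q (C - B) \<le> emeasure P D" using that by (intro mono) auto
    finally show ?thesis using that(6) by (meson add_left_mono less_imp_le order_trans)
  qed
  show ?thesis
    unfolding radon_def
  proof (intro conjI allI impI ballI)
    fix C :: "'b set" assume C: "compact C"
    show "emeasure Q C < \<infinity>"
      using mono[of C K] C bK radon_compact[OF P K] by (auto simp: borel_compact intro: le_less_trans)
  next
    fix U :: "'b set" assume U: "open U"
    show "emeasure Q U = (SUP K\<in>{K. compact K \<and> K \<subseteq> U}. emeasure Q K)"
    proof (rule antisym)
      show "emeasure Q U \<le> (SUP K\<in>{K. compact K \<and> K \<subseteq> U}. emeasure Q K)"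
      proof (rule ennreal_le_epsilon)
        fix e :: real assume e: "0 < e"
        obtain V where V: "open V" "K - U \<subseteq> V" "emeasure P (V - (K - U)) < ennreal e"
          using small[of "K - U" "ennreal e"] U bK e by auto
        let ?C = "K - V"
        have cC: "compact ?C" using K V(1) by (rule compact_diff)
        have "emeasure Q U \<le> emeasure Q ?C + ennreal e"
          by (rule near[of _ _ "V - (K - U)"]) (use V U bK borel_compact[OF cC] in auto)
        also have "emeasure Q ?C \<le> (SUP K\<in>{K. compact K \<and> K \<subseteq> U}. emeasure Q K)"
          using V cC by (intro SUP_upper) auto
        finally show "emeasure Q U \<le> (SUP K\<in>{K. compact K \<and> K \<subseteq> U}. emeasure Q K) + ennreal e"
          by (simp add: add_right_mono)
      qed
      show "(SUP K\<in>{K. compact K \<and> K \<subseteq> U}. emeasure Q K) \<le> emeasure Q U"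
        using U sQ by (intro SUP_least emeasure_mono) auto
    qed
  next
    fix B :: "'b set" assume B: "B \<in> sets borel"
    show "emeasure Q B = (INF U\<in>{U. open U \<and> B \<subseteq> U}. emeasure Q U)"
    proof (rule antisym)
      show "emeasure Q B \<le> (INF U\<in>{U. open U \<and> B \<subseteq> U}. emeasure Q U)"
        using sQ by (intro INF_greatest emeasure_mono) auto
      show "(INF U\<in>{U. open U \<and> B \<subseteq> U}. emeasure Q U) \<le> emeasure Q B"
      proof (rule ennreal_le_epsilon)
        fix e :: real assume e: "0 < e"
        obtain V where V: "open V" "B \<inter> K \<subseteq> V" "emeasure P (V - (B \<inter> K)) < ennreal e"
          using small[of "B \<inter> K" "ennreal e"] B bK e by auto
        have oU: "open (V \<union> - K)" using V compact_imp_closed[OF K] by auto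
        have "(INF U\<in>{U. open U \<and> B \<subseteq> U}. emeasure Q U) \<le> emeasure Q (V \<union> - K)"
          using V oU by (intro INF_lower) auto
        also have "\<dots> \<le> emeasure Q B + ennreal e"
          by (rule near[of _ _ "V - (B \<inter> K)"]) (use V oU B bK in auto)
        finally show "(INF U\<in>{U. open U \<and> B \<subseteq> U}. emeasure Q U) \<le> emeasure Q B + ennreal e" .
      qed
    qed
  qed (rule sQ)
qed

definition restr :: "'b set \<Rightarrow> 'b measure \<Rightarrow> 'b measure" where
  "restr K P = density P (indicator K)"

lemma sets_restr [simp]: "sets (restr K P) = sets P"
  by (simp add: restr_def)

lemma emeasure_restr:
  assumes "K \<in> sets P" "B \<in> sets P"
  shows "emeasure (restr K P) B = emeasure P (B \<inter> K)"
proof -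
  have "emeasure (restr K P) B = (\<integral>\<^sup>+x. indicator K x * indicator B x \<partial>P)"
    using assms by (simp add: restr_def emeasure_density)
  also have "\<dots> = (\<integral>\<^sup>+x. indicator (B \<inter> K) x \<partial>P)"
    by (intro nn_integral_cong) (auto split: split_indicator)
  finally show ?thesis using assms by simp
qed

lemma radon_restr:
  fixes P :: "'b::t2_space measure"
  assumes "radon P" "compact K" "Y \<in> sets borel" "Y \<subseteq> K"
  shows "radon (restr Y P)"
  using assms radon_sets[OF assms(1)]
  by (intro radon_dominated[OF assms(1,2)]) (auto simp: emeasure_restr borel_compact intro!: emeasure_mono)

text \<open>
  For a Hahn set \<open>Y \<subseteq> K\<close>, on which \<open>P\<close> dominates \<open>N\<close>, the common part \<open>M\<close> is \<open>N\<close> on \<open>Y\<close> and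
  \<open>P\<close> on \<open>K - Y\<close>; it is the minimum of the two measures on \<open>K\<close>.
\<close>

lemma Jordan_on_compact:
  fixes P N :: "'b::t2_space measure"
  assumes P: "radon P" and N: "radon N" and K: "compact K"
  obtains P' N' M where "radon M" "(P', N') \<in> signed_radon"
    "\<forall>B\<in>sets borel. emeasure (restr K P) B = emeasure P' B + emeasure M B"
    "\<forall>B\<in>sets borel. emeasure (restr K N) B = emeasure N' B + emeasure M B"
proof -
  note sP = radon_sets[OF P] and sN = radon_sets[OF N]
  have bK: "K \<in> sets borel" using K by (rule borel_compact)
  obtain Y where Y: "Y \<in> sets borel" "Y \<subseteq> K"
     "\<And>X. X \<in> sets borel \<Longrightarrow> X \<subseteq> Y \<Longrightarrow> emeasure N X \<le> emeasure P X"
     "\<And>X. X \<in> sets borel \<Longrightarrow> X \<subseteq> K \<Longrightarrow> X \<inter> Y = {} \<Longrightarrow> emeasure P X \<le> emeasure N X"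
    using unsigned_Hahn_decomposition[of N P K] sP sN bK radon_compact[OF P K] radon_compact[OF N K]
    by (auto simp: less_top)
  let ?Z = "K - Y"
  have Z: "?Z \<in> sets borel" "?Z \<subseteq> K" using bK Y by auto
  have fin: "finite_measure (restr X Q)" if "radon Q" "X \<in> sets borel" "X \<subseteq> K" for X Q
  proof (rule finite_measureI)
    have "emeasure (restr X Q) (space Q) = emeasure Q X"
      using that radon_space[OF that(1)] radon_sets[OF that(1)] by (simp add: emeasure_restr)
    also have "\<dots> \<le> emeasure Q K" using that bK radon_sets[OF that(1)] by (intro emeasure_mono) auto
    finally show "emeasure (restr X Q) (space (restr X Q)) \<noteq> \<infinity>"
      using radon_compact[OF that(1) K] by (auto simp: restr_def top_unique)
  qed
  (* What remains after removing the common part is P - N on Y and N - P on K - Y. *)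
  define P' where "P' = diff_measure (restr Y P) (restr Y N)"
  define N' where "N' = diff_measure (restr ?Z N) (restr ?Z P)"
  define M where "M = comb UNIV (\<lambda>_. 1) (\<lambda>b. if b then restr Y N else restr ?Z P)"
  have radM: "radon M" unfolding M_def using Y Z by (intro radon_comb) (auto intro!: radon_restr[OF _ K] P N)
  have eM: "emeasure M B = emeasure N (B \<inter> Y) + emeasure P (B \<inter> ?Z)" if "B \<in> sets borel" for B
    unfolding M_def using that Y Z sP sN
    by (subst emeasure_comb) (auto simp: UNIV_bool emeasure_restr)
  have eP': "emeasure P' B = emeasure P (B \<inter> Y) - emeasure N (B \<inter> Y)" if "B \<in> sets borel" for B
    unfolding P'_def using that Y sP sN fin[OF P Y(1,2)] fin[OF N Y(1,2)]
    by (subst emeasure_diff_measure) (auto simp: emeasure_restr)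
  have eN': "emeasure N' B = emeasure N (B \<inter> ?Z) - emeasure P (B \<inter> ?Z)" if "B \<in> sets borel" for B
    unfolding N'_def using that Y Z sP sN fin[OF P Z(1,2)] fin[OF N Z(1,2)]
    by (subst emeasure_diff_measure) (auto simp: emeasure_restr intro!: Y(4))
  have sP': "sets P' = sets borel" "sets N' = sets borel" by (auto simp: P'_def N'_def sP sN)
  have radP': "radon P'"
  proof (rule radon_dominated[OF P K sP'(1)])
    fix B :: "'b set" assume B: "B \<in> sets borel"
    have "emeasure P' B \<le> emeasure P (B \<inter> Y)" unfolding eP'[OF B] by (rule diff_le_self_ennreal)
    also have "\<dots> \<le> emeasure P (B \<inter> K)" using B Y bK sP by (intro emeasure_mono) auto
    finally show "emeasure P' B \<le> emeasure P (B \<inter> K)" .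
  qed
  have radN': "radon N'"
  proof (rule radon_dominated[OF N K sP'(2)])
    fix B :: "'b set" assume B: "B \<in> sets borel"
    have "emeasure N' B \<le> emeasure N (B \<inter> ?Z)" unfolding eN'[OF B] by (rule diff_le_self_ennreal)
    also have "\<dots> \<le> emeasure N (B \<inter> K)" using B Y bK sN by (intro emeasure_mono) auto
    finally show "emeasure N' B \<le> emeasure N (B \<inter> K)" .
  qed
  have sing: "(P', N') \<in> signed_radon"
    unfolding signed_radon_def
  proof (clarify, intro conjI allI impI radP' radN')
    fix L :: "'b set" assume L: "compact L"
    have "L \<inter> - Y \<inter> Y = {}" "(L - - Y) \<inter> (K - Y) = {}" by auto
    moreover have "L \<in> sets borel" using L by (rule borel_compact)
    ultimately show "\<exists>S\<in>sets borel. emeasure P' (L \<inter> S) = 0 \<and> emeasure N' (L - S) = 0"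
      using Y by (intro bexI[of _ "- Y"]) (auto simp: eP' eN')
  qed
  have split: "emeasure Q (B \<inter> K) = emeasure Q (B \<inter> Y) + emeasure Q (B \<inter> ?Z)"
    if "sets Q = sets borel" "B \<in> sets borel" for B and Q :: "'b measure"
  proof -
    have "B \<inter> K = (B \<inter> Y) \<union> (B \<inter> ?Z)" using Y by auto
    then show ?thesis using that Y Z by (simp add: plus_emeasure[symmetric] del: Diff_iff) (subst plus_emeasure; auto)
  qed
  show thesis
  proof (rule that[OF radM sing]; intro ballI)
    fix B :: "'b set" assume B: "B \<in> sets borel"
    have "emeasure N (B \<inter> Y) \<le> emeasure P (B \<inter> Y)" using Y B by auto
    then have "emeasure P (B \<inter> Y) = emeasure P' B + emeasure N (B \<inter> Y)"
      unfolding eP'[OF B] by (simp add: diff_add_cancel_ennreal)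
    then show "emeasure (restr K P) B = emeasure P' B + emeasure M B"
      using B bK sP split[OF sP B] by (simp add: emeasure_restr eM ac_simps)
    have "emeasure P (B \<inter> ?Z) \<le> emeasure N (B \<inter> ?Z)" using Y(4)[of "B \<inter> ?Z"] Z B by auto
    then have "emeasure N (B \<inter> ?Z) = emeasure N' B + emeasure P (B \<inter> ?Z)"
      unfolding eN'[OF B] by (simp add: diff_add_cancel_ennreal)
    then show "emeasure (restr K N) B = emeasure N' B + emeasure M B"
      using B bK sN split[OF sN B] by (simp add: emeasure_restr eM ac_simps)
  qed
qed

section \<open>Energies of Radon measures and positive definiteness\<close>

text \<open>
  The function \<open>u + c\<close> has a single nonnegative integral, and the negative part of \<open>u\<close> is bounded
  by \<open>c\<close>, so that the pairing is always defined.
\<close>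

lemma pairing_shift:
  fixes u :: "'b \<Rightarrow> ereal"
  assumes u: "u \<in> borel_measurable \<nu>" and c: "0 \<le> c" and uc: "\<And>x. 0 \<le> u x + ereal c"
    and fin: "c = 0 \<or> emeasure \<nu> (space \<nu>) < \<infinity>"
  shows "pairing (\<lambda>x. Some (u x)) \<nu> =
    Some (enn2ereal (\<integral>\<^sup>+x. e2ennreal (u x + ereal c) \<partial>\<nu>) - ereal (c * measure \<nu> (space \<nu>)))"
proof -
  note [measurable] = u
  let ?A = "\<integral>\<^sup>+x. e2ennreal (u x) \<partial>\<nu>" and ?N = "\<integral>\<^sup>+x. e2ennreal (- u x) \<partial>\<nu>"
    and ?S = "\<integral>\<^sup>+x. e2ennreal (u x + ereal c) \<partial>\<nu>"
  have pt: "e2ennreal (u x + ereal c) + e2ennreal (- u x) = e2ennreal (u x) + ennreal c \<and> e2ennreal (- u x) \<le> ennreal c" for x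
  proof (cases "u x")
    case (real r)
    then have "0 \<le> r + c" using uc[of x] by simp
    then show ?thesis using real c
      by (cases "0 \<le> r") (auto simp: ennreal_plus[symmetric] ennreal_neg ennreal_le_iff simp del: ennreal_plus)
  qed (use uc[of x] in \<open>auto simp: e2ennreal_neg\<close>)
  have cM: "(\<integral>\<^sup>+x. ennreal c \<partial>\<nu>) = ennreal (c * measure \<nu> (space \<nu>))"
    using fin c by (auto simp: emeasure_eq_ennreal_measure less_top ennreal_mult)
  have "?S + ?N = (\<integral>\<^sup>+x. e2ennreal (u x + ereal c) + e2ennreal (- u x) \<partial>\<nu>)" by (rule nn_integral_add[symmetric]) measurable
  also have "\<dots> = (\<integral>\<^sup>+x. e2ennreal (u x) + ennreal c \<partial>\<nu>)" using pt by simp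
  also have "\<dots> = ?A + (\<integral>\<^sup>+x. ennreal c \<partial>\<nu>)" by (rule nn_integral_add) measurable
  finally have eq: "?S + ?N = ?A + ennreal (c * measure \<nu> (space \<nu>))" unfolding cM .
  have "?N \<le> (\<integral>\<^sup>+x. ennreal c \<partial>\<nu>)" using pt by (intro nn_integral_mono) auto
  then have "?N \<le> ennreal (c * measure \<nu> (space \<nu>))" unfolding cM .
  then obtain n where n: "?N = ennreal n" "0 \<le> n" by (metis ennreal_cases ennreal_less_top top.not_eq_extremum leD)
  define q where "q = c * measure \<nu> (space \<nu>)"
  have q: "0 \<le> q" using c by (simp add: q_def)
  have "pairing (\<lambda>x. Some (u x)) \<nu> = pdiff (Some (enn2ereal ?A)) (Some (enn2ereal ?N))"
    unfolding pairing_def using u by auto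
  also have "\<dots> = Some (enn2ereal ?A - ereal n)"
    using n by (simp add: pdiff_def padd_def minus_ereal_def)
  also have "enn2ereal ?A - ereal n = enn2ereal ?S - ereal q"
  proof (cases ?A)
    case (real a)
    then have "?S + ennreal n = ennreal (a + q)" using eq n q by (simp add: q_def)
    then obtain s where s: "?S = ennreal s" "0 \<le> s"
      by (metis ennreal_cases ennreal_add_eq_top ennreal_neq_top)
    then have "s + n = a + q" using \<open>?S + ennreal n = ennreal (a + q)\<close> n q real
      by (simp add: ennreal_plus[symmetric] del: ennreal_plus)
    then show ?thesis using s real n by simp
  next
    case top
    then have "?S = top" using eq n by (metis ennreal_add_eq_top ennreal_neq_top)
    then show ?thesis using top by simp
  qed
  finally show ?thesis by (simp add: q_def)
qed

text \<open>
  The constant \<open>c\<close> makes the kernel nonnegative. It is \<open>0\<close> unless the space is compact, and then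
  all Radon measures are finite; in either case \<open>c\<close> times a mass is a real number.
\<close>

locale lc_kernel =
  fixes \<kappa> :: "'a::t2_space kernel" and c :: real
  assumes lc: "locally_compact_space (euclidean :: 'a topology)"
    and Phi: "\<kappa> \<in> Phi" and pd: "positive_definite \<kappa>"
    and c_nonneg: "0 \<le> c" and shift_nonneg: "0 \<le> \<kappa> z + ereal c"
    and c_compact: "c \<noteq> 0 \<Longrightarrow> compact (UNIV :: 'a set)"
begin

definition k :: "'a \<times> 'a \<Rightarrow> ennreal" where
  "k z = e2ennreal (\<kappa> z + ereal c)"

text \<open>
  The mutual energy for the nonnegative kernel \<open>k = \<kappa> + c\<close>, as an iterated integral.
\<close>

definition D :: "'a measure \<Rightarrow> 'a measure \<Rightarrow> ennreal" where
  "D \<mu> \<nu> = (\<integral>\<^sup>+x. \<integral>\<^sup>+y. k (x, y) \<partial>\<nu> \<partial>\<mu>)"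

text \<open>
  The mutual energy for \<open>\<kappa>\<close>, provided that \<open>D \<mu> \<nu>\<close> is finite.
\<close>

definition e :: "'a measure \<Rightarrow> 'a measure \<Rightarrow> real" where
  "e \<mu> \<nu> = enn2real (D \<mu> \<nu>) - c * measure \<mu> UNIV * measure \<nu> UNIV"

lemma lsc_kappa: "open {z. t < \<kappa> z}"
  using Phi by (simp add: Phi_def lsc_def)

lemma kappa_measurable: "\<kappa> \<in> borel_measurable borel"
  by (rule borel_measurableI_greater) (simp add: lsc_kappa)

lemma lsc_k: "lsc_nn k"
  unfolding lsc_nn_def
proof
  fix t
  have "t < k z \<longleftrightarrow> enn2ereal t - ereal c < \<kappa> z" for z
  proof -
    have "t < k z \<longleftrightarrow> enn2ereal t < \<kappa> z + ereal c"
      unfolding k_def using shift_nonneg[of z] by (simp add: less_ennreal.rep_eq enn2ereal_e2ennreal)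
    also have "\<dots> \<longleftrightarrow> enn2ereal t - ereal c < \<kappa> z"
      by (cases "enn2ereal t"; cases "\<kappa> z") auto
    finally show ?thesis .
  qed
  then show "open {z. t < k z}" using lsc_kappa by simp
qed

lemma k_sym: "k (x, y) = k (y, x)"
  using pd by (simp add: positive_definite_def k_def)

lemma k_section_measurable: "sets \<nu> = sets borel \<Longrightarrow> (\<lambda>y. k (x, y)) \<in> borel_measurable \<nu>"
  using lsc_nn_measurable[OF lsc_nn_section[OF lsc_k]] measurable_cong_sets by blast

lemma potential_measurable:
  "radon \<nu> \<Longrightarrow> (\<lambda>x. \<integral>\<^sup>+y. k (x, y) \<partial>\<nu>) \<in> borel_measurable borel"
  by (intro lsc_nn_measurable lsc_nn_integral_section lsc_k)

lemma D_commute: "radon \<mu> \<Longrightarrow> radon \<nu> \<Longrightarrow> D \<mu> \<nu> = D \<nu> \<mu>"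
  unfolding D_def using nn_integral_commute_lsc[OF lc lc _ _ lsc_k, of \<mu> \<nu>] k_sym by simp

lemma e_commute: "radon \<mu> \<Longrightarrow> radon \<nu> \<Longrightarrow> e \<mu> \<nu> = e \<nu> \<mu>"
  by (simp add: e_def D_commute)

lemma finite_mass: "radon (\<mu> :: 'a measure) \<Longrightarrow> c \<noteq> 0 \<Longrightarrow> emeasure \<mu> UNIV < \<infinity>"
  by (rule radon_compact[OF _ c_compact])

lemma energy_eq:
  assumes \<mu>: "radon \<mu>" and \<nu>: "radon \<nu>"
  shows "energy \<kappa> \<mu> \<nu> = Some (enn2ereal (D \<mu> \<nu>) - ereal (c * measure \<mu> UNIV * measure \<nu> UNIV))"
proof -
  note rad = radon_radon_prod[OF lc lc \<mu> \<nu>]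
  have "c * measure (radon_prod \<mu> \<nu>) UNIV = c * (measure \<mu> UNIV * measure \<nu> UNIV)"
  proof (cases "c = 0")
    case False
    then have "emeasure (radon_prod \<mu> \<nu>) (UNIV \<times> UNIV) = emeasure \<mu> UNIV * emeasure \<nu> UNIV"
      using radon_prod_Times[OF lc lc \<mu> \<nu>] c_compact by blast
    then show ?thesis by (simp add: measure_def enn2real_mult)
  qed simp
  moreover have "pairing (\<lambda>z. Some (\<kappa> z)) (radon_prod \<mu> \<nu>) =
      Some (enn2ereal (\<integral>\<^sup>+z. k z \<partial>radon_prod \<mu> \<nu>) - ereal (c * measure (radon_prod \<mu> \<nu>) UNIV))"
    unfolding k_def radon_space[OF rad, symmetric]
  proof (rule pairing_shift)
    show "\<kappa> \<in> borel_measurable (radon_prod \<mu> \<nu>)"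
      using kappa_measurable radon_sets[OF rad] measurable_cong_sets by blast
    show "c = 0 \<or> emeasure (radon_prod \<mu> \<nu>) (space (radon_prod \<mu> \<nu>)) < \<infinity>"
      using c_compact compact_Times[of "UNIV :: 'a set" "UNIV :: 'a set"] radon_compact[OF rad] radon_space[OF rad] by auto
  qed (rule c_nonneg shift_nonneg)+
  ultimately show ?thesis
    unfolding energy_def D_def nn_integral_radon_prod[OF lc lc \<mu> \<nu> lsc_k] mult.assoc by (simp only:)
qed

lemma energy_finite: "radon \<mu> \<Longrightarrow> radon \<nu> \<Longrightarrow> D \<mu> \<nu> < \<infinity> \<Longrightarrow> energy \<kappa> \<mu> \<nu> = Some (ereal (e \<mu> \<nu>))"
  by (cases "D \<mu> \<nu>") (auto simp: energy_eq e_def)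

lemma potential_eq:
  assumes \<nu>: "radon \<nu>"
  shows "potential \<kappa> \<nu> x = Some (enn2ereal (\<integral>\<^sup>+y. k (x, y) \<partial>\<nu>) - ereal (c * measure \<nu> UNIV))"
  unfolding potential_def k_def radon_space[OF \<nu>, symmetric]
proof (rule pairing_shift)
  have "(\<lambda>y. \<kappa> (x, y)) \<in> borel_measurable borel"
  proof (rule borel_measurableI_greater)
    fix t
    have "open ((\<lambda>y. (x, y)) -` {z. t < \<kappa> z})"
      by (intro open_vimage lsc_kappa) (auto intro: continuous_intros)
    then show "{y \<in> space borel. t < \<kappa> (x, y)} \<in> sets borel" by (simp add: vimage_def)
  qed
  then show "(\<lambda>y. \<kappa> (x, y)) \<in> borel_measurable \<nu>"
    using radon_sets[OF \<nu>] measurable_cong_sets by blast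
  show "c = 0 \<or> emeasure \<nu> (space \<nu>) < \<infinity>" using finite_mass[OF \<nu>] radon_space[OF \<nu>] by auto
qed (rule c_nonneg shift_nonneg)+

lemma D_comb:
  assumes "finite F" "\<And>i. i \<in> F \<Longrightarrow> sets (\<mu> i) = sets borel" "radon \<nu>"
  shows "D (comb F w \<mu>) \<nu> = (\<Sum>i\<in>F. ennreal (w i) * D (\<mu> i) \<nu>)"
  unfolding D_def using assms by (intro nn_integral_comb potential_measurable)

lemma mass_comb:
  assumes F: "finite F" and rad: "\<And>i. i \<in> F \<Longrightarrow> radon (\<mu> i :: 'a measure)" and w: "\<And>i. i \<in> F \<Longrightarrow> 0 \<le> w i"
  shows "c * measure (comb F w \<mu>) UNIV = (\<Sum>i\<in>F. w i * (c * measure (\<mu> i) UNIV))"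
proof (cases "c = 0")
  case False
  have "emeasure (comb F w \<mu>) UNIV = (\<Sum>i\<in>F. ennreal (w i) * emeasure (\<mu> i) UNIV)"
    by (rule emeasure_comb[OF radon_sets[OF rad]]) simp_all
  also have "\<dots> = (\<Sum>i\<in>F. ennreal (w i * measure (\<mu> i) UNIV))"
    using finite_mass[OF rad False] w by (intro sum.cong refl) (simp add: emeasure_eq_ennreal_measure less_top ennreal_mult)
  also have "\<dots> = ennreal (\<Sum>i\<in>F. w i * measure (\<mu> i) UNIV)" using w by (intro sum_ennreal) auto
  finally have "measure (comb F w \<mu>) UNIV = (\<Sum>i\<in>F. w i * measure (\<mu> i) UNIV)"
    using w by (simp add: measure_def sum_nonneg)
  then show ?thesis by (simp add: sum_distrib_left mult.left_commute)
qed simp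

lemma e_comb:
  assumes F: "finite F" and rad: "\<And>i. i \<in> F \<Longrightarrow> radon (\<mu> i)" and w: "\<And>i. i \<in> F \<Longrightarrow> 0 \<le> w i"
    and \<nu>: "radon \<nu>" and fin: "\<And>i. i \<in> F \<Longrightarrow> D (\<mu> i) \<nu> < \<infinity>"
  shows "D (comb F w \<mu>) \<nu> < \<infinity>" "e (comb F w \<mu>) \<nu> = (\<Sum>i\<in>F. w i * e (\<mu> i) \<nu>)"
proof -
  have D: "D (comb F w \<mu>) \<nu> = (\<Sum>i\<in>F. ennreal (w i) * D (\<mu> i) \<nu>)"
    by (rule D_comb[OF F radon_sets[OF rad] \<nu>])
  show "D (comb F w \<mu>) \<nu> < \<infinity>" unfolding D using F fin by (simp add: ennreal_mult_less_top)
  have "D (comb F w \<mu>) \<nu> = (\<Sum>i\<in>F. ennreal (w i * enn2real (D (\<mu> i) \<nu>)))"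
    unfolding D using fin w by (intro sum.cong refl) (simp add: ennreal_mult less_top)
  also have "\<dots> = ennreal (\<Sum>i\<in>F. w i * enn2real (D (\<mu> i) \<nu>))" using w by (intro sum_ennreal) auto
  finally have "enn2real (D (comb F w \<mu>) \<nu>) = (\<Sum>i\<in>F. w i * enn2real (D (\<mu> i) \<nu>))"
    using w by (simp add: sum_nonneg)
  moreover have "c * measure (comb F w \<mu>) UNIV * measure \<nu> UNIV = (\<Sum>i\<in>F. w i * (c * measure (\<mu> i) UNIV * measure \<nu> UNIV))"
    using mass_comb[OF F rad w] by (simp add: sum_distrib_right mult.assoc)
  ultimately show "e (comb F w \<mu>) \<nu> = (\<Sum>i\<in>F. w i * e (\<mu> i) \<nu>)"
    unfolding e_def by (simp add: sum_subtractf right_diff_distrib)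
qed

lemma D_plus:
  assumes "radon Q" "radon R" "radon \<nu>" "sets P = sets borel"
    and "\<And>B. B \<in> sets borel \<Longrightarrow> emeasure P B = emeasure Q B + emeasure R B"
  shows "D P \<nu> = D Q \<nu> + D R \<nu>" "D Q \<nu> < \<infinity> \<Longrightarrow> D R \<nu> < \<infinity> \<Longrightarrow> e P \<nu> = e Q \<nu> + e R \<nu>" "radon P"
proof -
  let ?f = "\<lambda>b. if b then Q else R"
  have P: "P = comb UNIV (\<lambda>_. 1) ?f"
    using assms radon_sets[OF assms(1)] radon_sets[OF assms(2)]
    by (intro measure_eqI) (auto simp: emeasure_comb UNIV_bool add.commute)
  show "D P \<nu> = D Q \<nu> + D R \<nu>"
    unfolding P using assms radon_sets[OF assms(1)] radon_sets[OF assms(2)]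
    by (subst D_comb) (auto simp: UNIV_bool add.commute)
  show "e P \<nu> = e Q \<nu> + e R \<nu>" if "D Q \<nu> < \<infinity>" "D R \<nu> < \<infinity>"
    unfolding P using assms that by (subst e_comb) (auto simp: UNIV_bool add.commute)
  show "radon P" unfolding P using assms by (intro radon_comb) auto
qed

text \<open>
  Were \<open>D P N\<close> infinite, the signed energy of \<open>P - N\<close> would be defined and equal to \<open>-\<infinity>\<close>.
\<close>

lemma signed_radon_energy:
  assumes PN: "(P, N) \<in> signed_radon" and fin: "D P P < \<infinity>" "D N N < \<infinity>"
  shows "D P N < \<infinity>" "2 * e P N \<le> e P P + e N N"
proof -
  have rad: "radon P" "radon N" using PN by (auto simp: signed_radon_def)
  have pd': "0 \<le> x" if "signed_energy \<kappa> (P, N) (P, N) = Some x" for x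
    using pd PN that by (auto simp: positive_definite_def)
  have en: "energy \<kappa> P P = Some (ereal (e P P))" "energy \<kappa> N N = Some (ereal (e N N))"
    using energy_finite rad fin by auto
  show D: "D P N < \<infinity>"
  proof (rule ccontr)
    assume "\<not> D P N < \<infinity>"
    then have "D P N = top" "D N P = top" using D_commute[OF rad] by (simp_all add: not_less top_unique)
    then have "energy \<kappa> P N = Some \<infinity>" "energy \<kappa> N P = Some \<infinity>"
      using energy_eq[OF rad] energy_eq[OF rad(2,1)] by auto
    then have "signed_energy \<kappa> (P, N) (P, N) = Some (- \<infinity>)"
      using en by (simp add: signed_energy_def pdiff_def padd_def)
    then show False using pd' by fastforce
  qed
  then have "energy \<kappa> P N = Some (ereal (e P N))" "energy \<kappa> N P = Some (ereal (e P N))"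
    using energy_finite rad D_commute[OF rad] e_commute[OF rad] by auto
  then have "signed_energy \<kappa> (P, N) (P, N) = Some (ereal (e P P + e N N - 2 * e P N))"
    using en by (simp add: signed_energy_def pdiff_def padd_def)
  from pd'[OF this] show "2 * e P N \<le> e P P + e N N" by simp
qed

text \<open>
  Write the restrictions as \<open>P' + M\<close> and \<open>N' + M\<close> with \<open>P'\<close>, \<open>N'\<close> mutually singular. All
  mutual energies of \<open>P'\<close>, \<open>N'\<close>, \<open>M\<close> are finite, and \<open>M\<close> drops out of the energy of the
  difference.
\<close>

lemma energy_restr:
  assumes P: "radon P" and N: "radon N" and K: "compact K"
    and fin: "D (restr K P) (restr K P) < \<infinity>" "D (restr K N) (restr K N) < \<infinity>"
  shows "D (restr K P) (restr K N) < \<infinity>"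
    "2 * e (restr K P) (restr K N) \<le> e (restr K P) (restr K P) + e (restr K N) (restr K N)"
proof -
  obtain P' N' M where M: "radon M" and s: "(P', N') \<in> signed_radon"
    and eP': "\<forall>B\<in>sets borel. emeasure (restr K P) B = emeasure P' B + emeasure M B"
    and eN': "\<forall>B\<in>sets borel. emeasure (restr K N) B = emeasure N' B + emeasure M B"
    using Jordan_on_compact[OF P N K] by metis
  note eP = bspec[OF eP'] and eN = bspec[OF eN']
  let ?P = "restr K P" and ?N = "restr K N"
  have r: "radon P'" "radon N'" using s by (auto simp: signed_radon_def)
  have sP: "sets ?P = sets borel" "sets ?N = sets borel" using radon_sets[OF P] radon_sets[OF N] by auto
  note DP = D_plus(1)[OF r(1) M _ sP(1) eP] and DN = D_plus(1)[OF r(2) M _ sP(2) eN]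
  note EP = D_plus(2)[OF r(1) M _ sP(1) eP] and EN = D_plus(2)[OF r(2) M _ sP(2) eN]
  have rP: "radon ?P" and rN: "radon ?N" using D_plus(3)[OF r(1) M M sP(1) eP] D_plus(3)[OF r(2) M M sP(2) eN] by auto
  have f1: "D P' P' < \<infinity>" "D P' M < \<infinity>" "D M P' < \<infinity>" "D M M < \<infinity>"
    using fin(1) DP[OF rP] DP[OF r(1)] DP[OF M] D_commute[OF r(1) rP] D_commute[OF M rP] D_commute[OF M r(1)] by auto
  have f2: "D N' N' < \<infinity>" "D N' M < \<infinity>" "D M N' < \<infinity>"
    using fin(2) DN[OF rN] DN[OF r(2)] DN[OF M] D_commute[OF r(2) rN] D_commute[OF M rN] D_commute[OF M r(2)] by auto
  note se = signed_radon_energy[OF s f1(1) f2(1)]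
  have f3: "D P' N' < \<infinity>" "D N' P' < \<infinity>" using se D_commute[OF r] by auto
  show "D ?P ?N < \<infinity>"
    using DP[OF rN] D_commute[OF r(1) rN] D_commute[OF M rN] DN[OF r(1)] DN[OF M] f1 f2 f3 D_commute[OF r] by auto
  have g: "D M ?P < \<infinity>" "D P' ?P < \<infinity>" "D M ?N < \<infinity>" "D N' ?N < \<infinity>" "D P' ?N < \<infinity>"
    using DP[OF r(1)] DP[OF M] DN[OF M] DN[OF r(2)] DN[OF r(1)] f1 f2 f3
      D_commute[OF r(1) rP] D_commute[OF M rP] D_commute[OF M rN] D_commute[OF r(2) rN] D_commute[OF r(1) rN] by auto
  have "e ?P ?P = e P' P' + 2 * e P' M + e M M"
    using EP[OF rP] EP[OF r(1)] EP[OF M] f1 g e_commute[OF r(1) rP] e_commute[OF M rP] e_commute[OF M r(1)] by simp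
  moreover have "e ?N ?N = e N' N' + 2 * e N' M + e M M"
    using EN[OF rN] EN[OF r(2)] EN[OF M] f1 f2 g e_commute[OF r(2) rN] e_commute[OF M rN] e_commute[OF M r(2)] by simp
  moreover have "e ?P ?N = e P' N' + e P' M + e N' M + e M M"
    using EP[OF rN] EN[OF r(1)] EN[OF M] f1 f2 f3 g e_commute[OF r(1) rN] e_commute[OF M rN] e_commute[OF r] e_commute[OF M r(1)] by simp
  ultimately show "2 * e ?P ?N \<le> e ?P ?P + e ?N ?N" using se(2) by simp
qed

lemma nn_integral_restr:
  "K \<in> sets \<mu> \<Longrightarrow> h \<in> borel_measurable \<mu> \<Longrightarrow> (\<integral>\<^sup>+x. h x \<partial>restr K \<mu>) = (\<integral>\<^sup>+x. indicator K x * h x \<partial>\<mu>)"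
  unfolding restr_def by (rule nn_integral_density) auto

lemma D_restr:
  assumes P: "radon P" and N: "radon N" and K: "compact K"
  shows "D (restr K P) (restr K N) = (\<integral>\<^sup>+x. indicator K x * (\<integral>\<^sup>+y. indicator K y * k (x, y) \<partial>N) \<partial>P)"
proof -
  have *: "(\<integral>\<^sup>+y. k (x, y) \<partial>restr K N) = (\<integral>\<^sup>+y. indicator K y * k (x, y) \<partial>N)" for x
    using borel_compact[OF K] radon_sets[OF N] by (intro nn_integral_restr k_section_measurable) auto
  have "radon (restr K N)" using radon_restr[OF N K borel_compact[OF K]] by simp
  then have "(\<lambda>x. \<integral>\<^sup>+y. indicator K y * k (x, y) \<partial>N) \<in> borel_measurable P"
    using potential_measurable[of "restr K N"] radon_sets[OF P] measurable_cong_sets unfolding * by blast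
  then show ?thesis
    unfolding D_def * using borel_compact[OF K] radon_sets[OF P] by (intro nn_integral_restr) auto
qed

lemma D_restr_le:
  assumes P: "radon P" and N: "radon N" and K: "compact K"
  shows "D (restr K P) (restr K N) \<le> D P N"
  unfolding D_restr[OF assms] unfolding D_def
proof (rule nn_integral_mono)
  fix x
  have "(\<integral>\<^sup>+y. indicator K y * k (x, y) \<partial>N) \<le> (\<integral>\<^sup>+y. k (x, y) \<partial>N)"
    by (intro nn_integral_mono) (simp add: indicator_def)
  then show "indicator K x * (\<integral>\<^sup>+y. indicator K y * k (x, y) \<partial>N) \<le> (\<integral>\<^sup>+y. k (x, y) \<partial>N)"
    by (cases "x \<in> K") auto
qed

text \<open>
  The kernels \<open>k \<cdot> 1\<^sub>Q\<close> with \<open>Q\<close> relatively compact are directed with supremum \<open>k\<close>, and the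
  projections of \<open>closure Q\<close> are compact.
\<close>

lemma D_less_restr:
  assumes P: "radon P" and N: "radon N" and t: "t < D P N"
  obtains K where "compact K" "t < D (restr K P) (restr K N)"
proof -
  note rad = radon_radon_prod[OF lc lc P N]
  define \<Q> where "\<Q> = {Q :: ('a \<times> 'a) set. open Q \<and> compact (closure Q)}"
  define H where "H = (\<lambda>Q z. k z * indicator Q z) ` \<Q>"
  have "k z \<le> (SUP h\<in>H. h z)" for z
  proof -
    obtain Q where "open Q" "z \<in> Q" "compact (closure Q)"
      using locally_compact_nbhd_point[OF locally_compact_Times[OF lc lc] open_UNIV UNIV_I, of z] by metis
    then show ?thesis
      by (intro SUP_upper2[of "\<lambda>z. k z * indicator Q z"]) (auto simp: H_def \<Q>_def)
  qed
  then have "(\<integral>\<^sup>+z. k z \<partial>radon_prod P N) \<le> (\<integral>\<^sup>+z. (SUP h\<in>H. h z) \<partial>radon_prod P N)"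
    by (rule nn_integral_mono)
  then have t': "t < (\<integral>\<^sup>+z. (SUP h\<in>H. h z) \<partial>radon_prod P N)"
    using t unfolding D_def nn_integral_radon_prod[OF lc lc P N lsc_k, symmetric]
    by (rule less_le_trans[rotated])
  have "\<exists>h\<in>H. t < (\<integral>\<^sup>+z. h z \<partial>radon_prod P N)"
  proof (rule radon_directed_SUP[OF rad _ _ t'])
    fix h assume "h \<in> H"
    then obtain Q where "open Q" "h = (\<lambda>z. k z * indicator Q z)" unfolding H_def \<Q>_def by blast
    then show "lsc_nn h" using lsc_nn_indicator_mult[OF lsc_k] by simp
  next
    fix g h assume "g \<in> H" "h \<in> H"
    then obtain A B where AB: "A \<in> \<Q>" "B \<in> \<Q>" "g = (\<lambda>z. k z * indicator A z)" "h = (\<lambda>z. k z * indicator B z)"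
      unfolding H_def by blast
    have "A \<union> B \<in> \<Q>" using AB by (auto simp: \<Q>_def)
    then show "\<exists>f\<in>H. g \<le> f \<and> h \<le> f"
      unfolding AB H_def by (intro bexI[OF _ imageI[of "A \<union> B"]]) (auto simp: le_fun_def indicator_def)
  qed
  then obtain Q where Q: "open Q" "compact (closure Q)" "t < (\<integral>\<^sup>+z. k z * indicator Q z \<partial>radon_prod P N)"
    unfolding H_def \<Q>_def by blast
  define K where "K = fst ` closure Q \<union> snd ` closure Q"
  have K: "compact K" unfolding K_def using Q by (intro compact_Un compact_continuous_image continuous_intros)
  have QK: "x \<in> K \<and> y \<in> K" if "(x, y) \<in> Q" for x y
  proof -
    have "(x, y) \<in> closure Q" using that closure_subset by blast
    then have "x \<in> fst ` closure Q" "y \<in> snd ` closure Q" by (auto intro: rev_image_eqI)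
    then show ?thesis by (simp add: K_def)
  qed
  have le: "k (x, y) * indicator Q (x, y) \<le> indicator K x * (indicator K y * k (x, y))" for x y
    using QK[of x y] by (auto simp: indicator_def)
  have "(\<integral>\<^sup>+z. k z * indicator Q z \<partial>radon_prod P N) = (\<integral>\<^sup>+x. \<integral>\<^sup>+y. k (x, y) * indicator Q (x, y) \<partial>N \<partial>P)"
    by (rule nn_integral_radon_prod[OF lc lc P N lsc_nn_indicator_mult[OF lsc_k Q(1)]])
  also have "\<dots> \<le> (\<integral>\<^sup>+x. indicator K x * (\<integral>\<^sup>+y. indicator K y * k (x, y) \<partial>N) \<partial>P)"
  proof (rule nn_integral_mono)
    fix x
    show "(\<integral>\<^sup>+y. k (x, y) * indicator Q (x, y) \<partial>N) \<le> indicator K x * (\<integral>\<^sup>+y. indicator K y * k (x, y) \<partial>N)"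
    proof (cases "x \<in> K")
      case True
      then have "k (x, y) * indicator Q (x, y) \<le> indicator K y * k (x, y)" for y using le[of x y] by simp
      then show ?thesis using True by (simp add: nn_integral_mono)
    next
      case False
      then have "(\<lambda>y. k (x, y) * indicator Q (x, y)) = (\<lambda>_. 0)"
        using QK[of x] by (auto simp: indicator_def fun_eq_iff)
      then show ?thesis by simp
    qed
  qed
  also have "\<dots> = D (restr K P) (restr K N)" by (rule D_restr[OF P N K, symmetric])
  finally show thesis using K Q(3) by (intro that[of K]) auto
qed

text \<open>
  Positive definiteness for an arbitrary pair of finite energy. If \<open>c \<noteq> 0\<close>,
  the space is compact and can be taken for \<open>K\<close> in \<open>energy_restr\<close>. If \<open>c = 0\<close>, the kernel is
  nonnegative, restriction does not increase the energies of \<open>P\<close> and \<open>N\<close>, and \<open>D P N\<close> is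
  approximated by restrictions.
\<close>

proposition energy_cross:
  assumes P: "radon P" and N: "radon N" and fin: "D P P < \<infinity>" "D N N < \<infinity>"
  shows "D P N < \<infinity>" "2 * e P N \<le> e P P + e N N"
proof -
  have "D P N < \<infinity> \<and> 2 * e P N \<le> e P P + e N N"
  proof (cases "c = 0")
    case False
    have "restr UNIV Q = Q" if "radon Q" for Q :: "'a measure"
      using radon_sets[OF that] by (intro measure_eqI) (auto simp: emeasure_restr)
    then show ?thesis using energy_restr[OF P N c_compact[OF False]] fin P N by simp
  next
    case True
    have "c * p * q = 0" for p q using True by simp
    then have e0: "e \<mu> \<nu> = enn2real (D \<mu> \<nu>)" for \<mu> \<nu> by (simp add: e_def)
    let ?s = "(enn2real (D P P) + enn2real (D N N)) / 2"
    have "D P N \<le> ennreal ?s"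
    proof (rule dense_le)
      fix t assume "t < D P N"
      then obtain K where K: "compact K" "t < D (restr K P) (restr K N)" using D_less_restr[OF P N] by blast
      note le = D_restr_le[OF P P K(1)] D_restr_le[OF N N K(1)]
      note er = energy_restr[OF P N K(1) le_less_trans[OF le(1) fin(1)] le_less_trans[OF le(2) fin(2)]]
      have "enn2real (D (restr K P) (restr K P)) \<le> enn2real (D P P)" "enn2real (D (restr K N) (restr K N)) \<le> enn2real (D N N)"
        using le fin by (auto intro!: enn2real_mono)
      then have "enn2real (D (restr K P) (restr K N)) \<le> ?s" using er(2) by (simp add: e0)
      then have "D (restr K P) (restr K N) \<le> ennreal ?s"
        using er(1) by (metis ennreal_enn2real ennreal_leI infinity_ennreal_def)
      then show "t \<le> ennreal ?s" using K(2) by simp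
    qed
    then have "D P N < \<infinity>" and "enn2real (D P N) \<le> ?s"
    proof -
      assume le: "D P N \<le> ennreal ?s"
      show "D P N < \<infinity>" using le by (rule le_less_trans) simp
      show "enn2real (D P N) \<le> ?s" using le by (rule enn2real_leI[rotated]) simp
    qed
    then show ?thesis by (simp add: e0)
  qed
  then show "D P N < \<infinity>" "2 * e P N \<le> e P P + e N N" by auto
qed

lemma e_comb_comb:
  assumes F: "finite F" and G: "finite G" and rad: "\<And>i. i \<in> F \<Longrightarrow> radon (\<mu> i)" "\<And>j. j \<in> G \<Longrightarrow> radon (\<nu> j)"
    and wv: "\<And>i. i \<in> F \<Longrightarrow> 0 \<le> w i" "\<And>j. j \<in> G \<Longrightarrow> 0 \<le> v j"
    and fin: "\<And>i j. i \<in> F \<Longrightarrow> j \<in> G \<Longrightarrow> D (\<mu> i) (\<nu> j) < \<infinity>"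
  shows "D (comb F w \<mu>) (comb G v \<nu>) < \<infinity>"
    "e (comb F w \<mu>) (comb G v \<nu>) = (\<Sum>i\<in>F. \<Sum>j\<in>G. w i * v j * e (\<mu> i) (\<nu> j))"
proof -
  have radC: "radon (comb G v \<nu>)" by (rule radon_comb[OF G rad(2)])
  have 1: "D (\<mu> i) (comb G v \<nu>) < \<infinity>" "e (\<mu> i) (comb G v \<nu>) = (\<Sum>j\<in>G. v j * e (\<mu> i) (\<nu> j))" if i: "i \<in> F" for i
  proof -
    have "D (\<nu> j) (\<mu> i) < \<infinity>" if "j \<in> G" for j
      using fin[OF i that] D_commute[OF rad(1)[OF i] rad(2)[OF that]] by simp
    note c = e_comb[where w = v, OF G rad(2) wv(2) rad(1)[OF i] this]
    show "D (\<mu> i) (comb G v \<nu>) < \<infinity>" using c(1) D_commute[OF rad(1)[OF i] radC] by simp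
    have "e (\<mu> i) (comb G v \<nu>) = (\<Sum>j\<in>G. v j * e (\<nu> j) (\<mu> i))"
      using c(2) e_commute[OF rad(1)[OF i] radC] by simp
    also have "\<dots> = (\<Sum>j\<in>G. v j * e (\<mu> i) (\<nu> j))"
      using e_commute[OF rad(1)[OF i] rad(2)] by (intro sum.cong) auto
    finally show "e (\<mu> i) (comb G v \<nu>) = (\<Sum>j\<in>G. v j * e (\<mu> i) (\<nu> j))" .
  qed
  note c = e_comb[where w = w, OF F rad(1) wv(1) radC 1(1)]
  show "D (comb F w \<mu>) (comb G v \<nu>) < \<infinity>" by (rule c(1))
  show "e (comb F w \<mu>) (comb G v \<nu>) = (\<Sum>i\<in>F. \<Sum>j\<in>G. w i * v j * e (\<mu> i) (\<nu> j))"
    using c(2) 1(2) by (simp add: sum_distrib_left mult.assoc cong: sum.cong)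
qed

text \<open>
  Collecting the positive and the negative coefficients gives two nonnegative measures, to which
  \<open>energy_cross\<close> applies.
\<close>

proposition energy_form_nonneg:
  fixes \<nu> :: "'i \<Rightarrow> 'a measure" and x :: "'i \<Rightarrow> real"
  assumes F: "finite F" and rad: "\<And>i. i \<in> F \<Longrightarrow> radon (\<nu> i)" and fin: "\<And>i. i \<in> F \<Longrightarrow> D (\<nu> i) (\<nu> i) < \<infinity>"
  shows "0 \<le> (\<Sum>i\<in>F. \<Sum>j\<in>F. x i * x j * e (\<nu> i) (\<nu> j))"
proof -
  have cross: "D (\<nu> i) (\<nu> j) < \<infinity>" if "i \<in> F" "j \<in> F" for i j
    using energy_cross(1)[OF rad rad fin fin] that by auto
  define C where "C w = comb F w \<nu>" for w
  have radC: "radon (C w)" for w unfolding C_def by (rule radon_comb[OF F rad])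
  have 2: "D (C w) (C v) < \<infinity>" "e (C w) (C v) = (\<Sum>i\<in>F. \<Sum>j\<in>F. w i * v j * e (\<nu> i) (\<nu> j))"
    if wv: "\<And>i. 0 \<le> w i" "\<And>i. 0 \<le> v i" for w v
    unfolding C_def using e_comb_comb[OF F F rad rad wv cross] by auto
  define p where "p i = max (x i) 0" for i
  define n where "n i = max (- x i) 0" for i
  have pn: "0 \<le> p i" "0 \<le> n i" "x i = p i - n i" for i by (auto simp: p_def n_def)
  have "2 * e (C p) (C n) \<le> e (C p) (C p) + e (C n) (C n)"
    by (rule energy_cross(2)[OF radC radC 2(1)[OF pn(1,1)] 2(1)[OF pn(2,2)]])
  then have "0 \<le> e (C p) (C p) + e (C n) (C n) - e (C p) (C n) - e (C n) (C p)"
    using e_commute[OF radC radC, of p n] by simp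
  also have "\<dots> = (\<Sum>i\<in>F. \<Sum>j\<in>F. x i * x j * e (\<nu> i) (\<nu> j))"
    by (simp add: 2 pn sum.distrib[symmetric] sum_subtractf[symmetric]) (simp add: algebra_simps)
  finally show ?thesis .
qed

end

section \<open>Finite pairings and absolutely convergent series\<close>

lemma pairing_cong_AE:
  assumes v: "v \<in> borel_measurable \<nu>" and AE: "AE x in \<nu>. u x = Some (v x)"
  shows "pairing u \<nu> = pdiff (Some (enn2ereal (\<integral>\<^sup>+x. e2ennreal (v x) \<partial>\<nu>))) (Some (enn2ereal (\<integral>\<^sup>+x. e2ennreal (- v x) \<partial>\<nu>)))"
proof -
  have "(\<integral>\<^sup>+x. e2ennreal (the (u x)) \<partial>\<nu>) = (\<integral>\<^sup>+x. e2ennreal (v x) \<partial>\<nu>)"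
    "(\<integral>\<^sup>+x. e2ennreal (- the (u x)) \<partial>\<nu>) = (\<integral>\<^sup>+x. e2ennreal (- v x) \<partial>\<nu>)"
    using AE by (auto intro!: nn_integral_cong_AE)
  then show ?thesis unfolding pairing_def using assms by auto
qed

lemma pdiff_enn_real_iff:
  "pdiff (Some (enn2ereal a)) (Some (enn2ereal b)) = Some (ereal r) \<longleftrightarrow>
    a < \<infinity> \<and> b < \<infinity> \<and> enn2real a - enn2real b = r"
  by (cases a; cases b) (auto simp: pdiff_def padd_def)

lemma pairing_SomeD: "pairing u \<nu> = Some y \<Longrightarrow> \<exists>v\<in>borel_measurable \<nu>. AE x in \<nu>. u x = Some (v x)"
  unfolding pairing_def by (metis option.distinct(1))

text \<open>
  A finite pairing is an ordinary integral of a real function. With the counting measure this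
  turns a finite series into an absolutely convergent sum.
\<close>

lemma pairing_real_iff:
  "pairing u \<nu> = Some (ereal r) \<longleftrightarrow>
    (\<exists>w. (AE x in \<nu>. u x = Some (ereal (w x))) \<and> integrable \<nu> w \<and> integral\<^sup>L \<nu> w = r)"
proof
  assume *: "pairing u \<nu> = Some (ereal r)"
  then obtain v where v[measurable]: "v \<in> borel_measurable \<nu>" and AE: "AE x in \<nu>. u x = Some (v x)"
    using pairing_SomeD by blast
  let ?a = "\<integral>\<^sup>+x. e2ennreal (v x) \<partial>\<nu>" and ?b = "\<integral>\<^sup>+x. e2ennreal (- v x) \<partial>\<nu>"
  have ab: "?a < \<infinity>" "?b < \<infinity>" "enn2real ?a - enn2real ?b = r"
    using * unfolding pairing_cong_AE[OF v AE] pdiff_enn_real_iff by auto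
  (* real_of_ereal alters v only where it is infinite, which is a null set. *)
  define w where "w x = real_of_ereal (v x)" for x
  have "AE x in \<nu>. e2ennreal (v x) \<noteq> \<infinity>" "AE x in \<nu>. e2ennreal (- v x) \<noteq> \<infinity>"
    using ab by (intro nn_integral_PInf_AE; simp)+
  then have vw: "AE x in \<nu>. v x = ereal (w x)"
  proof eventually_elim
    case (elim x)
    then show ?case by (cases "v x") (auto simp: w_def e2ennreal_infty)
  qed
  have w[measurable]: "w \<in> borel_measurable \<nu>" unfolding w_def by measurable
  have 1: "?a = (\<integral>\<^sup>+x. ennreal (w x) \<partial>\<nu>)" "?b = (\<integral>\<^sup>+x. ennreal (- w x) \<partial>\<nu>)"
    using vw by (auto intro!: nn_integral_cong_AE elim!: eventually_mono)
  then have "integrable \<nu> w" using ab by (auto simp: real_integrable_def)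
  moreover from this have "integral\<^sup>L \<nu> w = r" using ab by (simp add: real_lebesgue_integral_def 1)
  moreover have "AE x in \<nu>. u x = Some (ereal (w x))" using AE vw by eventually_elim simp
  ultimately show "\<exists>w. (AE x in \<nu>. u x = Some (ereal (w x))) \<and> integrable \<nu> w \<and> integral\<^sup>L \<nu> w = r" by blast
next
  assume "\<exists>w. (AE x in \<nu>. u x = Some (ereal (w x))) \<and> integrable \<nu> w \<and> integral\<^sup>L \<nu> w = r"
  then obtain w where w: "AE x in \<nu>. u x = Some (ereal (w x))" "integrable \<nu> w" "integral\<^sup>L \<nu> w = r" by blast
  have [measurable]: "w \<in> borel_measurable \<nu>" using w by simp
  have m: "(\<lambda>x. ereal (w x)) \<in> borel_measurable \<nu>" by measurable
  show "pairing u \<nu> = Some (ereal r)"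
    unfolding pairing_cong_AE[OF m w(1)] pdiff_enn_real_iff
    using w by (auto simp: real_integrable_def real_lebesgue_integral_def less_top)
qed

lemma integral_count_space_infsum:
  fixes w :: "'i \<Rightarrow> real"
  shows "integrable (count_space J) w \<longleftrightarrow> w summable_on J"
    "integrable (count_space J) w \<Longrightarrow> integral\<^sup>L (count_space J) w = infsum w J"
proof -
  show "integrable (count_space J) w \<longleftrightarrow> w summable_on J"
    using abs_summable_equivalent[of w J] summable_on_iff_abs_summable_on_real[of w J]
    by (simp add: Infinite_Set_Sum.abs_summable_on_def)
  show "integral\<^sup>L (count_space J) w = infsum w J" if "integrable (count_space J) w"
    using infsetsum_infsum[of w J] that by (simp add: Infinite_Set_Sum.abs_summable_on_def infsetsum_def)
qed

lemma series_real_iff: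
  "series u J = Some (ereal r) \<longleftrightarrow> (\<exists>w. (\<forall>j\<in>J. u j = Some (ereal (w j))) \<and> (w has_sum r) J)"
  unfolding series_def pairing_real_iff has_sum_iff AE_count_space
  using integral_count_space_infsum by metis

lemma AE_comb:
  assumes F: "finite F" and sets: "\<And>i. i \<in> F \<Longrightarrow> sets (\<nu> i) = sets borel" and AE: "\<And>i. i \<in> F \<Longrightarrow> AE x in \<nu> i. Q x"
  shows "AE x in comb F w \<nu>. Q x"
proof -
  have "\<exists>N\<in>sets borel. emeasure (\<nu> i) N = 0 \<and> {x. \<not> Q x} \<subseteq> N" if "i \<in> F" for i
    using AE[OF that] sets[OF that] sets_eq_imp_space_eq[OF sets[OF that]]
    by (auto simp: eventually_ae_filter null_sets_def)
  then obtain N where N: "\<And>i. i \<in> F \<Longrightarrow> N i \<in> sets borel \<and> emeasure (\<nu> i) (N i) = 0 \<and> {x. \<not> Q x} \<subseteq> N i" by metis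
  have B: "(\<Inter>i\<in>F. N i) \<in> sets borel"
    using F N by (cases "F = {}") (auto intro: sets.finite_INT)
  have "emeasure (\<nu> i) (\<Inter>i\<in>F. N i) = 0" if "i \<in> F" for i
    using emeasure_mono[of "\<Inter>i\<in>F. N i" "N i" "\<nu> i"] N[OF that] that sets[OF that] by auto
  then have "(\<Inter>i\<in>F. N i) \<in> null_sets (comb F w \<nu>)"
    using B sets by (simp add: null_sets_def emeasure_comb)
  then show ?thesis using N by (intro AE_I'[of "\<Inter>i\<in>F. N i"]) auto
qed

text \<open>
  A function that is only partially defined may have different measurable versions for different
  measures. The single Borel function \<open>v\<close>, with which \<open>u\<close> agrees wherever it is defined, serves
  all of them.
\<close>

lemma pairing_comb:
  assumes F: "finite F" and sets: "\<And>i. i \<in> F \<Longrightarrow> sets (\<nu> i) = sets borel" and w: "\<And>i. i \<in> F \<Longrightarrow> 0 \<le> w i"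
    and v: "v \<in> borel_measurable borel" and uv: "\<And>x y. u x = Some y \<Longrightarrow> y = v x"
    and r: "\<And>i. i \<in> F \<Longrightarrow> pairing u (\<nu> i) = Some (ereal (r i))"
  shows "pairing u (comb F w \<nu>) = Some (ereal (\<Sum>i\<in>F. w i * r i))"
proof -
  have AE: "AE x in \<nu> i. u x = Some (v x)" if "i \<in> F" for i
    using pairing_SomeD[OF r[OF that]] uv by (auto elim!: eventually_mono)
  have vi: "v \<in> borel_measurable (\<nu> i)" if "i \<in> F" for i
    using v measurable_cong_sets[OF sets[OF that] refl] by blast
  have vc: "v \<in> borel_measurable (comb F w \<nu>)" using v measurable_cong_sets[OF sets_comb refl] by blast
  define a where "a i = (\<integral>\<^sup>+x. e2ennreal (v x) \<partial>\<nu> i)" for i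
  define b where "b i = (\<integral>\<^sup>+x. e2ennreal (- v x) \<partial>\<nu> i)" for i
  have ab: "a i < \<infinity>" "b i < \<infinity>" "enn2real (a i) - enn2real (b i) = r i" if "i \<in> F" for i
    using r[OF that] unfolding pairing_cong_AE[OF vi[OF that] AE[OF that]] pdiff_enn_real_iff a_def b_def by auto
  have real_sum: "(\<Sum>i\<in>F. ennreal (w i) * q i) = ennreal (\<Sum>i\<in>F. w i * enn2real (q i))" if "\<And>i. i \<in> F \<Longrightarrow> q i < \<infinity>" for q
  proof -
    have "(\<Sum>i\<in>F. ennreal (w i) * q i) = (\<Sum>i\<in>F. ennreal (w i * enn2real (q i)))"
      using w that by (intro sum.cong refl) (simp add: ennreal_mult less_top)
    then show ?thesis using w by (simp add: sum_ennreal)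
  qed
  have "(\<integral>\<^sup>+x. e2ennreal (v x) \<partial>comb F w \<nu>) = (\<Sum>i\<in>F. ennreal (w i) * a i)"
    unfolding a_def by (rule nn_integral_comb[OF F sets]) (use v in auto)
  also have "\<dots> = ennreal (\<Sum>i\<in>F. w i * enn2real (a i))" by (rule real_sum[OF ab(1)])
  finally have pos: "(\<integral>\<^sup>+x. e2ennreal (v x) \<partial>comb F w \<nu>) = ennreal (\<Sum>i\<in>F. w i * enn2real (a i))" .
  have "(\<integral>\<^sup>+x. e2ennreal (- v x) \<partial>comb F w \<nu>) = (\<Sum>i\<in>F. ennreal (w i) * b i)"
    unfolding b_def by (rule nn_integral_comb[OF F sets]) (use v in auto)
  moreover have "\<dots> = ennreal (\<Sum>i\<in>F. w i * enn2real (b i))" by (rule real_sum[OF ab(2)])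
  ultimately have eq: "(\<integral>\<^sup>+x. e2ennreal (- v x) \<partial>comb F w \<nu>) = ennreal (\<Sum>i\<in>F. w i * enn2real (b i))" by simp
  have AEc: "AE x in comb F w \<nu>. u x = Some (v x)" by (rule AE_comb[OF F sets AE])
  show ?thesis
    unfolding pairing_cong_AE[OF vc AEc] pos eq pdiff_enn_real_iff
    using w ab(3) by (auto simp: sum_nonneg sum_subtractf[symmetric] right_diff_distrib[symmetric])
qed

section \<open>Positive semidefinite forms on bounded families\<close>

definition bounded_family :: "('i \<Rightarrow> real) \<Rightarrow> bool" where
  "bounded_family x \<longleftrightarrow> (\<exists>C. \<forall>p. \<bar>x p\<bar> \<le> C)"

lemma bounded_family_lincomb:
  assumes "bounded_family x" "bounded_family y"
  shows "bounded_family (\<lambda>p. x p + t * y p)"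
proof -
  obtain C D where "\<And>p. \<bar>x p\<bar> \<le> C" "\<And>p. \<bar>y p\<bar> \<le> D" using assms by (auto simp: bounded_family_def)
  then have "\<bar>x p + t * y p\<bar> \<le> C + \<bar>t\<bar> * D" for p
    by (intro order_trans[OF abs_triangle_ineq] add_mono) (auto simp: abs_mult intro!: mult_left_mono)
  then show ?thesis unfolding bounded_family_def by blast
qed

text \<open>
  The first order condition at the left end point for \<open>t \<mapsto> 2 t b + t\<^sup>2 q\<close>.
\<close>

lemma first_order_nonneg:
  fixes b q :: real
  assumes "\<And>t. 0 < t \<Longrightarrow> t \<le> 1 \<Longrightarrow> 0 \<le> 2 * t * b + t * t * q"
  shows "0 \<le> b"
proof (rule ccontr)
  assume b: "\<not> 0 \<le> b"
  define t where "t = min 1 (- b / (\<bar>q\<bar> + 1))"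
  have "0 < - b / (\<bar>q\<bar> + 1)" using b by (intro divide_pos_pos) auto
  then have t: "0 < t" "t \<le> 1" by (auto simp: t_def)
  have "t \<le> - b / (\<bar>q\<bar> + 1)" by (simp add: t_def)
  then have "t * (\<bar>q\<bar> + 1) \<le> - b" by (subst (asm) pos_le_divide_eq) auto
  moreover have "t * q \<le> t * (\<bar>q\<bar> + 1)" using t by (intro mult_left_mono) auto
  ultimately have "2 * b + t * q < 0" using b by linarith
  then have "t * (2 * b + t * q) < 0" using t by (simp add: mult_pos_neg)
  then show False using assms[OF t] by (simp add: algebra_simps)
qed

text \<open>
  An absolutely summable matrix defines a bilinear form on bounded families; it is semidefinite
  as soon as its finite sections are.
\<close>

locale psd_form =
  fixes J :: "'i set" and M :: "'i \<Rightarrow> 'i \<Rightarrow> real"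
  assumes sym: "p \<in> J \<Longrightarrow> q \<in> J \<Longrightarrow> M p q = M q p"
    and summ: "(\<lambda>(p, q). M p q) summable_on J \<times> J"
    and psd: "finite F \<Longrightarrow> F \<subseteq> J \<Longrightarrow> 0 \<le> (\<Sum>p\<in>F. \<Sum>q\<in>F. x p * x q * M p q)"
begin

definition B :: "('i \<Rightarrow> real) \<Rightarrow> ('i \<Rightarrow> real) \<Rightarrow> real" where
  "B x y = (\<Sum>\<^sub>\<infinity>(p, q)\<in>J \<times> J. x p * y q * M p q)"

lemma summable_B:
  assumes "bounded_family x" "bounded_family y"
  shows "(\<lambda>(p, q). x p * y q * M p q) summable_on J \<times> J"
proof -
  obtain C D where CD: "\<And>p. \<bar>x p\<bar> \<le> C" "\<And>p. \<bar>y p\<bar> \<le> D" using assms by (auto simp: bounded_family_def)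
  have "0 \<le> C" "0 \<le> D" using CD[of undefined] by linarith+
  have "(\<lambda>z. norm (case z of (p, q) \<Rightarrow> x p * y q * M p q)) summable_on J \<times> J"
  proof (rule Infinite_Sum.abs_summable_on_comparison_test)
    show "(\<lambda>z. norm (C * D * (case z of (p, q) \<Rightarrow> M p q))) summable_on J \<times> J"
      using summ by (intro summable_on_iff_abs_summable_on_real[THEN iffD1] summable_on_cmult_right)
    fix z
    show "norm (case z of (p, q) \<Rightarrow> x p * y q * M p q) \<le> norm (C * D * (case z of (p, q) \<Rightarrow> M p q))"
      using CD \<open>0 \<le> C\<close> \<open>0 \<le> D\<close> by (cases z) (auto simp: abs_mult intro!: mult_mono)
  qed
  then show ?thesis by (rule abs_summable_summable)
qed

lemma B_lincomb_left:
  assumes "bounded_family x" "bounded_family y" "bounded_family z"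
  shows "B (\<lambda>p. x p + t * y p) z = B x z + t * B y z"
proof -
  have "B (\<lambda>p. x p + t * y p) z = (\<Sum>\<^sub>\<infinity>w\<in>J \<times> J. (case w of (p, q) \<Rightarrow> x p * z q * M p q) + t * (case w of (p, q) \<Rightarrow> y p * z q * M p q))"
    unfolding B_def by (intro infsum_cong) (auto simp: algebra_simps)
  also have "\<dots> = B x z + t * B y z"
    unfolding B_def using assms
    by (subst infsum_add) (auto simp: infsum_cmult_right' intro!: summable_B summable_on_cmult_right)
  finally show ?thesis .
qed

lemma B_commute: "B x y = B y x"
proof -
  have "B y x = (\<Sum>\<^sub>\<infinity>z\<in>J \<times> J. (case prod.swap z of (p, q) \<Rightarrow> y p * x q * M p q))"
    unfolding B_def
    by (rule infsum_reindex_bij_betw[symmetric], rule bij_betwI[where g = prod.swap]) auto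
  also have "\<dots> = B x y" unfolding B_def using sym by (intro infsum_cong) auto
  finally show ?thesis by simp
qed

lemma B_quadratic:
  assumes "bounded_family x" "bounded_family y"
  shows "B (\<lambda>p. x p + t * y p) (\<lambda>p. x p + t * y p) = B x x + 2 * t * B y x + t * t * B y y"
proof -
  have *: "B z (\<lambda>p. x p + t * y p) = B x z + t * B y z" if "bounded_family z" for z
    using B_lincomb_left[OF assms that] B_commute by metis
  show ?thesis
    using B_lincomb_left[OF assms bounded_family_lincomb[OF assms]] *[OF assms(1)] *[OF assms(2)] B_commute[of x y]
    by (simp add: algebra_simps)
qed

text \<open>
  A negative value would be seen on all large finite sets of pairs, and among these are the
  squares \<open>F \<times> F\<close>.
\<close>

lemma B_nonneg:
  assumes "bounded_family x"
  shows "0 \<le> B x x"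
proof (rule ccontr)
  assume neg: "\<not> 0 \<le> B x x"
  define h where "h = (\<lambda>(p, q). x p * x q * M p q)"
  have "(h has_sum B x x) (J \<times> J)"
    unfolding h_def B_def by (rule has_sum_infsum) (rule summable_B[OF assms assms])
  then have "\<forall>\<^sub>F T in finite_subsets_at_top (J \<times> J). sum h T < 0"
    unfolding has_sum_def using neg by (intro order_tendstoD) auto
  then obtain T where T: "finite T" "T \<subseteq> J \<times> J"
      "\<And>T'. finite T' \<Longrightarrow> T \<subseteq> T' \<Longrightarrow> T' \<subseteq> J \<times> J \<Longrightarrow> sum h T' < 0"
    unfolding eventually_finite_subsets_at_top by meson
  define F where "F = fst ` T \<union> snd ` T"
  have F: "finite F" "F \<subseteq> J" using T by (auto simp: F_def)
  have "T \<subseteq> F \<times> F" unfolding F_def by force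
  then have "sum h (F \<times> F) < 0" using F by (intro T(3)) auto
  moreover have "sum h (F \<times> F) = (\<Sum>p\<in>F. \<Sum>q\<in>F. x p * x q * M p q)"
    unfolding h_def by (simp add: sum.cartesian_product)
  ultimately show False using psd[OF F, of x] by simp
qed

lemma B_null:
  assumes x: "bounded_family x" and y: "bounded_family y" and null: "B x x \<le> 0"
  shows "B x y = 0"
proof -
  have q: "0 \<le> B x x + 2 * t * B y x + t * t * B y y" for t
    using B_nonneg[OF bounded_family_lincomb[OF x y], of t] unfolding B_quadratic[OF x y] .
  have "0 \<le> 2 * t * B y x + t * t * B y y" for t using q[of t] null by simp
  then have "0 \<le> B y x" "0 \<le> - B y x"
    using first_order_nonneg[of "B y x" "B y y"] first_order_nonneg[of "- B y x" "B y y"]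
    by (metis, metis (no_types, opaque_lifting) minus_mult_commute minus_mult_minus mult_minus_left mult_minus_right)
  then show ?thesis using B_commute[of x y] by simp
qed

lemma B_delta:
  assumes a: "a \<in> J"
  shows "B (\<lambda>p. if p = a then s else 0) y = s * (\<Sum>\<^sub>\<infinity>q\<in>J. y q * M a q)"
proof -
  have "B (\<lambda>p. if p = a then s else 0) y = (\<Sum>\<^sub>\<infinity>z\<in>{a} \<times> J. (case z of (p, q) \<Rightarrow> s * (y q * M p q)))"
    unfolding B_def using a by (intro infsum_cong_neutral) (auto split: if_splits)
  also have "\<dots> = (\<Sum>\<^sub>\<infinity>q\<in>J. (case (a, q) of (p, q) \<Rightarrow> s * (y q * M p q)))"
    by (rule infsum_reindex_bij_betw[symmetric]) (auto simp: bij_betw_def inj_on_def)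
  finally show ?thesis by (simp add: infsum_cmult_right')
qed

text \<open>
  The convexity argument behind the theorem, with \<open>F\<close>, \<open>F'\<close> standing for the field terms of the
  two minimizers \<open>u\<close>, \<open>v\<close>, and \<open>ui\<close>, \<open>vi\<close>, \<open>fi\<close>, \<open>fi'\<close> for the contributions of component \<open>i\<close>.
  The midpoint shows that \<open>v - u\<close> is a null vector, hence orthogonal to everything. The one-sided
  derivatives along \<open>vi - ui\<close> at \<open>u\<close> and along \<open>ui - vi\<close> at \<open>v\<close> are nonnegative; since
  \<open>B u = B v\<close>, they are, up to a factor \<open>2\<close>, the difference \<open>B vi v + fi' - (B ui u + fi)\<close> and
  its negative.
\<close>

proposition variational_equality:
  assumes u: "bounded_family u" and v: "bounded_family v" and ui: "bounded_family ui" and vi: "bounded_family vi"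
    and G: "B u u + 2 * F = G" "B v v + 2 * F' = G"
    and mid: "G \<le> B (\<lambda>p. u p + 1/2 * (v p + (-1) * u p)) (\<lambda>p. u p + 1/2 * (v p + (-1) * u p)) + (F + F')"
    and var: "\<And>t. 0 < t \<Longrightarrow> t \<le> 1 \<Longrightarrow>
      G \<le> B (\<lambda>p. u p + t * (vi p + (-1) * ui p)) (\<lambda>p. u p + t * (vi p + (-1) * ui p)) + 2 * F + 2 * t * (fi' - fi)"
    and var': "\<And>t. 0 < t \<Longrightarrow> t \<le> 1 \<Longrightarrow>
      G \<le> B (\<lambda>p. v p + t * (ui p + (-1) * vi p)) (\<lambda>p. v p + t * (ui p + (-1) * vi p)) + 2 * F' + 2 * t * (fi - fi')"
  shows "B ui u + fi = B vi v + fi'"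
proof -
  let ?d = "\<lambda>p. v p + (-1) * u p" and ?i = "\<lambda>p. vi p + (-1) * ui p" and ?j = "\<lambda>p. ui p + (-1) * vi p"
  note bd = bounded_family_lincomb[OF v u, of "-1"] bounded_family_lincomb[OF vi ui, of "-1"] bounded_family_lincomb[OF ui vi, of "-1"]
  have "B ?d u = B v u - B u u" using B_lincomb_left[OF v u u, of "-1"] by simp
  moreover have "B ?d ?d = B v v - 2 * B v u + B u u"
    using B_quadratic[OF v u, of "-1"] B_commute[of u v] by simp
  ultimately have "B ?d ?d \<le> 0"
    using mid G unfolding B_quadratic[OF u bd(1)] by (simp, linarith)
  then have "B ?d y = 0" if "bounded_family y" for y using B_null[OF bd(1) that] by simp
  then have uv: "B v y = B u y" if "bounded_family y" for y
    using B_lincomb_left[OF v u that, of "-1"] that by simp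
  have "0 \<le> B ?i u + (fi' - fi)"
  proof (rule first_order_nonneg)
    fix t :: real assume "0 < t" "t \<le> 1"
    then show "0 \<le> 2 * t * (B ?i u + (fi' - fi)) + t * t * B ?i ?i"
      using var[of t] G unfolding B_quadratic[OF u bd(2)] by (simp add: algebra_simps)
  qed
  then have 1: "0 \<le> B vi u - B ui u + (fi' - fi)" using B_lincomb_left[OF vi ui u, of "-1"] by simp
  have "0 \<le> B ?j v + (fi - fi')"
  proof (rule first_order_nonneg)
    fix t :: real assume "0 < t" "t \<le> 1"
    then show "0 \<le> 2 * t * (B ?j v + (fi - fi')) + t * t * B ?j ?j"
      using var'[of t] G unfolding B_quadratic[OF v bd(3)] by (simp add: algebra_simps)
  qed
  then have 2: "0 \<le> B ui v - B vi v + (fi - fi')" using B_lincomb_left[OF ui vi v, of "-1"] by simp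
  show ?thesis using 1 2 uv[OF ui] uv[OF vi] B_commute by smt
qed

end

text \<open>
  Groups a quadratic form on the doubled index set by pairs of plates.
\<close>

lemma infsum_bool_pairs:
  fixes h :: "('i \<times> bool) \<times> ('i \<times> bool) \<Rightarrow> real"
  assumes h: "h summable_on (I \<times> UNIV) \<times> (I \<times> UNIV)"
  shows "((\<lambda>(i, j). \<Sum>b\<in>UNIV. \<Sum>b'\<in>UNIV. h ((i, b), (j, b'))) has_sum infsum h ((I \<times> UNIV) \<times> (I \<times> UNIV))) (I \<times> I)"
proof -
  define g :: "('i \<times> 'i) \<times> (bool \<times> bool) \<Rightarrow> ('i \<times> bool) \<times> ('i \<times> bool)"
    where "g = (\<lambda>((i, j), (b, b')). ((i, b), (j, b')))"
  have bij: "bij_betw g ((I \<times> I) \<times> UNIV) ((I \<times> UNIV) \<times> (I \<times> UNIV))"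
    by (rule bij_betwI[where g = "\<lambda>((i, b), (j, b')). ((i, j), (b, b'))"]) (auto simp: g_def)
  have hg: "(\<lambda>(x, y). h (g (x, y))) = (\<lambda>z. h (g z))" by auto
  have s: "(\<lambda>(x, y). h (g (x, y))) summable_on ((I \<times> I) \<times> UNIV)"
    unfolding hg using summable_on_reindex_bij_betw[OF bij, of h] h by blast
  have eq: "infsum (\<lambda>y. h (g (x, y))) UNIV = (case x of (i, j) \<Rightarrow> \<Sum>b\<in>UNIV. \<Sum>b'\<in>UNIV. h ((i, b), (j, b')))" for x
    by (cases x) (simp add: g_def sum.cartesian_product case_prod_unfold)
  have "(\<lambda>x. infsum (\<lambda>y. h (g (x, y))) UNIV) summable_on (I \<times> I)"
    using summable_on_Sigma_banach[OF s] .
  moreover have "infsum (\<lambda>x. infsum (\<lambda>y. h (g (x, y))) UNIV) (I \<times> I) = infsum h ((I \<times> UNIV) \<times> (I \<times> UNIV))"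
    using infsum_Sigma'_banach[OF s] infsum_reindex_bij_betw[OF bij, of h] unfolding hg by simp
  ultimately show ?thesis unfolding has_sum_iff eq by (simp add: case_prod_unfold)
qed

section \<open>Condensers\<close>

lemma Phi_measurable: "\<psi> \<in> Phi \<Longrightarrow> \<psi> \<in> borel_measurable borel"
  by (rule borel_measurableI_greater) (simp add: Phi_def lsc_def)

lemma pdiff_SomeD: "pdiff (Some p) (Some q) = Some y \<Longrightarrow> y = p - q"
  by (auto simp: pdiff_def padd_def minus_ereal_def split: if_splits)

locale condenser_problem = lc_kernel \<kappa> c
  for \<kappa> :: "'a::t2_space kernel" and c :: real +
  fixes Ipos Ineg :: "nat set" and A :: "nat \<Rightarrow> 'a set" and f :: "nat \<Rightarrow> 'a \<rightharpoonup> ereal"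
    and a :: "nat \<Rightarrow> real" and g :: "nat \<Rightarrow> 'a \<Rightarrow> real"
  assumes cond: "condenser Ipos Ineg A"
    and field: "external_field \<kappa> Ipos Ineg f"
    and g_cont: "j \<in> Ipos \<union> Ineg \<Longrightarrow> continuous_on (A j) (g j)"
begin

definition I :: "nat set" where "I = Ipos \<union> Ineg"

definition s :: "nat \<Rightarrow> real" where "s j = (if j \<in> Ipos then 1 else -1)"

lemma alpha_s: "alpha Ipos j = ereal (s j)"
  by (simp add: alpha_def s_def one_ereal_def)

lemma s_values: "s j = 1 \<or> s j = -1"
  by (simp add: s_def)

text \<open>
  A compact space meets only finitely many plates, and every plate is nonempty.
\<close>

lemma finite_I: "c \<noteq> 0 \<Longrightarrow> finite I"
proof -
  assume "c \<noteq> 0"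
  then have "finite {i \<in> I. A i \<inter> UNIV \<noteq> {}}"
    using cond c_compact unfolding condenser_def I_def by blast
  moreover have "{i \<in> I. A i \<inter> UNIV \<noteq> {}} = I" using cond by (auto simp: condenser_def I_def)
  ultimately show "finite I" by simp
qed

lemma field_version:
  assumes "j \<in> I"
  obtains v where "v \<in> borel_measurable borel" "\<And>x y. f j x = Some y \<Longrightarrow> y = v x"
proof -
  obtain f1 f2 where "f1 \<in> Phi" "f2 \<in> Phi" and fj: "\<And>x. f j x = pdiff (Some (f1 x)) (Some (f2 x))"
    using field assms unfolding external_field_def I_def by blast
  then have [measurable]: "f1 \<in> borel_measurable borel" "f2 \<in> borel_measurable borel"
    using Phi_measurable by blast+
  show thesis
    by (rule that[of "\<lambda>x. f1 x - f2 x"]) (auto simp: fj dest: pdiff_SomeD)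
qed

lemma g_version:
  assumes "j \<in> I"
  obtains v where "v \<in> borel_measurable borel" "\<And>x y. ((\<lambda>x. Some (ereal (g j x))) |` A j) x = Some y \<Longrightarrow> y = v x"
proof -
  have "A j \<in> sets borel" using cond assms by (auto simp: condenser_def I_def)
  then have "(\<lambda>x. indicator (A j) x *\<^sub>R g j x) \<in> borel_measurable borel"
    using g_cont assms by (intro borel_measurable_continuous_on_indicator) (auto simp: I_def)
  then have "(\<lambda>x. ereal (indicator (A j) x *\<^sub>R g j x)) \<in> borel_measurable borel" by simp
  then show thesis
    by (rule that) (auto simp: restrict_map_def split: if_splits)
qed

lemma pscale_energy_real_iff:
  assumes "radon \<mu>" "radon \<nu>"
  shows "pscale (alpha Ipos i * alpha Ipos j) (energy \<kappa> \<mu> \<nu>) = Some (ereal w) \<longleftrightarrow>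
    D \<mu> \<nu> < \<infinity> \<and> w = s i * s j * e \<mu> \<nu>"
proof (cases "D \<mu> \<nu> < \<infinity>")
  case True
  then show ?thesis using energy_finite[OF assms True] by (auto simp: pscale_def alpha_s)
next
  case False
  then have "D \<mu> \<nu> = top" by (simp add: not_less top_unique)
  then have "energy \<kappa> \<mu> \<nu> = Some \<infinity>" using energy_eq[OF assms] by simp
  then show ?thesis using False s_values[of i] s_values[of j] by (auto simp: pscale_def alpha_s)
qed

lemma venergy_real_iff:
  assumes rad: "\<And>j. j \<in> I \<Longrightarrow> radon (\<mu> j)"
  shows "venergy \<kappa> Ipos Ineg \<mu> \<mu> = Some (ereal r) \<longleftrightarrow>
    (\<forall>i\<in>I. \<forall>j\<in>I. D (\<mu> i) (\<mu> j) < \<infinity>) \<and> ((\<lambda>(i, j). s i * s j * e (\<mu> i) (\<mu> j)) has_sum r) (I \<times> I)"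
proof -
  let ?h = "\<lambda>(i, j). s i * s j * e (\<mu> i) (\<mu> j)"
  have *: "(case z of (i, j) \<Rightarrow> pscale (alpha Ipos i * alpha Ipos j) (energy \<kappa> (\<mu> i) (\<mu> j))) = Some (ereal (w z))
      \<longleftrightarrow> D (\<mu> (fst z)) (\<mu> (snd z)) < \<infinity> \<and> w z = ?h z" if "z \<in> I \<times> I" for z w
    using that pscale_energy_real_iff[OF rad rad] by (auto simp: case_prod_unfold)
  have "venergy \<kappa> Ipos Ineg \<mu> \<mu> = Some (ereal r) \<longleftrightarrow>
    (\<exists>w. (\<forall>z\<in>I \<times> I. D (\<mu> (fst z)) (\<mu> (snd z)) < \<infinity> \<and> w z = ?h z) \<and> (w has_sum r) (I \<times> I))"
    unfolding venergy_def series_real_iff I_def[symmetric] by (intro ex_cong1 conj_cong ball_cong refl *)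
  also have "\<dots> \<longleftrightarrow> (\<forall>z\<in>I \<times> I. D (\<mu> (fst z)) (\<mu> (snd z)) < \<infinity>) \<and> (?h has_sum r) (I \<times> I)"
  proof (intro iffI conjI)
    assume "\<exists>w. (\<forall>z\<in>I \<times> I. D (\<mu> (fst z)) (\<mu> (snd z)) < \<infinity> \<and> w z = ?h z) \<and> (w has_sum r) (I \<times> I)"
    then obtain w where w: "\<And>z. z \<in> I \<times> I \<Longrightarrow> D (\<mu> (fst z)) (\<mu> (snd z)) < \<infinity>"
      "\<And>z. z \<in> I \<times> I \<Longrightarrow> w z = ?h z" "(w has_sum r) (I \<times> I)" by blast
    show "\<forall>z\<in>I \<times> I. D (\<mu> (fst z)) (\<mu> (snd z)) < \<infinity>" using w(1) by blast
    show "(?h has_sum r) (I \<times> I)" using w(3) has_sum_cong[of "I \<times> I" w ?h r, OF w(2)] by simp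
  qed blast
  finally show ?thesis by auto
qed

lemma admissibleD:
  assumes "\<mu> \<in> admissible \<kappa> Ipos Ineg A f a g"
  shows "\<And>j. j \<in> I \<Longrightarrow> \<mu> j \<in> Mplus (A j)" "\<And>j. j \<in> I \<Longrightarrow> radon (\<mu> j)"
    "\<And>i j. i \<in> I \<Longrightarrow> j \<in> I \<Longrightarrow> D (\<mu> i) (\<mu> j) < \<infinity>"
    "(\<lambda>(i, j). s i * s j * e (\<mu> i) (\<mu> j)) summable_on I \<times> I"
    "\<And>j. j \<in> I \<Longrightarrow> pairing ((\<lambda>x. Some (ereal (g j x))) |` A j) (\<mu> j) = Some (ereal (a j))"
    "\<exists>\<phi>. (\<forall>j\<in>I. pairing (f j) (\<mu> j) = Some (ereal (\<phi> j))) \<and> \<phi> summable_on I"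
proof -
  show M: "\<And>j. j \<in> I \<Longrightarrow> \<mu> j \<in> Mplus (A j)" using assms by (auto simp: admissible_def E_cond_def vmeasures_def I_def)
  then show rad: "\<And>j. j \<in> I \<Longrightarrow> radon (\<mu> j)" by (auto simp: Mplus_def)
  obtain r where "venergy \<kappa> Ipos Ineg \<mu> \<mu> = Some (ereal r)" using assms by (auto simp: admissible_def E_cond_def pfinite_def)
  then have "(\<forall>i\<in>I. \<forall>j\<in>I. D (\<mu> i) (\<mu> j) < \<infinity>) \<and> ((\<lambda>(i, j). s i * s j * e (\<mu> i) (\<mu> j)) has_sum r) (I \<times> I)"
    using venergy_real_iff[of \<mu> r] rad by blast
  then show "\<And>i j. i \<in> I \<Longrightarrow> j \<in> I \<Longrightarrow> D (\<mu> i) (\<mu> j) < \<infinity>" "(\<lambda>(i, j). s i * s j * e (\<mu> i) (\<mu> j)) summable_on I \<times> I"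
    by (blast intro: has_sum_imp_summable)+
  show "\<And>j. j \<in> I \<Longrightarrow> pairing ((\<lambda>x. Some (ereal (g j x))) |` A j) (\<mu> j) = Some (ereal (a j))"
    using assms by (auto simp: admissible_def I_def)
  obtain r where "field_pairing Ipos Ineg f \<mu> = Some (ereal r)" using assms by (auto simp: admissible_def pfinite_def)
  then show "\<exists>\<phi>. (\<forall>j\<in>I. pairing (f j) (\<mu> j) = Some (ereal (\<phi> j))) \<and> \<phi> summable_on I"
    unfolding field_pairing_def series_real_iff I_def[symmetric] by (auto intro: has_sum_imp_summable)
qed

text \<open>
  For \<open>c = 0\<close> the potential is nonnegative, whence the last equation; it controls the absolute
  convergence of the series of potentials.
\<close>

lemma potential_integrable:
  assumes \<mu>: "radon \<mu>" and \<nu>: "radon \<nu>" and fin: "D \<mu> \<nu> < \<infinity>"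
  defines "G \<equiv> \<lambda>x. enn2real (\<integral>\<^sup>+y. k (x, y) \<partial>\<nu>) - c * measure \<nu> UNIV"
  shows "integrable \<mu> G" "integral\<^sup>L \<mu> G = e \<mu> \<nu>" "AE x in \<mu>. (\<integral>\<^sup>+y. k (x, y) \<partial>\<nu>) < \<infinity>"
    "c = 0 \<Longrightarrow> (\<integral>x. \<bar>G x\<bar> \<partial>\<mu>) = \<bar>e \<mu> \<nu>\<bar>"
proof -
  define H where "H x = (\<integral>\<^sup>+y. k (x, y) \<partial>\<nu>)" for x
  have H[measurable]: "H \<in> borel_measurable \<mu>"
    using potential_measurable[OF \<nu>] radon_sets[OF \<mu>] measurable_cong_sets unfolding H_def by blast
  have DH: "D \<mu> \<nu> = (\<integral>\<^sup>+x. H x \<partial>\<mu>)" by (simp add: D_def H_def)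
  have AE: "AE x in \<mu>. H x \<noteq> \<infinity>" using fin unfolding DH by (intro nn_integral_PInf_AE) auto
  then show "AE x in \<mu>. (\<integral>\<^sup>+y. k (x, y) \<partial>\<nu>) < \<infinity>" by (simp add: H_def less_top)
  have "(\<integral>\<^sup>+x. ennreal (enn2real (H x)) \<partial>\<mu>) = (\<integral>\<^sup>+x. H x \<partial>\<mu>)"
    using AE by (intro nn_integral_cong_AE) (auto elim!: eventually_mono simp: less_top)
  also have "\<dots> = ennreal (enn2real (D \<mu> \<nu>))" using fin by (simp add: DH[symmetric] less_top)
  finally have HI: "integrable \<mu> (\<lambda>x. enn2real (H x))" "(\<integral>x. enn2real (H x) \<partial>\<mu>) = enn2real (D \<mu> \<nu>)"
    by (subst (asm) nn_integral_eq_integrable; simp)+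
  have CI: "integrable \<mu> (\<lambda>x. c * measure \<nu> UNIV)"
  proof (cases "c = 0")
    case False
    have "finite_measure \<mu>"
      using finite_mass[OF \<mu> False] radon_space[OF \<mu>] by (intro finite_measureI) auto
    then show ?thesis by (rule finite_measure.integrable_const)
  qed simp
  show "integrable \<mu> G" unfolding G_def H_def[symmetric] using HI CI by simp
  show "integral\<^sup>L \<mu> G = e \<mu> \<nu>"
    unfolding G_def H_def[symmetric] e_def using HI CI radon_space[OF \<mu>] by simp
  show "(\<integral>x. \<bar>G x\<bar> \<partial>\<mu>) = \<bar>e \<mu> \<nu>\<bar>" if "c = 0"
  proof -
    have z: "c * p = 0" "c * p * q = 0" for p q using that by auto
    show ?thesis using HI(2) unfolding G_def H_def[symmetric] e_def z by simp
  qed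
qed

text \<open>
  The series of potentials is integrated term by term. Its absolute convergence in mean comes
  from the row of the energy series if \<open>c = 0\<close>, and otherwise the series is finite.
\<close>

lemma weighted_potential_pairing:
  assumes rad: "\<And>j. j \<in> I \<Longrightarrow> radon (\<mu> j)" and i: "i \<in> I"
    and fin: "\<And>j. j \<in> I \<Longrightarrow> D (\<mu> i) (\<mu> j) < \<infinity>"
    and summ: "(\<lambda>j. s i * s j * e (\<mu> i) (\<mu> j)) summable_on I"
    and \<phi>: "pairing (f i) (\<mu> i) = Some (ereal \<phi>)"
  shows "pairing (weighted_potential \<kappa> Ipos Ineg f \<mu> i) (\<mu> i) =
    Some (ereal ((\<Sum>\<^sub>\<infinity>j\<in>I. s i * s j * e (\<mu> i) (\<mu> j)) + \<phi>))"
proof -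
  define G where "G j x = enn2real (\<integral>\<^sup>+y. k (x, y) \<partial>\<mu> j) - c * measure (\<mu> j) UNIV" for j x
  define h where "h j x = (if j \<in> I then s i * s j * G j x else 0)" for j x
  note pot = potential_integrable[OF rad[OF i] rad fin, folded G_def]
  have Gint: "integrable (\<mu> i) (G j)" "integral\<^sup>L (\<mu> i) (G j) = e (\<mu> i) (\<mu> j)" if "j \<in> I" for j
    using pot(1,2)[OF that that] unfolding G_def by auto
  have hint: "integrable (\<mu> i) (h j)" for j
    unfolding h_def using Gint(1) by (cases "j \<in> I") auto
  have hval: "integral\<^sup>L (\<mu> i) (h j) = (if j \<in> I then s i * s j * e (\<mu> i) (\<mu> j) else 0)" for j
    unfolding h_def using Gint by (cases "j \<in> I") auto
  have hsum: "summable (\<lambda>j. \<integral>x. norm (h j x) \<partial>\<mu> i)"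
  proof (cases "c = 0")
    case False
    show ?thesis by (rule summable_finite[OF finite_I[OF False]]) (simp add: h_def)
  next
    case True
    have "(\<integral>x. norm (h j x) \<partial>\<mu> i) = (if j \<in> I then norm (s i * s j * e (\<mu> i) (\<mu> j)) else 0)" for j
      using pot(4)[OF _ _ True] s_values[of i] s_values[of j] unfolding h_def G_def by (auto simp: abs_mult)
    moreover have "(\<lambda>j. if j \<in> I then norm (s i * s j * e (\<mu> i) (\<mu> j)) else 0) summable_on UNIV"
      using summ[THEN summable_on_iff_abs_summable_on_real[THEN iffD1]]
      by (rule summable_on_cong_neutral[THEN iffD1, rotated -1]) auto
    ultimately show ?thesis by (simp add: summable_on_imp_summable)
  qed
  have AEsum: "AE x in \<mu> i. summable (\<lambda>j. norm (h j x))"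
  proof -
    have [measurable]: "h j \<in> borel_measurable (\<mu> i)" for j using hint by simp
    have "(\<integral>\<^sup>+x. (\<Sum>j. ennreal (norm (h j x))) \<partial>\<mu> i) = (\<Sum>j. \<integral>\<^sup>+x. ennreal (norm (h j x)) \<partial>\<mu> i)"
      by (rule nn_integral_suminf) measurable
    also have "\<dots> = (\<Sum>j. ennreal (\<integral>x. norm (h j x) \<partial>\<mu> i))"
      using hint by (intro suminf_cong nn_integral_eq_integral) auto
    also have "\<dots> \<noteq> \<infinity>" using hsum by (simp add: suminf_ennreal2)
    finally have "AE x in \<mu> i. (\<Sum>j. ennreal (norm (h j x))) \<noteq> \<infinity>"
      by (intro nn_integral_PInf_AE) measurable
    then show ?thesis by eventually_elim (rule summable_suminf_not_top, auto)
  qed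
  (* enn2real sends infinity to 0, so G is the potential only where all potentials are finite. *)
  have AEfin: "AE x in \<mu> i. \<forall>j\<in>I. (\<integral>\<^sup>+y. k (x, y) \<partial>\<mu> j) < \<infinity>"
    using pot(3) by (subst AE_ball_countable) auto
  obtain w where w: "AE x in \<mu> i. f i x = Some (ereal (w x))" "integrable (\<mu> i) w" "integral\<^sup>L (\<mu> i) w = \<phi>"
    using \<phi> unfolding pairing_real_iff by blast
  define V where "V x = (\<Sum>j. h j x)" for x
  have "AE x in \<mu> i. vpotential \<kappa> Ipos Ineg \<mu> i x = Some (ereal (V x))"
    using AEsum AEfin
  proof eventually_elim
    case (elim x)
    have "((\<lambda>j. h j x) has_sum V x) UNIV"
      unfolding V_def
      by (rule norm_summable_imp_has_sum[OF elim(1) summable_sums[OF summable_norm_cancel[OF elim(1)]]])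
    then have "((\<lambda>j. s i * s j * G j x) has_sum V x) I"
      by (rule has_sum_cong_neutral[THEN iffD1, rotated -1]) (auto simp: h_def)
    moreover have "pscale (alpha Ipos i * alpha Ipos j) (potential \<kappa> (\<mu> j) x) = Some (ereal (s i * s j * G j x))" if j: "j \<in> I" for j
    proof -
      have "(\<integral>\<^sup>+y. k (x, y) \<partial>\<mu> j) < \<infinity>" using elim(2) j by blast
      then show ?thesis
        by (cases "\<integral>\<^sup>+y. k (x, y) \<partial>\<mu> j") (auto simp: potential_eq[OF rad[OF j]] pscale_def alpha_s G_def)
    qed
    ultimately show "vpotential \<kappa> Ipos Ineg \<mu> i x = Some (ereal (V x))"
      unfolding vpotential_def series_real_iff I_def[symmetric] by (intro exI[of _ "\<lambda>j. s i * s j * G j x"]) auto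
  qed
  then have "AE x in \<mu> i. weighted_potential \<kappa> Ipos Ineg f \<mu> i x = Some (ereal (V x + w x))"
    using w(1) by eventually_elim (simp add: weighted_potential_def padd_def)
  moreover have "integrable (\<mu> i) V" unfolding V_def by (rule integrable_suminf[OF hint AEsum hsum])
  moreover have "integral\<^sup>L (\<mu> i) V = (\<Sum>\<^sub>\<infinity>j\<in>I. s i * s j * e (\<mu> i) (\<mu> j))"
  proof -
    have "(\<lambda>j. integral\<^sup>L (\<mu> i) (h j)) sums integral\<^sup>L (\<mu> i) V"
      unfolding V_def by (rule sums_integral[OF hint AEsum hsum])
    moreover have "((\<lambda>j. integral\<^sup>L (\<mu> i) (h j)) has_sum (\<Sum>\<^sub>\<infinity>j\<in>I. s i * s j * e (\<mu> i) (\<mu> j))) UNIV"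
      using has_sum_infsum[OF summ] by (rule has_sum_cong_neutral[THEN iffD1, rotated -1]) (auto simp: hval)
    ultimately show ?thesis using has_sum_imp_sums sums_unique2 by blast
  qed
  ultimately show ?thesis
    unfolding pairing_real_iff using w by (intro exI[of _ "\<lambda>x. V x + w x"]) auto
qed

end

section \<open>Competing with mixtures of two equilibrium measures\<close>

lemma sum_Times_bool: "(\<Sum>p\<in>F \<times> UNIV. h p) = (\<Sum>i\<in>F. h (i, True) + h (i, False :: bool) :: real)"
proof -
  have "(\<Sum>p\<in>F \<times> UNIV. h p) = (\<Sum>i\<in>F. \<Sum>b\<in>UNIV. h (i, b))" by (simp add: sum.cartesian_product)
  then show ?thesis by (simp add: UNIV_bool add.commute)
qed

text \<open>
  The functions \<open>\<phi>\<close> and \<open>\<phi>'\<close> record the field terms of the components of \<open>l\<close> and \<open>l'\<close>.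
\<close>

locale condenser_pair = condenser_problem \<kappa> c Ipos Ineg A f a g
  for \<kappa> :: "'a::t2_space kernel" and c :: real and Ipos Ineg A f a g +
  fixes l l' :: "nat \<Rightarrow> 'a measure" and \<phi> \<phi>' :: "nat \<Rightarrow> real"
  assumes l: "l \<in> admissible \<kappa> Ipos Ineg A f a g" and l': "l' \<in> admissible \<kappa> Ipos Ineg A f a g"
    and \<phi>: "j \<in> I \<Longrightarrow> pairing (f j) (l j) = Some (ereal (\<phi> j))" "\<phi> summable_on I"
    and \<phi>': "j \<in> I \<Longrightarrow> pairing (f j) (l' j) = Some (ereal (\<phi>' j))" "\<phi>' summable_on I"
begin

text \<open>
  The two families as one, indexed by plate and side: \<open>(j, False)\<close> stands for \<open>l j\<close> and
  \<open>(j, True)\<close> for \<open>l' j\<close>. The energy of every mixture is then a value of one quadratic form.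
\<close>

definition \<nu> :: "nat \<times> bool \<Rightarrow> 'a measure" where
  "\<nu> p = (if snd p then l' (fst p) else l (fst p))"

definition J :: "(nat \<times> bool) set" where "J = I \<times> UNIV"

definition M :: "nat \<times> bool \<Rightarrow> nat \<times> bool \<Rightarrow> real" where "M p q = e (\<nu> p) (\<nu> q)"

lemma radon_\<nu>: "p \<in> J \<Longrightarrow> radon (\<nu> p)"
  using admissibleD(2)[OF l] admissibleD(2)[OF l'] by (auto simp: \<nu>_def J_def)

lemma D_\<nu>_self: "p \<in> J \<Longrightarrow> D (\<nu> p) (\<nu> p) < \<infinity>"
  using admissibleD(3)[OF l] admissibleD(3)[OF l'] by (auto simp: \<nu>_def J_def)

lemma D_\<nu>: "p \<in> J \<Longrightarrow> q \<in> J \<Longrightarrow> D (\<nu> p) (\<nu> q) < \<infinity>"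
  by (rule energy_cross(1)[OF radon_\<nu> radon_\<nu> D_\<nu>_self D_\<nu>_self])

lemma M_psd:
  assumes "finite F" "F \<subseteq> J"
  shows "0 \<le> (\<Sum>p\<in>F. \<Sum>q\<in>F. x p * x q * M p q)"
proof -
  have "radon (\<nu> p)" "D (\<nu> p) (\<nu> p) < \<infinity>" if "p \<in> F" for p
    using radon_\<nu>[OF subsetD[OF assms(2) that]] D_\<nu>_self[OF subsetD[OF assms(2) that]] .
  then show ?thesis unfolding M_def by (rule energy_form_nonneg[OF assms(1)])
qed

lemma sum_energy_le:
  fixes \<mu> :: "nat \<Rightarrow> 'a measure"
  assumes c: "c = 0" and \<mu>: "\<mu> \<in> admissible \<kappa> Ipos Ineg A f a g" and F: "finite F" "F \<subseteq> I"
  shows "(\<Sum>i\<in>F. \<Sum>j\<in>F. e (\<mu> i) (\<mu> j)) \<le> (\<Sum>\<^sub>\<infinity>z\<in>I \<times> I. norm (case z of (i, j) \<Rightarrow> s i * s j * e (\<mu> i) (\<mu> j)))"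
proof -
  have "(\<Sum>i\<in>F. \<Sum>j\<in>F. e (\<mu> i) (\<mu> j)) \<le> (\<Sum>z\<in>F \<times> F. norm (case z of (i, j) \<Rightarrow> s i * s j * e (\<mu> i) (\<mu> j)))"
    unfolding sum.cartesian_product
  proof (rule sum_mono)
    fix z :: "nat \<times> nat"
    obtain i j where z: "z = (i, j)" by (cases z)
    have "\<bar>s i * s j * e (\<mu> i) (\<mu> j)\<bar> = \<bar>e (\<mu> i) (\<mu> j)\<bar>"
      using s_values[of i] s_values[of j] by (auto simp: abs_mult)
    then show "(case z of (i, j) \<Rightarrow> e (\<mu> i) (\<mu> j)) \<le> norm (case z of (i, j) \<Rightarrow> s i * s j * e (\<mu> i) (\<mu> j))"
      unfolding z by simp
  qed
  also have "\<dots> \<le> (\<Sum>\<^sub>\<infinity>z\<in>I \<times> I. norm (case z of (i, j) \<Rightarrow> s i * s j * e (\<mu> i) (\<mu> j)))"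
    using F admissibleD(4)[OF \<mu>, THEN summable_on_iff_abs_summable_on_real[THEN iffD1]]
    by (intro finite_sum_le_infsum) auto
  finally show ?thesis .
qed

text \<open>
  Admissibility bounds the mutual energies within \<open>l\<close> and within \<open>l'\<close>. Those across are bounded
  by testing positive semidefiniteness with the coefficients \<open>\<plusminus>1\<close>: the entries \<open>M p q\<close> are nonnegative
  if \<open>c = 0\<close>, and the factor \<open>1 + x p x q\<close> is \<open>2\<close> within a family and \<open>0\<close> across.
\<close>

lemma M_summable: "(\<lambda>(p, q). M p q) summable_on J \<times> J"
proof (cases "c = 0")
  case False
  then show ?thesis using finite_I by (intro summable_on_finite) (auto simp: J_def)
next
  case c: True
  have z: "c * p * q = 0" for p q using c by simp
  have M0: "0 \<le> M p q" for p q unfolding M_def e_def z by simp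
  let ?C = "\<lambda>\<mu> :: nat \<Rightarrow> 'a measure. \<Sum>\<^sub>\<infinity>z\<in>I \<times> I. norm (case z of (i, j) \<Rightarrow> s i * s j * e (\<mu> i) (\<mu> j))"
  show ?thesis
  proof (rule nonneg_bdd_above_summable_on)
    show "0 \<le> (case z of (p, q) \<Rightarrow> M p q)" for z using M0 by (cases z) auto
    show "bdd_above (sum (\<lambda>(p, q). M p q) ` {T. T \<subseteq> J \<times> J \<and> finite T})"
    proof (rule bdd_aboveI2)
      fix T assume "T \<in> {T. T \<subseteq> J \<times> J \<and> finite T}"
      then have T: "T \<subseteq> J \<times> J" "finite T" by auto
      define F where "F = fst ` fst ` T \<union> fst ` snd ` T"
      have F: "finite F" "F \<subseteq> I" using T by (auto simp: F_def J_def)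
      have TF: "T \<subseteq> (F \<times> UNIV) \<times> (F \<times> UNIV)" unfolding F_def by force
      define x :: "nat \<times> bool \<Rightarrow> real" where "x p = (if snd p then 1 else -1)" for p
      have "sum (\<lambda>(p, q). M p q) T \<le> (\<Sum>p\<in>F \<times> UNIV. \<Sum>q\<in>F \<times> UNIV. M p q)"
        unfolding sum.cartesian_product using F M0 TF by (intro sum_mono2) auto
      also have "\<dots> \<le> (\<Sum>p\<in>F \<times> UNIV. \<Sum>q\<in>F \<times> UNIV. M p q) + (\<Sum>p\<in>F \<times> UNIV. \<Sum>q\<in>F \<times> UNIV. x p * x q * M p q)"
        using M_psd[of "F \<times> UNIV" x] F by (auto simp: J_def)
      also have "\<dots> = (\<Sum>p\<in>F \<times> UNIV. \<Sum>q\<in>F \<times> UNIV. (1 + x p * x q) * M p q)"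
        by (simp add: sum.distrib distrib_right)
      also have "\<dots> = (\<Sum>i\<in>F. \<Sum>j\<in>F. 2 * M (i, True) (j, True) + 2 * M (i, False) (j, False))"
        unfolding sum_Times_bool by (simp add: x_def sum.distrib)
      also have "\<dots> = 2 * (\<Sum>i\<in>F. \<Sum>j\<in>F. e (l' i) (l' j)) + 2 * (\<Sum>i\<in>F. \<Sum>j\<in>F. e (l i) (l j))"
        by (simp add: M_def \<nu>_def sum.distrib sum_distrib_left)
      also have "\<dots> \<le> 2 * ?C l' + 2 * ?C l"
        using sum_energy_le[OF c l F] sum_energy_le[OF c l' F] by (intro add_mono mult_left_mono) auto
      finally show "sum (\<lambda>(p, q). M p q) T \<le> 2 * ?C l' + 2 * ?C l" .
    qed
  qed
qed

sublocale psd_form J M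
proof
  show "M p q = M q p" if "p \<in> J" "q \<in> J" for p q
    unfolding M_def using that by (intro e_commute radon_\<nu>)
qed (rule M_summable M_psd)+

definition mixture :: "(nat \<Rightarrow> real) \<Rightarrow> nat \<Rightarrow> 'a measure" where
  "mixture t j = comb UNIV (\<lambda>b. if b then t j else 1 - t j) (\<lambda>b. \<nu> (j, b))"

text \<open>
  The coefficients of the signed measure of the mixture with respect to \<open>\<nu>\<close>; the sign \<open>s\<close> of
  the plate is part of them.
\<close>

definition coef :: "(nat \<Rightarrow> real) \<Rightarrow> nat \<times> bool \<Rightarrow> real" where
  "coef t = (\<lambda>(j, b). s j * (if b then t j else 1 - t j))"

lemma bounded_coef:
  assumes "\<And>j. 0 \<le> t j \<and> t j \<le> 1"
  shows "bounded_family (coef t)"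
  unfolding bounded_family_def
proof (intro exI allI)
  fix p show "\<bar>coef t p\<bar> \<le> 1"
    using assms[of "fst p"] s_values[of "fst p"] by (cases p) (auto simp: coef_def abs_mult)
qed

lemma mixture_energy:
  assumes t: "\<And>j. 0 \<le> t j \<and> t j \<le> 1"
  shows "venergy \<kappa> Ipos Ineg (mixture t) (mixture t) = Some (ereal (B (coef t) (coef t)))"
proof -
  let ?w = "\<lambda>j b. if b then t j else 1 - t j"
  have rad: "radon (\<nu> (j, b))" if "j \<in> I" for j b using radon_\<nu>[of "(j, b)"] that by (simp add: J_def)
  have radm: "radon (mixture t j)" if "j \<in> I" for j
    unfolding mixture_def using rad[OF that] by (intro radon_comb) auto
  have ee: "D (mixture t i) (mixture t j) < \<infinity> \<and>
      e (mixture t i) (mixture t j) = (\<Sum>b\<in>UNIV. \<Sum>b'\<in>UNIV. ?w i b * ?w j b' * M (i, b) (j, b'))"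
    if "i \<in> I" "j \<in> I" for i j
  proof -
    have w: "0 \<le> ?w i b" for i b using t[of i] by simp
    have "D (\<nu> (i, b)) (\<nu> (j, b')) < \<infinity>" for b b' using D_\<nu> that by (auto simp: J_def)
    then show ?thesis
      unfolding mixture_def M_def
      using e_comb_comb[of "UNIV :: bool set" "UNIV :: bool set" "\<lambda>b. \<nu> (i, b)" "\<lambda>b. \<nu> (j, b)" "?w i" "?w j"]
        rad[OF that(1)] rad[OF that(2)] w by auto
  qed
  define h where "h = (\<lambda>(p, q). coef t p * coef t q * M p q)"
  have "h summable_on (I \<times> UNIV) \<times> (I \<times> UNIV)"
    unfolding h_def J_def[symmetric] by (intro summable_B bounded_coef t)
  note hs' = infsum_bool_pairs[OF this]
  have "infsum h ((I \<times> UNIV) \<times> (I \<times> UNIV)) = B (coef t) (coef t)"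
    by (simp only: B_def h_def J_def[symmetric])
  then have hs: "((\<lambda>(i, j). \<Sum>b\<in>UNIV. \<Sum>b'\<in>UNIV. h ((i, b), (j, b'))) has_sum B (coef t) (coef t)) (I \<times> I)"
    using hs' by simp
  have "((\<lambda>(i, j). s i * s j * e (mixture t i) (mixture t j)) has_sum B (coef t) (coef t)) (I \<times> I)"
  proof (rule has_sum_cong[THEN iffD2, OF _ hs])
    fix z assume "z \<in> I \<times> I"
    then obtain i j where z: "z = (i, j)" "i \<in> I" "j \<in> I" by auto
    show "(case z of (i, j) \<Rightarrow> s i * s j * e (mixture t i) (mixture t j)) =
        (case z of (i, j) \<Rightarrow> \<Sum>b\<in>UNIV. \<Sum>b'\<in>UNIV. h ((i, b), (j, b')))"
      using ee[OF z(2,3)] by (simp add: z(1) h_def coef_def sum_distrib_left mult.assoc mult.left_commute)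
  qed
  moreover have "\<forall>i\<in>I. \<forall>j\<in>I. D (mixture t i) (mixture t j) < \<infinity>" using ee by blast
  ultimately show ?thesis using venergy_real_iff[of "mixture t"] radm by blast
qed

lemma mixture_pairing:
  assumes t: "\<And>j. 0 \<le> t j \<and> t j \<le> 1" and j: "j \<in> I"
    and v: "v \<in> borel_measurable borel" and uv: "\<And>x y. u x = Some y \<Longrightarrow> y = v x"
    and r: "pairing u (l j) = Some (ereal r)" and r': "pairing u (l' j) = Some (ereal r')"
  shows "pairing u (mixture t j) = Some (ereal ((1 - t j) * r + t j * r'))"
proof -
  have "sets (\<nu> (j, b)) = sets borel" for b using radon_sets[OF radon_\<nu>, of "(j, b)"] j by (simp add: J_def)
  then have "pairing u (mixture t j) = Some (ereal (\<Sum>b\<in>UNIV. (if b then t j else 1 - t j) * (if b then r' else r)))"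
    unfolding mixture_def using t[of j] r r' by (intro pairing_comb[OF _ _ _ v uv]) (auto simp: \<nu>_def)
  then show ?thesis by (simp add: UNIV_bool add.commute)
qed

lemma mixture_admissible:
  assumes t: "\<And>j. 0 \<le> t j \<and> t j \<le> 1" and F: "((\<lambda>j. (1 - t j) * \<phi> j + t j * \<phi>' j) has_sum F) I"
  shows "mixture t \<in> admissible \<kappa> Ipos Ineg A f a g"
    "weighted_energy \<kappa> Ipos Ineg f (mixture t) = Some (ereal (B (coef t) (coef t) + 2 * F))"
proof -
  have "mixture t j \<in> Mplus (A j)" if "j \<in> I" for j
    unfolding mixture_def using admissibleD(1)[OF l that] admissibleD(1)[OF l' that]
    by (intro Mplus_comb) (auto simp: \<nu>_def)
  then have vm: "mixture t \<in> vmeasures Ipos Ineg A" by (simp add: vmeasures_def I_def)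
  have g: "pairing ((\<lambda>x. Some (ereal (g j x))) |` A j) (mixture t j) = Some (ereal (a j))" if j: "j \<in> I" for j
  proof -
    obtain v where v: "v \<in> borel_measurable borel" "\<And>x y. ((\<lambda>x. Some (ereal (g j x))) |` A j) x = Some y \<Longrightarrow> y = v x"
      using g_version[OF j] by metis
    show ?thesis
      using mixture_pairing[OF t j v admissibleD(5)[OF l j] admissibleD(5)[OF l' j]] by (simp add: algebra_simps)
  qed
  have fj: "pairing (f j) (mixture t j) = Some (ereal ((1 - t j) * \<phi> j + t j * \<phi>' j))" if j: "j \<in> I" for j
  proof -
    obtain v where v: "v \<in> borel_measurable borel" "\<And>x y. f j x = Some y \<Longrightarrow> y = v x"
      using field_version[OF j] by metis
    show ?thesis by (rule mixture_pairing[OF t j v \<phi>(1)[OF j] \<phi>'(1)[OF j]])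
  qed
  have fp: "field_pairing Ipos Ineg f (mixture t) = Some (ereal F)"
    unfolding field_pairing_def series_real_iff I_def[symmetric]
    by (intro exI[of _ "\<lambda>j. (1 - t j) * \<phi> j + t j * \<phi>' j"] conjI ballI fj F)
  note ve = mixture_energy[OF t]
  show "mixture t \<in> admissible \<kappa> Ipos Ineg A f a g"
    using vm g fp ve by (auto simp: admissible_def E_cond_def pfinite_def I_def)
  show "weighted_energy \<kappa> Ipos Ineg f (mixture t) = Some (ereal (B (coef t) (coef t) + 2 * F))"
    unfolding weighted_energy_def ve fp by (simp add: pscale_def padd_def)
qed

lemma mixture_ends:
  assumes "j \<in> I"
  shows "t j = 0 \<Longrightarrow> mixture t j = l j" "t j = 1 \<Longrightarrow> mixture t j = l' j"
proof -
  have sets: "sets (\<nu> (j, b)) = sets borel" for b using radon_sets[OF radon_\<nu>, of "(j, b)"] assms by (simp add: J_def)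
  have "sets (l j) = sets borel" "sets (l' j) = sets borel" using sets[of False] sets[of True] by (auto simp: \<nu>_def)
  then show "t j = 0 \<Longrightarrow> mixture t j = l j" "t j = 1 \<Longrightarrow> mixture t j = l' j"
    unfolding mixture_def using sets
    by (auto intro!: measure_eqI simp: emeasure_comb UNIV_bool) (auto simp: \<nu>_def)
qed

lemma weighted_energy_end:
  fixes \<mu> :: "nat \<Rightarrow> 'a measure"
  assumes t: "\<And>j. 0 \<le> t j \<and> t j \<le> 1" and \<mu>: "\<And>j. j \<in> I \<Longrightarrow> mixture t j = \<mu> j"
    and rad: "\<And>j. j \<in> I \<Longrightarrow> radon (\<mu> j)"
    and \<psi>: "\<And>j. j \<in> I \<Longrightarrow> pairing (f j) (\<mu> j) = Some (ereal (\<psi> j))" "\<psi> summable_on I"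
  shows "weighted_energy \<kappa> Ipos Ineg f \<mu> = Some (ereal (B (coef t) (coef t) + 2 * infsum \<psi> I))"
proof -
  have radm: "radon (mixture t j)" if "j \<in> I" for j using \<mu>[OF that] rad[OF that] by simp
  have *: "(\<forall>i\<in>I. \<forall>j\<in>I. D (mixture t i) (mixture t j) < \<infinity>) \<and>
      ((\<lambda>(i, j). s i * s j * e (mixture t i) (mixture t j)) has_sum B (coef t) (coef t)) (I \<times> I)"
    by (rule venergy_real_iff[THEN iffD1, OF _ mixture_energy[OF t]]) (rule radm)
  have "((\<lambda>(i, j). s i * s j * e (\<mu> i) (\<mu> j)) has_sum B (coef t) (coef t)) (I \<times> I)"
    by (rule has_sum_cong[THEN iffD1, OF _ conjunct2[OF *]]) (auto simp: \<mu>)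
  moreover have "\<forall>i\<in>I. \<forall>j\<in>I. D (\<mu> i) (\<mu> j) < \<infinity>" using conjunct1[OF *] \<mu> by auto
  ultimately have ve: "venergy \<kappa> Ipos Ineg \<mu> \<mu> = Some (ereal (B (coef t) (coef t)))"
    by (intro venergy_real_iff[THEN iffD2] conjI rad)
  have fp: "field_pairing Ipos Ineg f \<mu> = Some (ereal (infsum \<psi> I))"
    unfolding field_pairing_def series_real_iff I_def[symmetric] using \<psi> by (intro exI[of _ \<psi>]) auto
  show ?thesis unfolding weighted_energy_def ve fp by (simp add: pscale_def padd_def)
qed

lemma has_sum_update:
  fixes q :: real
  assumes "\<psi> summable_on I" "i \<in> I"
  shows "((\<lambda>j. \<psi> j + (if j = i then q else 0)) has_sum (infsum \<psi> I + q)) I"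
proof -
  have "((\<lambda>j. if j = i then q else 0) has_sum q) {i}" by (rule has_sum_finiteI) auto
  then have "((\<lambda>j. if j = i then q else 0) has_sum q) I"
    by (rule has_sum_cong_neutral[THEN iffD1, rotated -1]) (use assms in auto)
  then show ?thesis by (intro has_sum_add has_sum_infsum assms)
qed

lemma B_component:
  assumes "i \<in> I" and "\<And>j. x (j, b) = s j" and "\<And>j. x (j, \<not> b) = 0"
  shows "B (\<lambda>p. if p = (i, b) then s i else 0) x = (\<Sum>\<^sub>\<infinity>j\<in>I. s i * s j * e (\<nu> (i, b)) (\<nu> (j, b)))"
proof -
  have "(\<Sum>\<^sub>\<infinity>q\<in>J. x q * M (i, b) q) = (\<Sum>\<^sub>\<infinity>q\<in>I \<times> {b}. x q * M (i, b) q)"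
  proof (rule infsum_cong_neutral)
    fix q assume "q \<in> J - I \<times> {b}"
    then have "q = (fst q, \<not> b)" by (auto simp: J_def)
    then show "x q * M (i, b) q = 0" using assms(3)[of "fst q"] by simp
  qed (auto simp: J_def)
  also have "\<dots> = (\<Sum>\<^sub>\<infinity>j\<in>I. x (j, b) * M (i, b) (j, b))"
    by (rule infsum_reindex_bij_betw[symmetric]) (auto simp: bij_betw_def inj_on_def)
  finally show ?thesis
    using B_delta[of "(i, b)" "s i" x] assms(1,2)
    by (simp add: J_def[symmetric] M_def infsum_cmult_right'[symmetric] mult.assoc) (simp add: J_def)
qed

text \<open>
  The coefficients \<open>u\<close>, \<open>v\<close> belong to \<open>t = 0\<close> and \<open>t = 1\<close>, that is, to \<open>l\<close> and \<open>l'\<close>. The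
  midpoint is the mixture with constant \<open>t = 1/2\<close>, and the variations of component \<open>i\<close> are
  mixtures that differ from \<open>t = 0\<close> or \<open>t = 1\<close> only at \<open>i\<close>.
\<close>

lemma equilibrium_interaction:
  assumes i: "i \<in> I"
    and G: "weighted_energy \<kappa> Ipos Ineg f l = Some (ereal G)" "weighted_energy \<kappa> Ipos Ineg f l' = Some (ereal G)"
    and min: "\<And>\<mu> w. \<mu> \<in> admissible \<kappa> Ipos Ineg A f a g \<Longrightarrow> weighted_energy \<kappa> Ipos Ineg f \<mu> = Some (ereal w) \<Longrightarrow> G \<le> w"
  shows "(\<Sum>\<^sub>\<infinity>j\<in>I. s i * s j * e (l i) (l j)) + \<phi> i = (\<Sum>\<^sub>\<infinity>j\<in>I. s i * s j * e (l' i) (l' j)) + \<phi>' i"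
proof -
  let ?F = "infsum \<phi> I" and ?F' = "infsum \<phi>' I"
  let ?u = "coef (\<lambda>_. 0)" and ?v = "coef (\<lambda>_. 1)"
  let ?ui = "\<lambda>p. if p = (i, False) then s i else 0" and ?vi = "\<lambda>p. if p = (i, True) then s i else 0"
  have comp: "G \<le> B (coef t) (coef t) + 2 * F"
    if "\<And>j. 0 \<le> t j \<and> t j \<le> 1" "((\<lambda>j. (1 - t j) * \<phi> j + t j * \<phi>' j) has_sum F) I" for t F
    using min mixture_admissible[OF that] by blast
  have bdi: "bounded_family (\<lambda>p. if p = q then s i else 0)" for q
    unfolding bounded_family_def using s_values[of i] by (intro exI[of _ 1]) auto
  have "B ?ui ?u + \<phi> i = B ?vi ?v + \<phi>' i"
  proof (rule variational_equality[where G = G and F = ?F and F' = ?F'])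
    show "bounded_family ?u" "bounded_family ?v" by (auto intro!: bounded_coef)
    show "bounded_family ?ui" "bounded_family ?vi" by (rule bdi)+
    have "weighted_energy \<kappa> Ipos Ineg f l = Some (ereal (B ?u ?u + 2 * ?F))"
      by (rule weighted_energy_end[OF _ mixture_ends(1) admissibleD(2)[OF l] \<phi>]) auto
    then show "B ?u ?u + 2 * ?F = G" using G by simp
    have "weighted_energy \<kappa> Ipos Ineg f l' = Some (ereal (B ?v ?v + 2 * ?F'))"
      by (rule weighted_energy_end[OF _ mixture_ends(2) admissibleD(2)[OF l'] \<phi>']) auto
    then show "B ?v ?v + 2 * ?F' = G" using G by simp
    have "((\<lambda>j. (1 - 1/2) * \<phi> j + 1/2 * \<phi>' j) has_sum ((1 - 1/2) * ?F + 1/2 * ?F')) I"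
      by (intro has_sum_add has_sum_cmult_right has_sum_infsum \<phi> \<phi>')
    from comp[OF _ this]
    have "G \<le> B (coef (\<lambda>_. 1/2)) (coef (\<lambda>_. 1/2)) + (?F + ?F')" by simp
    moreover have "coef (\<lambda>_. 1/2) = (\<lambda>p. ?u p + 1/2 * (?v p + (-1) * ?u p))"
      by (auto simp: coef_def fun_eq_iff)
    ultimately show "G \<le> B (\<lambda>p. ?u p + 1/2 * (?v p + (-1) * ?u p)) (\<lambda>p. ?u p + 1/2 * (?v p + (-1) * ?u p)) + (?F + ?F')"
      by simp
  next
    fix t :: real assume t: "0 < t" "t \<le> 1"
    let ?t = "\<lambda>j. if j = i then t else 0"
    have "(\<lambda>j. (1 - ?t j) * \<phi> j + ?t j * \<phi>' j) = (\<lambda>j. \<phi> j + (if j = i then t * (\<phi>' i - \<phi> i) else 0))"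
      by (auto simp: fun_eq_iff algebra_simps)
    then have "G \<le> B (coef ?t) (coef ?t) + 2 * (?F + t * (\<phi>' i - \<phi> i))"
      using t by (intro comp) (auto intro!: has_sum_update \<phi> i)
    moreover have "coef ?t = (\<lambda>p. ?u p + t * (?vi p + (-1) * ?ui p))"
      by (auto simp: coef_def fun_eq_iff algebra_simps)
    ultimately show "G \<le> B (\<lambda>p. ?u p + t * (?vi p + (-1) * ?ui p)) (\<lambda>p. ?u p + t * (?vi p + (-1) * ?ui p))
        + 2 * ?F + 2 * t * (\<phi>' i - \<phi> i)"
      by (simp add: algebra_simps)
    let ?t = "\<lambda>j. if j = i then 1 - t else 1"
    have "(\<lambda>j. (1 - ?t j) * \<phi> j + ?t j * \<phi>' j) = (\<lambda>j. \<phi>' j + (if j = i then t * (\<phi> i - \<phi>' i) else 0))"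
      by (auto simp: fun_eq_iff algebra_simps)
    then have "G \<le> B (coef ?t) (coef ?t) + 2 * (?F' + t * (\<phi> i - \<phi>' i))"
      using t by (intro comp) (auto intro!: has_sum_update \<phi>' i)
    moreover have "coef ?t = (\<lambda>p. ?v p + t * (?ui p + (-1) * ?vi p))"
      by (auto simp: coef_def fun_eq_iff algebra_simps)
    ultimately show "G \<le> B (\<lambda>p. ?v p + t * (?ui p + (-1) * ?vi p)) (\<lambda>p. ?v p + t * (?ui p + (-1) * ?vi p))
        + 2 * ?F' + 2 * t * (\<phi> i - \<phi>' i)"
      by (simp add: algebra_simps)
  qed
  moreover have "B ?ui ?u = (\<Sum>\<^sub>\<infinity>j\<in>I. s i * s j * e (l i) (l j))"
    using B_component[of i ?u False] i by (simp add: coef_def \<nu>_def)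
  moreover have "B ?vi ?v = (\<Sum>\<^sub>\<infinity>j\<in>I. s i * s j * e (l' i) (l' j))"
    using B_component[of i ?v True] i by (simp add: coef_def \<nu>_def)
  ultimately show ?thesis by simp
qed

end

text \<open>
  On a compact space the open sets \<open>{\<kappa> > -n}\<close> cover the product, so finitely many of them do.
\<close>

lemma Phi_bounded_below:
  fixes \<kappa> :: "('a::topological_space) kernel"
  assumes "\<kappa> \<in> Phi"
  obtains c :: real where "0 \<le> c" "\<And>z. 0 \<le> \<kappa> z + ereal c" "c \<noteq> 0 \<Longrightarrow> compact (UNIV :: 'a set)"
proof (cases "\<forall>z. 0 \<le> \<kappa> z")
  case True
  then show thesis by (intro that[of 0]) (auto simp: zero_ereal_def[symmetric])
next
  case False
  then have UU: "compact (UNIV :: ('a \<times> 'a) set)" using assms unfolding Phi_def by blast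
  have op: "open {z. ereal (- real n) < \<kappa> z}" for n using assms by (simp add: Phi_def lsc_def)
  have "UNIV \<subseteq> (\<Union>n::nat. {z. ereal (- real n) < \<kappa> z})"
  proof
    fix z
    have "\<kappa> z \<noteq> - \<infinity>" using assms unfolding Phi_def by blast
    then obtain n :: nat where "ereal (- real n) < \<kappa> z"
    proof (cases "\<kappa> z")
      case (real r)
      then show ?thesis using that reals_Archimedean2[of "- r"] by (metis ereal_less_eq(3) linorder_not_le minus_less_iff)
    qed auto
    then show "z \<in> (\<Union>n::nat. {z. ereal (- real n) < \<kappa> z})" by auto
  qed
  then obtain N where N: "finite N" "UNIV \<subseteq> (\<Union>n\<in>N. {z. ereal (- real n) < \<kappa> z})"
    using compactE_image[OF UU, of UNIV "\<lambda>n. {z. ereal (- real n) < \<kappa> z}"] op by auto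
  define m where "m = Max (insert 0 N)"
  have "0 \<le> \<kappa> z + ereal (real m)" for z
  proof -
    obtain n where n: "n \<in> N" "ereal (- real n) < \<kappa> z" using N(2) by auto
    have "n \<le> m" unfolding m_def using n(1) N(1) by (intro Max_ge) auto
    then show ?thesis using n(2) by (cases "\<kappa> z") auto
  qed
  moreover have "compact (UNIV :: 'a set)"
    using compact_continuous_image[OF continuous_on_fst[OF continuous_on_id] UU] by simp
  ultimately show thesis by (intro that[of "real m"]) auto
qed

theorem corollary7p2:
  fixes \<kappa> :: "'a::t2_space \<times> 'a \<Rightarrow> ereal"
    and Ipos Ineg :: "nat set"
    and A :: "nat \<Rightarrow> 'a set"
    and f :: "nat \<Rightarrow> 'a \<rightharpoonup> ereal"
    and a :: "nat \<Rightarrow> real"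
    and g :: "nat \<Rightarrow> 'a \<Rightarrow> real"
    and l l' :: "nat \<Rightarrow> 'a measure"
    and i :: nat
  assumes "locally_compact_space (euclidean :: 'a topology)"
    and "\<kappa> \<in> Phi" and "positive_definite \<kappa>"
    and "condenser Ipos Ineg A"
    and "external_field \<kappa> Ipos Ineg f"
    and "\<And>j. j \<in> Ipos \<union> Ineg \<Longrightarrow> a j > 0"
    and "\<And>j. j \<in> Ipos \<union> Ineg \<Longrightarrow> continuous_on (A j) (g j) \<and> (\<forall>x\<in>A j. g j x > 0)"
    and "l \<in> equilibrium_measures \<kappa> Ipos Ineg A f a g"
    and "l' \<in> equilibrium_measures \<kappa> Ipos Ineg A f a g"
    and "i \<in> Ipos \<union> Ineg"
  shows "pairing (weighted_potential \<kappa> Ipos Ineg f l i) (l i) \<noteq> None \<and>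
    pairing (weighted_potential \<kappa> Ipos Ineg f l i) (l i) =
    pairing (weighted_potential \<kappa> Ipos Ineg f l' i) (l' i)"
proof -
  obtain c where c: "0 \<le> c" "\<And>z. 0 \<le> \<kappa> z + ereal c" "c \<noteq> 0 \<Longrightarrow> compact (UNIV :: 'a set)"
    using Phi_bounded_below[OF assms(2)] by metis
  interpret condenser_problem \<kappa> c Ipos Ineg A f a g
    by unfold_locales (use assms c in auto)
  have i: "i \<in> I" using assms(10) by (simp add: I_def)
  have adm: "l \<in> admissible \<kappa> Ipos Ineg A f a g" "l' \<in> admissible \<kappa> Ipos Ineg A f a g"
    and m: "weighted_energy \<kappa> Ipos Ineg f l = Some (min_weighted_energy \<kappa> Ipos Ineg A f a g)"
      "weighted_energy \<kappa> Ipos Ineg f l' = Some (min_weighted_energy \<kappa> Ipos Ineg A f a g)"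
    using assms(8,9) by (auto simp: equilibrium_measures_def)
  obtain \<phi> where \<phi>: "\<And>j. j \<in> I \<Longrightarrow> pairing (f j) (l j) = Some (ereal (\<phi> j))" "\<phi> summable_on I"
    using admissibleD(6)[OF adm(1)] by blast
  obtain \<phi>' where \<phi>': "\<And>j. j \<in> I \<Longrightarrow> pairing (f j) (l' j) = Some (ereal (\<phi>' j))" "\<phi>' summable_on I"
    using admissibleD(6)[OF adm(2)] by blast
  interpret condenser_pair \<kappa> c Ipos Ineg A f a g l l' \<phi> \<phi>'
    by unfold_locales (use adm \<phi> \<phi>' in auto)
  have "weighted_energy \<kappa> Ipos Ineg f l = Some (ereal (B (coef (\<lambda>_. 0)) (coef (\<lambda>_. 0)) + 2 * infsum \<phi> I))"
    by (rule weighted_energy_end[OF _ mixture_ends(1) admissibleD(2)[OF adm(1)] \<phi>]) auto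
  then obtain G where G: "min_weighted_energy \<kappa> Ipos Ineg A f a g = ereal G" using m by simp
  have min: "G \<le> w" if "\<mu> \<in> admissible \<kappa> Ipos Ineg A f a g" "weighted_energy \<kappa> Ipos Ineg f \<mu> = Some (ereal w)" for \<mu> w
  proof -
    have "ereal G \<le> the (weighted_energy \<kappa> Ipos Ineg f \<mu>)"
      unfolding G[symmetric] min_weighted_energy_def using that(1) by (rule INF_lower)
    then show ?thesis using that(2) by simp
  qed
  have "pairing (weighted_potential \<kappa> Ipos Ineg f \<mu> i) (\<mu> i) = Some (ereal ((\<Sum>\<^sub>\<infinity>j\<in>I. s i * s j * e (\<mu> i) (\<mu> j)) + \<psi> i))"
    if \<mu>: "\<mu> \<in> admissible \<kappa> Ipos Ineg A f a g" and \<psi>: "pairing (f i) (\<mu> i) = Some (ereal (\<psi> i))" for \<mu> \<psi>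
  proof (rule weighted_potential_pairing[where \<mu> = \<mu> and \<phi> = "\<psi> i"])
    show "radon (\<mu> j)" "D (\<mu> i) (\<mu> j) < \<infinity>" if "j \<in> I" for j
      using admissibleD(2,3)[OF \<mu>] i that by auto
    show "(\<lambda>j. s i * s j * e (\<mu> i) (\<mu> j)) summable_on I"
      using summable_on_SigmaD1[OF admissibleD(4)[OF \<mu>] i] by simp
  qed (rule i \<psi>)+
  note pairing_value = this
  have "(\<Sum>\<^sub>\<infinity>j\<in>I. s i * s j * e (l i) (l j)) + \<phi> i = (\<Sum>\<^sub>\<infinity>j\<in>I. s i * s j * e (l' i) (l' j)) + \<phi>' i"
    by (rule equilibrium_interaction[OF i m[unfolded G]]) (rule min)
  then show ?thesis using pairing_value[of l \<phi>, OF adm(1) \<phi>(1)[OF i]] pairing_value[of l' \<phi>', OF adm(2) \<phi>'(1)[OF i]] by simp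
qed

end
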